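(* Let $\mathcal{C}$ be a W$^*$-category and $(A_i)_{i\in I}$ a family of objects of $\mathcal{C}$ indexed by an arbitrary set $I$. For an object $A\in\mathcal{C}$ the following are equivalent: (1) $A$ is an $I$-indexed direct sum of $(A_i)_{i\in I}$, i.e. there is a natural isomorphism $\mathcal{C}(A,B)\cong\bigoplus_i\mathcal{C}(A_i,B)$ in $B\in\mathcal{C}$ whose components are isometric linear isomorphisms of Banach spaces. (2) There is a family of morphisms $(\kappa_j\colon A_j\to A)_{j\in I}$ with $\sum_j\kappa_j\kappa_j^*<\infty$ such that for every object $B$ and every family $(f_j\colon A_j\to B)_{j\in I}$ with $\sum_j f_jf_j^*<\infty$ there is a unique $f\colon A\to B$ with $f\kappa_j=f_j$ for all $j\in I$, and moreover this $f$ satisfies $\|f\|^2=\bigl\|\sum_j f_jf_j^*\bigr\|$. (3) There is a family of morphisms $(\kappa_j\colon A_j\to A)_{j\in I}$ with $\kappa_i^*\kappa_j=\delta_{ij}$ (meaning $1_{A_i}$ if $i=j$ and $0$ otherwise) for all $i,j\in I$, and $\sum_{j\in I}\kappa_j\kappa_j^*=1_A$ (sum converging ultraweakly in the W$^*$-algebra $\mathcal{C}(A,A)$).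
   Context: A C$^*$-category is a category $\mathcal{C}$ with complex-vector-space hom-sets and bilinear composition, an identity-on-objects involutive conjugate-linear contravariant functor $a\mapsto a^*$ (with $a^*a=b^*b$ for some $b\colon A\to A$ whenever $a\colon A\to B$, and $a^*a=0\Rightarrow a=0$), such that every hom-set is a Banach space, $\|ab\|\le\|a\|\|b\|$, and $\|a\|^2=\|a^*a\|$. A W$^*$-category is a C$^*$-category in which every hom-set has a Banach-space predual; equivalently, each $\mathcal{C}(A,A)$ is a W$^*$-algebra and each $\mathcal{C}(A,B)$ is self-dual as a Hilbert $\mathcal{C}(A,A)$-module with inner product $\langle a,b\rangle=a^*b$. For objects $A_i$ and $B$, $\bigoplus_i\mathcal{C}(A_i,B):=\{(f_i\colon A_i\to B)_{i\in I}:\sum_i f_if_i^*<\infty\}$, where $\sum_i f_if_i^*<\infty$ means the finite partial sums are bounded (equivalently the sum of these positive elements converges ultraweakly in $\mathcal{C}(B,B)$); it is a Banach space with norm $\|(f_i)\|:=\|\sum_i f_if_i^*\|^{1/2}$, and is functorial in $B$ via $g\colon B\to C\mapsto ((f_i)\mapsto(gf_i))$. *)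

theory Defs
  imports "HOL-Analysis.Analysis" "HOL-Library.FuncSet"
begin

text \<open>A (possibly large) category with objects of type 'o and morphisms of type 'm.
  All elements of type 'o are objects.  cmp g f is the composite g f (first f, then g).
  Each hom-set carries complex vector space operations hadd, hsmul with zero hzero A B,
  an involution adj (the star operation) and a norm nrm.\<close>

record ('o,'m) wcat =
  Hom   :: "'o \<Rightarrow> 'o \<Rightarrow> 'm set"
  cmp   :: "'m \<Rightarrow> 'm \<Rightarrow> 'm"
  idm   :: "'o \<Rightarrow> 'm"
  adj   :: "'m \<Rightarrow> 'm"
  hadd  :: "'m \<Rightarrow> 'm \<Rightarrow> 'm"
  hsmul :: "complex \<Rightarrow> 'm \<Rightarrow> 'm"
  hzero :: "'o \<Rightarrow> 'o \<Rightarrow> 'm"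
  nrm   :: "'m \<Rightarrow> real"

definition category_axioms :: "('o,'m) wcat \<Rightarrow> bool" where
  "category_axioms C \<longleftrightarrow>
     (\<forall>A B A' B' f. f \<in> Hom C A B \<longrightarrow> f \<in> Hom C A' B' \<longrightarrow> A = A' \<and> B = B') \<and>
     (\<forall>A B D f g. f \<in> Hom C A B \<longrightarrow> g \<in> Hom C B D \<longrightarrow> cmp C g f \<in> Hom C A D) \<and>
     (\<forall>A B D E f g h. f \<in> Hom C A B \<longrightarrow> g \<in> Hom C B D \<longrightarrow> h \<in> Hom C D E \<longrightarrow>
        cmp C h (cmp C g f) = cmp C (cmp C h g) f) \<and>
     (\<forall>A. idm C A \<in> Hom C A A) \<and>
     (\<forall>A B f. f \<in> Hom C A B \<longrightarrow> cmp C f (idm C A) = f \<and> cmp C (idm C B) f = f)"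

definition vector_space_axioms :: "('o,'m) wcat \<Rightarrow> bool" where
  "vector_space_axioms C \<longleftrightarrow>
    (\<forall>A B. hzero C A B \<in> Hom C A B \<and>
      (\<forall>x\<in>Hom C A B. \<forall>y\<in>Hom C A B. \<forall>z\<in>Hom C A B. \<forall>a b.
         hadd C x y \<in> Hom C A B \<and> hsmul C a x \<in> Hom C A B \<and>
         hadd C (hadd C x y) z = hadd C x (hadd C y z) \<and>
         hadd C x y = hadd C y x \<and>
         hadd C x (hzero C A B) = x \<and>
         hadd C x (hsmul C (-1) x) = hzero C A B \<and>
         hsmul C a (hsmul C b x) = hsmul C (a * b) x \<and>
         hsmul C 1 x = x \<and>
         hsmul C a (hadd C x y) = hadd C (hsmul C a x) (hsmul C a y) \<and>
         hsmul C (a + b) x = hadd C (hsmul C a x) (hsmul C b x)))"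

definition bilinear_comp :: "('o,'m) wcat \<Rightarrow> bool" where
  "bilinear_comp C \<longleftrightarrow>
    (\<forall>A B D. \<forall>f\<in>Hom C A B. \<forall>f'\<in>Hom C A B. \<forall>g\<in>Hom C B D. \<forall>g'\<in>Hom C B D. \<forall>c.
       cmp C g (hadd C f f') = hadd C (cmp C g f) (cmp C g f') \<and>
       cmp C (hadd C g g') f = hadd C (cmp C g f) (cmp C g' f) \<and>
       cmp C g (hsmul C c f) = hsmul C c (cmp C g f) \<and>
       cmp C (hsmul C c g) f = hsmul C c (cmp C g f))"

definition involution_axioms :: "('o,'m) wcat \<Rightarrow> bool" where
  "involution_axioms C \<longleftrightarrow>
    (\<forall>A. adj C (idm C A) = idm C A) \<and>
    (\<forall>A B. \<forall>f\<in>Hom C A B. \<forall>f'\<in>Hom C A B. \<forall>c.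
       adj C f \<in> Hom C B A \<and> adj C (adj C f) = f \<and>
       adj C (hadd C f f') = hadd C (adj C f) (adj C f') \<and>
       adj C (hsmul C c f) = hsmul C (cnj c) (adj C f) \<and>
       (\<exists>b\<in>Hom C A A. cmp C (adj C f) f = cmp C (adj C b) b) \<and>
       (cmp C (adj C f) f = hzero C A A \<longrightarrow> f = hzero C A B)) \<and>
    (\<forall>A B D. \<forall>f\<in>Hom C A B. \<forall>g\<in>Hom C B D. adj C (cmp C g f) = cmp C (adj C f) (adj C g))"

definition norm_axioms :: "('o,'m) wcat \<Rightarrow> bool" where
  "norm_axioms C \<longleftrightarrow>
    (\<forall>A B. (\<forall>x\<in>Hom C A B. \<forall>y\<in>Hom C A B. \<forall>c.
        0 \<le> nrm C x \<and> (nrm C x = 0 \<longleftrightarrow> x = hzero C A B) \<and>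
        nrm C (hadd C x y) \<le> nrm C x + nrm C y \<and>
        nrm C (hsmul C c x) = cmod c * nrm C x) \<and>
      (\<forall>s. (\<forall>n. s n \<in> Hom C A B) \<longrightarrow>
         (\<forall>e>0. \<exists>N. \<forall>m\<ge>N. \<forall>n\<ge>N. nrm C (hadd C (s m) (hsmul C (-1) (s n))) < e) \<longrightarrow>
         (\<exists>x\<in>Hom C A B. (\<lambda>n. nrm C (hadd C (s n) (hsmul C (-1) x))) \<longlonglongrightarrow> 0))) \<and>
    (\<forall>A B D. \<forall>f\<in>Hom C A B. \<forall>g\<in>Hom C B D. nrm C (cmp C g f) \<le> nrm C g * nrm C f) \<and>
    (\<forall>A B. \<forall>a\<in>Hom C A B. (nrm C a)\<^sup>2 = nrm C (cmp C (adj C a) a))"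

definition cstar_cat :: "('o,'m) wcat \<Rightarrow> bool" where
  "cstar_cat C \<longleftrightarrow> category_axioms C \<and> vector_space_axioms C \<and> bilinear_comp C \<and>
     involution_axioms C \<and> norm_axioms C"

definition blf :: "('o,'m) wcat \<Rightarrow> 'o \<Rightarrow> 'o \<Rightarrow> ('m \<Rightarrow> complex) \<Rightarrow> bool" where
  "blf C A B \<phi> \<longleftrightarrow>
     (\<forall>x. x \<notin> Hom C A B \<longrightarrow> \<phi> x = 0) \<and>
     (\<forall>x\<in>Hom C A B. \<forall>y\<in>Hom C A B. \<phi> (hadd C x y) = \<phi> x + \<phi> y) \<and>
     (\<forall>c. \<forall>x\<in>Hom C A B. \<phi> (hsmul C c x) = c * \<phi> x) \<and>
     (\<exists>K. \<forall>x\<in>Hom C A B. cmod (\<phi> x) \<le> K * nrm C x)"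

definition fnorm :: "('o,'m) wcat \<Rightarrow> 'o \<Rightarrow> 'o \<Rightarrow> ('m \<Rightarrow> complex) \<Rightarrow> real" where
  "fnorm C A B \<phi> = (SUP x\<in>{x\<in>Hom C A B. nrm C x \<le> 1}. cmod (\<phi> x))"

text \<open>P is a Banach-space predual of Hom A B, realised (canonically) as a norm-closed subspace
  of the dual of Hom A B such that the evaluation map identifies Hom A B isometrically
  with the dual space of P.\<close>
definition is_predual :: "('o,'m) wcat \<Rightarrow> 'o \<Rightarrow> 'o \<Rightarrow> ('m \<Rightarrow> complex) set \<Rightarrow> bool" where
  "is_predual C A B P \<longleftrightarrow>
     P \<subseteq> {\<phi>. blf C A B \<phi>} \<and> (\<lambda>x. 0) \<in> P \<and>
     (\<forall>\<phi>\<in>P. \<forall>\<psi>\<in>P. (\<lambda>x. \<phi> x + \<psi> x) \<in> P) \<and>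
     (\<forall>c. \<forall>\<phi>\<in>P. (\<lambda>x. c * \<phi> x) \<in> P) \<and>
     (\<forall>s \<phi>. (\<forall>n. s n \<in> P) \<longrightarrow> blf C A B \<phi> \<longrightarrow>
         (\<lambda>n. fnorm C A B (\<lambda>x. s n x - \<phi> x)) \<longlonglongrightarrow> 0 \<longrightarrow> \<phi> \<in> P) \<and>
     (\<forall>\<Psi> :: ('m \<Rightarrow> complex) \<Rightarrow> complex.
         (\<forall>\<phi>\<in>P. \<forall>\<psi>\<in>P. \<Psi> (\<lambda>x. \<phi> x + \<psi> x) = \<Psi> \<phi> + \<Psi> \<psi>) \<longrightarrow>
         (\<forall>c. \<forall>\<phi>\<in>P. \<Psi> (\<lambda>x. c * \<phi> x) = c * \<Psi> \<phi>) \<longrightarrow>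
         (\<exists>K. \<forall>\<phi>\<in>P. cmod (\<Psi> \<phi>) \<le> K * fnorm C A B \<phi>) \<longrightarrow>
         (\<exists>x\<in>Hom C A B. \<forall>\<phi>\<in>P. \<Psi> \<phi> = \<phi> x)) \<and>
     (\<forall>x\<in>Hom C A B. nrm C x = (SUP \<phi>\<in>{\<phi>\<in>P. fnorm C A B \<phi> \<le> 1}. cmod (\<phi> x)))"

definition wstar_cat :: "('o,'m) wcat \<Rightarrow> bool" where
  "wstar_cat C \<longleftrightarrow> cstar_cat C \<and> (\<forall>A B. \<exists>P. is_predual C A B P)"

definition fsum :: "('o,'m) wcat \<Rightarrow> 'o \<Rightarrow> 'i set \<Rightarrow> ('i \<Rightarrow> 'm) \<Rightarrow> 'm" where
  "fsum C B F g = Finite_Set.fold (\<lambda>i acc. hadd C (g i) acc) (hzero C B B) F"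

text \<open>Sum of positive elements is finite: finite partial sums are bounded.\<close>
definition bdd_sum :: "('o,'m) wcat \<Rightarrow> 'o \<Rightarrow> 'i set \<Rightarrow> ('i \<Rightarrow> 'm) \<Rightarrow> bool" where
  "bdd_sum C B I g \<longleftrightarrow> (\<exists>K. \<forall>F. finite F \<and> F \<subseteq> I \<longrightarrow> nrm C (fsum C B F g) \<le> K)"

definition uw_has_sum :: "('o,'m) wcat \<Rightarrow> 'o \<Rightarrow> 'i set \<Rightarrow> ('i \<Rightarrow> 'm) \<Rightarrow> 'm \<Rightarrow> bool" where
  "uw_has_sum C B I g s \<longleftrightarrow> s \<in> Hom C B B \<and>
     (\<forall>P. is_predual C B B P \<longrightarrow> (\<forall>\<phi>\<in>P. ((\<lambda>i. \<phi> (g i)) has_sum \<phi> s) I))"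

definition uw_sum :: "('o,'m) wcat \<Rightarrow> 'o \<Rightarrow> 'i set \<Rightarrow> ('i \<Rightarrow> 'm) \<Rightarrow> 'm" where
  "uw_sum C B I g = (THE s. uw_has_sum C B I g s)"

definition dsum :: "('o,'m) wcat \<Rightarrow> 'i set \<Rightarrow> ('i \<Rightarrow> 'o) \<Rightarrow> 'o \<Rightarrow> ('i \<Rightarrow> 'm) set" where
  "dsum C I Ai B = {f \<in> (\<Pi>\<^sub>E i\<in>I. Hom C (Ai i) B).
      bdd_sum C B I (\<lambda>i. cmp C (f i) (adj C (f i)))}"

definition dsum_norm :: "('o,'m) wcat \<Rightarrow> 'i set \<Rightarrow> 'o \<Rightarrow> ('i \<Rightarrow> 'm) \<Rightarrow> real" where
  "dsum_norm C I B f = sqrt (nrm C (uw_sum C B I (\<lambda>i. cmp C (f i) (adj C (f i)))))"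

definition is_direct_sum :: "('o,'m) wcat \<Rightarrow> 'i set \<Rightarrow> ('i \<Rightarrow> 'o) \<Rightarrow> 'o \<Rightarrow> bool" where
  "is_direct_sum C I Ai A \<longleftrightarrow>
    (\<exists>\<Phi> :: 'o \<Rightarrow> 'm \<Rightarrow> ('i \<Rightarrow> 'm).
      (\<forall>B. bij_betw (\<Phi> B) (Hom C A B) (dsum C I Ai B)) \<and>
      (\<forall>B. \<forall>x\<in>Hom C A B. \<forall>y\<in>Hom C A B.
         \<Phi> B (hadd C x y) = (\<lambda>i\<in>I. hadd C (\<Phi> B x i) (\<Phi> B y i))) \<and>
      (\<forall>B c. \<forall>x\<in>Hom C A B. \<Phi> B (hsmul C c x) = (\<lambda>i\<in>I. hsmul C c (\<Phi> B x i))) \<and>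
      (\<forall>B. \<forall>x\<in>Hom C A B. dsum_norm C I B (\<Phi> B x) = nrm C x) \<and>
      (\<forall>B B'. \<forall>g\<in>Hom C B B'. \<forall>x\<in>Hom C A B.
         \<Phi> B' (cmp C g x) = (\<lambda>i\<in>I. cmp C g (\<Phi> B x i))))"

end

theory Submission
  imports Defs
begin

text \<open>(1) and (2) are related by the Yoneda lemma: \<open>\<kappa>\<close> is the image of \<open>1\<^sub>A\<close>.

  Partial sums of bounded sums of positive endomorphisms have weak cluster points by
  Banach-Alaoglu. Positivity of bounded elements is a condition on norms, so it survives weak limits;
  hence every cluster point is the supremum of the partial sums, and the sum converges ultraweakly.

  (2) to (3): extending the family \<open>(\<delta>\<^sub>i\<^sub>j)\<^sub>j\<close> along \<open>\<kappa>\<close> yields contractions \<open>g\<^sub>i\<close> with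
  \<open>g\<^sub>i \<kappa>\<^sub>j = \<delta>\<^sub>i\<^sub>j\<close>. Each \<open>\<kappa>\<^sub>i\<close> is a contraction too, since \<open>\<kappa>\<^sub>i \<kappa>\<^sub>i\<^sup>*\<close> is at most the full sum, which has
  norm \<open>\<parallel>1\<^sub>A\<parallel>\<^sup>2\<close>; then \<open>(g\<^sub>i - \<kappa>\<^sub>i\<^sup>*) (g\<^sub>i - \<kappa>\<^sub>i\<^sup>*)\<^sup>* \<le> 0\<close> forces \<open>g\<^sub>i = \<kappa>\<^sub>i\<^sup>*\<close>. The sum of the \<open>\<kappa>\<^sub>i \<kappa>\<^sub>i\<^sup>*\<close>
  agrees with \<open>1\<^sub>A\<close> on every \<open>\<kappa>\<^sub>j\<close>, so it is \<open>1\<^sub>A\<close> by uniqueness.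

  (3) to (2): the morphism \<open>g\<close> is a weak cluster point of the partial sums of \<open>\<Sum>\<^sub>i f\<^sub>i \<kappa>\<^sub>i\<^sup>*\<close>.
  Separate weak continuity of the composition is needed only for projections, where it follows from
  an orthogonality estimate of norms. If \<open>d \<kappa>\<^sub>j = 0\<close> for all \<open>j\<close>, then \<open>h = d\<^sup>* d\<close> is orthogonal to the
  partial sums of \<open>1\<^sub>A\<close>, so \<open>\<parallel>n + h\<parallel>\<^sup>2 \<le> n\<^sup>2 + \<parallel>h\<parallel>\<^sup>2\<close> for all real \<open>n\<close>, and \<open>h = 0\<close>.\<close>

section \<open>Order in unital C*-algebras\<close>

text \<open>The obstacle is that a predual belongs to one hom-set as a Banach space: nothing relates
  it to composition, involution or order, and \<open>uw_has_sum\<close> quantifies over all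
  preduals. What does pass to a weak limit is a bound on the norm of \<open>y k + w\<close>, with
  \<open>w\<close> fixed and the bound uniform in \<open>k\<close>. Three properties are therefore
  recast in this form: self-adjointness as \<open>norm (a + n i)^2 \<le> K^2 + n^2\<close> for all
  real \<open>n\<close>, positivity of a self-adjoint \<open>a\<close> as
  \<open>norm (a - t) \<le> t\<close> for a single \<open>t\<close> above the norm, and annihilation
  of a projection as a Pythagorean bound. In the first and the third, \<open>n\<close> tends to
  infinity: the terms quadratic in \<open>n\<close> cancel, so the linear cross term has to vanish.
  Since positivity is defined by its norm condition, the order theory is built without spectra.
  Square roots come from the binomial series, and the fact that a root commutes with whatever
  commutes with the given element takes the place of a functional calculus.\<close>

text \<open>Unital C*-algebras as real algebras with a central square root \<open>imag\<close> of -1. The axiom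
  \<open>0 \<noteq> 1\<close> is not imposed, which is why \<open>real_normed_algebra_1\<close> is avoided.\<close>

class cstar_algebra = real_normed_algebra + banach + monoid_mult +
  fixes star :: "'a \<Rightarrow> 'a" and imag :: 'a
  assumes star_add: "star (x + y) = star x + star y"
    and star_scaleR: "star (r *\<^sub>R x) = r *\<^sub>R star x"
    and star_mult: "star (x * y) = star y * star x"
    and star_star [simp]: "star (star x) = x"
    and norm_star_mult_self: "norm (star x * x) = (norm x)\<^sup>2"
    and imag_mult_imag: "imag * imag = - 1"
    and imag_commute: "imag * x = x * imag"
    and star_imag: "star imag = - imag"

lemma star_zero [simp]: "star (0::'a::cstar_algebra) = 0"
  using star_scaleR[of 0 "0::'a"] by simp

lemma star_minus: "star (- x) = - star x" for x :: "'a::cstar_algebra"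
  using star_scaleR[of "-1" x] by simp

lemma star_diff: "star (x - y) = star x - star y" for x :: "'a::cstar_algebra"
  using star_add[of x "- y"] star_minus by simp

lemma star_one [simp]: "star (1::'a::cstar_algebra) = 1"
  by (metis mult_1_left mult_1_right star_mult star_star)

lemma norm_star [simp]: "norm (star x) = norm x" for x :: "'a::cstar_algebra"
proof -
  have le: "norm x \<le> norm (star x)" for x :: 'a
  proof (cases "norm x = 0")
    case False
    have "norm x * norm x \<le> norm (star x) * norm x"
      using norm_star_mult_self[of x] norm_mult_ineq[of "star x" x] by (simp add: power2_eq_square)
    with False show ?thesis by simp
  qed simp
  from le[of x] le[of "star x"] show ?thesis by simp
qed

lemma norm_mult_star_self: "norm (x * star x) = (norm x)\<^sup>2" for x :: "'a::cstar_algebra"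
  using norm_star_mult_self[of "star x"] by simp

lemma norm_one_le: "norm (1::'a::cstar_algebra) \<le> 1"
proof -
  have "norm (1::'a) * norm (1::'a) = norm (1::'a)"
    using norm_star_mult_self[of "1::'a"] by (simp add: power2_eq_square)
  then have "norm (1::'a) = 0 \<or> norm (1::'a) = 1"
    by (simp only: mult_cancel_right2)
  then show ?thesis by linarith
qed

lemma norm_scaleR_one_le: "t \<ge> 0 \<Longrightarrow> norm (t *\<^sub>R (1::'a::cstar_algebra)) \<le> t"
  using norm_one_le[where 'a='a] by (simp add: mult_left_le)

lemmas star_simps = star_add star_scaleR star_mult star_minus star_diff star_imag

lemma norm_power_le_one:
  fixes x :: "'a::cstar_algebra"
  assumes "norm x \<le> 1"
  shows "norm (x ^ n) \<le> 1"
proof (induction n)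
  case (Suc n)
  have "norm (x ^ Suc n) \<le> norm x * norm (x ^ n)" by (simp add: norm_mult_ineq)
  also have "\<dots> \<le> 1 * 1" using assms Suc by (intro mult_mono) auto
  finally show ?case by simp
qed (simp add: norm_one_le)

lemma star_power: "star (x ^ n) = star x ^ n" for x :: "'a::cstar_algebra"
  by (induction n) (simp_all add: star_mult power_commutes)

lemma bounded_linear_star: "bounded_linear (star :: 'a::cstar_algebra \<Rightarrow> 'a)"
  by (rule bounded_linear_intro[where K=1]) (simp_all add: star_simps)

text \<open>For self-adjoint \<open>a\<close> the inequality says that the spectrum lies in the
  interval from 0 to \<open>2 t\<close>, so this is the usual notion of positivity, expressed by
  norms alone.\<close>

definition pos :: "'a::cstar_algebra \<Rightarrow> bool" where
  "pos a \<longleftrightarrow> star a = a \<and> (\<exists>t\<ge>0. norm (t *\<^sub>R 1 - a) \<le> t)"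

lemma pos_star: "pos a \<Longrightarrow> star a = a"
  by (simp add: pos_def)

lemma pos_bound_mono:
  fixes a :: "'a::cstar_algebra"
  assumes "norm (t *\<^sub>R 1 - a) \<le> t" "t \<le> t'"
  shows "norm (t' *\<^sub>R 1 - a) \<le> t'"
proof -
  have "t' *\<^sub>R 1 - a = (t' - t) *\<^sub>R 1 + (t *\<^sub>R 1 - a)" by (simp add: algebra_simps)
  also have "norm \<dots> \<le> (t' - t) + t"
    using assms by (intro norm_triangle_mono norm_scaleR_one_le) auto
  finally show ?thesis by simp
qed

lemma pos_zero [simp]: "pos 0"
  by (auto simp: pos_def intro: exI[of _ 0])

lemma pos_add:
  assumes "pos a" "pos b"
  shows "pos (a + b)"
proof -
  obtain s t where st: "s \<ge> 0" "norm (s *\<^sub>R 1 - a) \<le> s" "t \<ge> 0" "norm (t *\<^sub>R 1 - b) \<le> t"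
    using assms by (auto simp: pos_def)
  have "(s + t) *\<^sub>R 1 - (a + b) = (s *\<^sub>R 1 - a) + (t *\<^sub>R 1 - b)" by (simp add: algebra_simps)
  then have "norm ((s + t) *\<^sub>R 1 - (a + b)) \<le> s + t"
    using st norm_triangle_mono by metis
  then show ?thesis using assms st unfolding pos_def
    by (auto simp: star_simps intro!: exI[of _ "s + t"])
qed

lemma pos_scaleR:
  assumes "pos a" "r \<ge> 0"
  shows "pos (r *\<^sub>R a)"
proof -
  obtain t where t: "t \<ge> 0" "norm (t *\<^sub>R 1 - a) \<le> t" using assms by (auto simp: pos_def)
  have "(r * t) *\<^sub>R 1 - r *\<^sub>R a = r *\<^sub>R (t *\<^sub>R 1 - a)" by (simp add: algebra_simps)
  then have "norm ((r * t) *\<^sub>R 1 - r *\<^sub>R a) \<le> r * t"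
    using t assms by (simp add: mult_left_mono)
  then show ?thesis using assms t unfolding pos_def
    by (auto simp: star_simps intro!: exI[of _ "r * t"])
qed

lemma pos_scaleR_one_diff:
  fixes a :: "'a::cstar_algebra"
  assumes "star a = a" "norm a \<le> t"
  shows "pos (t *\<^sub>R 1 - a)"
  unfolding pos_def using assms norm_ge_zero[of a]
  by (auto simp: star_simps simp del: norm_ge_zero intro!: exI[of _ t])

section \<open>Square roots of positive elements\<close>

text \<open>All coefficients of \<open>sqrt (1 - x)\<close> after the constant term 1 are
  nonpositive. The sum of their moduli is thus 1 minus a partial sum of the series at
  \<open>x = 1\<close>, and that partial sum has a nonnegative closed form. This gives absolute
  convergence on the whole closed unit ball.\<close>

lemma sum_abs_half_gbinomial_le:
  "(\<Sum>k\<in>{1..n}. \<bar>(1/2 gchoose k) * (-1) ^ k\<bar>) \<le> (1::real)"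
proof -
  have neg: "(1/2 gchoose Suc k) * (-1) ^ Suc k \<le> (0::real)" for k
  proof -
    have "(-1) ^ k * ((-1/2::real) gchoose k) \<ge> 0"
    proof -
      have "(-1) ^ k * ((-1/2::real) gchoose k) = pochhammer (1/2) k / fact k"
        by (simp add: gbinomial_pochhammer flip: mult.assoc power_mult_distrib)
      then show ?thesis by (simp add: pochhammer_nonneg)
    qed
    moreover have "(1/2 gchoose Suc k) = (1/2) / of_nat (Suc k) * ((-1/2::real) gchoose k)"
      using Suc_times_gbinomial[of k "-1/2::real"] by (simp add: field_simps)
    ultimately show ?thesis
      by (simp add: mult.commute mult_nonneg_nonneg zero_le_divide_iff)
  qed
  have "(\<Sum>k\<in>{1..n}. \<bar>(1/2 gchoose k) * (-1) ^ k\<bar>) = - (\<Sum>k\<in>{1..n}. (1/2 gchoose k) * (-1) ^ k :: real)"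
    unfolding sum_negf[symmetric]
  proof (rule sum.cong[OF refl])
    fix k assume "k \<in> {1..n}"
    then obtain m where "k = Suc m" by (auto simp: Suc_le_eq gr0_conv_Suc)
    with neg[of m] show "\<bar>(1/2 gchoose k) * (-1) ^ k\<bar> = - ((1/2 gchoose k) * (-1) ^ k :: real)"
      by simp
  qed
  also have "\<dots> = 1 - (\<Sum>k\<le>n. (1/2 gchoose k) * (-1) ^ k :: real)"
    by (simp add: atMost_atLeast0 sum.atLeast_Suc_atMost)
  also have "(\<Sum>k\<le>n. (1/2 gchoose k) * (-1) ^ k :: real) = (-1) ^ n * (-1/2 gchoose n)"
    using gbinomial_sum_lower_neg[of "1/2::real" n] by simp
  also have "\<dots> = pochhammer (1/2) n / fact n"
    by (simp add: gbinomial_pochhammer flip: mult.assoc power_mult_distrib)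
  finally show ?thesis
    by (simp add: pochhammer_nonneg)
qed

text \<open>The second bound concerns the series without its constant term 1. It says that the root
  \<open>r\<close> satisfies \<open>norm (1 - r) \<le> 1\<close>, which is positivity of
  \<open>r\<close> with witness 1.\<close>

lemma summable_norm_half_gbinomial:
  fixes x :: "'a::cstar_algebra"
  assumes "norm x \<le> 1"
  shows "summable (\<lambda>n. norm (((1/2 gchoose n) * (-1) ^ n) *\<^sub>R x ^ n))"
    and "norm (\<Sum>n. ((1/2 gchoose Suc n) * (-1) ^ Suc n) *\<^sub>R x ^ Suc n) \<le> 1"
proof -
  define c :: "nat \<Rightarrow> real" where "c n = (1/2 gchoose n) * (-1) ^ n" for n
  have le: "norm (c n *\<^sub>R x ^ n) \<le> \<bar>c n\<bar>" for n
    using norm_power_le_one[OF assms, of n] by (simp add: mult_left_le)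
  have part: "(\<Sum>k<n. \<bar>c (Suc k)\<bar>) \<le> 1" for n
  proof -
    have "(\<Sum>k<n. \<bar>c (Suc k)\<bar>) = (\<Sum>k\<in>{1..n}. \<bar>c k\<bar>)"
      by (rule sum.reindex_bij_witness[where i="\<lambda>k. k - 1" and j=Suc]) auto
    then show ?thesis using sum_abs_half_gbinomial_le[of n] by (simp add: c_def)
  qed
  have sumS: "summable (\<lambda>n. \<bar>c (Suc n)\<bar>)"
    by (rule summableI_nonneg_bounded[where x=1]) (use part in auto)
  then have "summable (\<lambda>n. \<bar>c n\<bar>)" using summable_Suc_iff by blast
  then have "summable (\<lambda>n. norm (c n *\<^sub>R x ^ n))"
    by (rule summable_comparison_test[rotated]) (use le in auto)
  then show "summable (\<lambda>n. norm (((1/2 gchoose n) * (-1) ^ n) *\<^sub>R x ^ n))"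
    by (simp add: c_def)
  have sn: "summable (\<lambda>n. norm (c (Suc n) *\<^sub>R x ^ Suc n))"
    by (rule summable_comparison_test[OF _ sumS]) (use le in \<open>auto simp del: power_Suc\<close>)
  have "norm (\<Sum>n. c (Suc n) *\<^sub>R x ^ Suc n) \<le> (\<Sum>n. norm (c (Suc n) *\<^sub>R x ^ Suc n))"
    by (rule summable_norm[OF sn])
  also have "\<dots> \<le> (\<Sum>n. \<bar>c (Suc n)\<bar>)"
    by (rule suminf_le[OF le sn sumS])
  also have "\<dots> \<le> 1"
    by (rule suminf_le_const[OF sumS part])
  finally show "norm (\<Sum>n. ((1/2 gchoose Suc n) * (-1) ^ Suc n) *\<^sub>R x ^ Suc n) \<le> 1"
    by (simp add: c_def)
qed

text \<open>The root is the binomial series of \<open>(1 - x)^(1/2)\<close>. As a series in powers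
  of \<open>x\<close> it commutes with everything that commutes with \<open>x\<close>.\<close>

lemma sqrt_exists_of_near_one:
  fixes x :: "'a::cstar_algebra"
  assumes sa: "star x = x" and "norm x \<le> 1"
  shows "\<exists>r. pos r \<and> r * r = 1 - x \<and> (\<forall>b. x * b = b * x \<longrightarrow> r * b = b * r)"
proof -
  define c :: "nat \<Rightarrow> real" where "c n = (1/2 gchoose n) * (-1) ^ n" for n
  define r where "r = (\<Sum>n. c n *\<^sub>R x ^ n)"
  have sn: "summable (\<lambda>n. norm (c n *\<^sub>R x ^ n))"
    using summable_norm_half_gbinomial(1)[OF assms(2)] by (simp add: c_def)
  then have s: "summable (\<lambda>n. c n *\<^sub>R x ^ n)" by (rule summable_norm_cancel)
  \<comment> \<open>By Vandermonde's identity the Cauchy square of the coefficients consists of the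
    coefficients of \<open>(1 - x)^1\<close>.\<close>
  have conv: "(\<Sum>i\<le>n. c i * c (n - i)) = (if n = 0 then 1 else if n = 1 then - 1 else 0)" for n
  proof -
    have "(\<Sum>i\<le>n. c i * c (n - i)) = (\<Sum>i\<le>n. ((1/2) gchoose i) * ((1/2) gchoose (n - i))) * (-1) ^ n"
      unfolding sum_distrib_right
      by (rule sum.cong) (auto simp: c_def mult_ac simp flip: power_add)
    also have "(\<Sum>i\<le>n. ((1/2) gchoose i) * ((1/2) gchoose (n - i))) = (1 gchoose n :: real)"
      using gbinomial_Vandermonde[of "1/2::real" "1/2" n] by (simp add: atMost_atLeast0)
    also have "(1 gchoose n :: real) = of_nat (1 choose n)"
      by (metis binomial_gbinomial of_nat_1)
    also have "\<dots> * (-1) ^ n = (if n = 0 then 1 else if n = 1 then - 1 else 0)"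
      by (cases n) (auto simp: binomial_eq_0)
    finally show ?thesis .
  qed
  have "r * r = (\<Sum>n. \<Sum>i\<le>n. (c i *\<^sub>R x ^ i) * (c (n - i) *\<^sub>R x ^ (n - i)))"
    unfolding r_def by (rule Cauchy_product[OF sn sn])
  also have "\<dots> = (\<Sum>n. (\<Sum>i\<le>n. c i * c (n - i)) *\<^sub>R x ^ n)"
    by (intro arg_cong[where f=suminf] ext)
       (auto simp: scaleR_left.sum mult.commute simp flip: power_add intro!: sum.cong)
  also have "\<dots> = (\<Sum>n\<in>{0,1}. (\<Sum>i\<le>n. c i * c (n - i)) *\<^sub>R x ^ n)"
    by (rule suminf_finite) (auto simp: conv)
  also have "\<dots> = 1 - x" by (simp add: conv)
  finally have "r * r = 1 - x" .
  moreover have "r * b = b * r" if "x * b = b * x" for b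
  proof -
    have "x ^ n * b = b * x ^ n" for n
      by (induction n) (simp_all add: mult.assoc that, metis mult.assoc that)
    then show ?thesis
      unfolding r_def suminf_mult2[OF s] suminf_mult[OF s, symmetric] by simp
  qed
  moreover have "star r = r"
    unfolding r_def bounded_linear.suminf[OF bounded_linear_star s]
    by (simp add: star_scaleR star_power sa)
  moreover have "norm (1 *\<^sub>R 1 - r) \<le> 1"
  proof -
    have "r = 1 + (\<Sum>n. c (Suc n) *\<^sub>R x ^ Suc n)"
      using suminf_split_head[OF s] by (simp add: r_def c_def)
    then show ?thesis
      using summable_norm_half_gbinomial(2)[OF assms(2)] by (simp add: c_def)
  qed
  ultimately show ?thesis unfolding pos_def by (metis zero_le_one)
qed

text \<open>A positive \<open>a\<close> with witness \<open>t\<close> is rescaled to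
  \<open>1 - x\<close> with \<open>norm x \<le> 1\<close>. The commutation clause is what later
  makes the roots of two commuting elements commute.\<close>

lemma sqrt_exists:
  fixes a :: "'a::cstar_algebra"
  assumes "pos a"
  obtains r where "pos r" "r * r = a" "\<And>b. a * b = b * a \<Longrightarrow> r * b = b * r"
proof -
  obtain t0 where t0: "t0 \<ge> 0" "norm (t0 *\<^sub>R 1 - a) \<le> t0" using assms by (auto simp: pos_def)
  \<comment> \<open>The given witness may be 0. Adding 1 allows division by it.\<close>
  define t where "t = t0 + 1"
  have t: "t > 0" "norm (t *\<^sub>R 1 - a) \<le> t"
    using t0 pos_bound_mono[of t0 a t] by (auto simp: t_def)
  define x where "x = 1 - (1 / t) *\<^sub>R a"
  have "x = (1 / t) *\<^sub>R (t *\<^sub>R 1 - a)" using t by (simp add: x_def algebra_simps)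
  then have "norm x \<le> 1" using t by (simp add: divide_le_eq_1)
  moreover have "star x = x" using assms by (simp add: x_def star_simps pos_star)
  ultimately obtain r where r: "pos r" "r * r = 1 - x" "\<And>b. x * b = b * x \<Longrightarrow> r * b = b * r"
    using sqrt_exists_of_near_one[of x] by blast
  show thesis
  proof
    show "pos (sqrt t *\<^sub>R r)" using r(1) t by (simp add: pos_scaleR)
    show "(sqrt t *\<^sub>R r) * (sqrt t *\<^sub>R r) = a" using r(2) t by (simp add: x_def)
    fix b assume "a * b = b * a"
    then have "x * b = b * x" by (simp add: x_def algebra_simps)
    then show "(sqrt t *\<^sub>R r) * b = b * (sqrt t *\<^sub>R r)" using r(3) by simp
  qed
qed

section \<open>Self-adjoint parts and norm inequalities for the order\<close>

lemma imag_left_commute: "x * (imag * y) = imag * (x * y)" for x :: "'a::cstar_algebra"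
  by (simp only: mult.assoc[symmetric] imag_commute[of x])

lemma imag_imag: "imag * (imag * x) = - x" for x :: "'a::cstar_algebra"
  by (simp add: imag_mult_imag flip: mult.assoc)

lemma norm_selfadjoint_parts_le:
  fixes p q :: "'a::cstar_algebra"
  assumes "star p = p" "star q = q"
  shows "norm p \<le> norm (p + imag * q)" and "norm q \<le> norm (p + imag * q)"
proof -
  let ?z = "p + imag * q"
  have sz: "star ?z = p - imag * q"
    using assms by (simp add: star_simps imag_commute[of q])
  have "2 *\<^sub>R p = ?z + star ?z" unfolding sz by (simp add: scaleR_2)
  then have "norm (2 *\<^sub>R p) \<le> norm ?z + norm (star ?z)" by (metis norm_triangle_ineq)
  then show "norm p \<le> norm ?z" by simp
  have "imag * (star ?z - ?z) = 2 *\<^sub>R q"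
    unfolding sz by (simp add: algebra_simps scaleR_2 imag_mult_imag flip: mult.assoc)
  then have "norm (2 *\<^sub>R q) \<le> norm (imag :: 'a) * norm (star ?z - ?z)" by (metis norm_mult_ineq)
  also have "norm (imag :: 'a) \<le> 1"
  proof -
    have "(norm (imag :: 'a))\<^sup>2 = norm (1 :: 'a)"
      using norm_star_mult_self[of "imag :: 'a"] by (simp add: star_simps imag_mult_imag)
    then show ?thesis using norm_one_le[where 'a='a] by - (rule power2_le_imp_le, auto)
  qed
  also have "norm (star ?z - ?z) \<le> norm (star ?z) + norm ?z" by (rule norm_triangle_ineq4)
  finally show "norm q \<le> norm ?z" by (simp add: mult_right_mono)
qed

text \<open>For commuting \<open>p\<close> and \<open>q\<close> the element
  \<open>z = p + imag * q\<close> is normal with \<open>star z * z = p * p + q * q\<close>, while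
  \<open>p * p - q * q\<close> is the real part of \<open>z * z\<close>.\<close>

lemma norm_commuting_selfadjoint:
  fixes p q :: "'a::cstar_algebra"
  assumes "star p = p" "star q = q" "p * q = q * p"
  shows "(norm (p + imag * q))\<^sup>2 = norm (p * p + q * q)"
    and "norm (p * p - q * q) \<le> norm (p * p + q * q)"
proof -
  let ?z = "p + imag * q"
  have sz: "star ?z = p - imag * q"
    using assms by (simp add: star_simps imag_commute[of q])
  have "star ?z * ?z = p * p + q * q"
    unfolding sz by (simp add: algebra_simps imag_left_commute[of p] imag_left_commute[of q] imag_imag assms(3))
  then show *: "(norm ?z)\<^sup>2 = norm (p * p + q * q)"
    using norm_star_mult_self[of ?z] by simp
  have "2 *\<^sub>R (p * p - q * q) = ?z * ?z + star ?z * star ?z"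
    unfolding sz by (simp add: algebra_simps imag_left_commute[of p] imag_left_commute[of q] imag_imag assms(3) scaleR_2)
  then have "norm (2 *\<^sub>R (p * p - q * q)) \<le> norm (?z * ?z) + norm (star ?z * star ?z)"
    by (metis norm_triangle_ineq)
  also have "\<dots> \<le> (norm ?z)\<^sup>2 + (norm ?z)\<^sup>2"
    using norm_mult_ineq[of ?z ?z] norm_mult_ineq[of "star ?z" "star ?z"]
    by (simp add: power2_eq_square)
  finally show "norm (p * p - q * q) \<le> norm (p * p + q * q)" using * by simp
qed

text \<open>With \<open>t = (norm u)^2\<close> let \<open>r\<close> be a root of
  \<open>t - u * u\<close>. It commutes with \<open>u\<close> and is the real part of
  \<open>r + imag * u\<close>, whose squared norm is that of \<open>r * r + u * u = t\<close>. So
  \<open>norm (t - u * u) = (norm r)^2 \<le> t\<close>.\<close>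

lemma pos_square:
  fixes u :: "'a::cstar_algebra"
  assumes "star u = u"
  shows "pos (u * u)"
proof -
  define t where "t = (norm u)\<^sup>2"
  have n: "norm (u * u) \<le> t" using norm_star_mult_self[of u] assms by (simp add: t_def)
  have sa: "star (u * u) = u * u" using assms by (simp add: star_simps)
  obtain r where r: "pos r" "r * r = t *\<^sub>R 1 - u * u"
    "\<And>b. (t *\<^sub>R 1 - u * u) * b = b * (t *\<^sub>R 1 - u * u) \<Longrightarrow> r * b = b * r"
    using sqrt_exists[OF pos_scaleR_one_diff[OF sa n]] by blast
  have "r * u = u * r" by (rule r(3)) (simp add: algebra_simps)
  then have "(norm (r + imag * u))\<^sup>2 = norm (t *\<^sub>R (1::'a))"
    using norm_commuting_selfadjoint(1)[of r u] r(1,2) assms by (simp add: pos_star)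
  also have "\<dots> \<le> t" by (rule norm_scaleR_one_le) (simp add: t_def)
  finally have "(norm (r + imag * u))\<^sup>2 \<le> t" .
  moreover have "(norm r)\<^sup>2 \<le> (norm (r + imag * u))\<^sup>2"
    using r(1) assms by (intro power_mono norm_selfadjoint_parts_le) (auto simp: pos_star)
  ultimately have "(norm r)\<^sup>2 \<le> t" by linarith
  then have "norm (t *\<^sub>R 1 - u * u) \<le> t"
    using norm_star_mult_self[of r] r(1,2) by (simp add: pos_star)
  then show ?thesis using sa by (auto simp: pos_def t_def intro: exI[of _ "(norm u)\<^sup>2"])
qed

text \<open>This is the substitute for functional calculus in the estimates below: commuting roots
  reduce it to \<open>norm_commuting_selfadjoint\<close>.\<close>

lemma norm_diff_le_norm_add:
  assumes "pos a" "pos b" "a * b = b * a"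
  shows "norm (a - b) \<le> norm (a + b)"
proof -
  obtain p where p: "pos p" "p * p = a" "\<And>c. a * c = c * a \<Longrightarrow> p * c = c * p"
    using sqrt_exists[OF assms(1)] by blast
  obtain q where q: "pos q" "q * q = b" "\<And>c. b * c = c * b \<Longrightarrow> q * c = c * q"
    using sqrt_exists[OF assms(2)] by blast
  \<comment> \<open>The commutation clause is used twice: \<open>q\<close> commutes with
    \<open>a\<close> because \<open>b\<close> does, and then \<open>p\<close> commutes with
    \<open>q\<close>.\<close>
  have "p * q = q * p" 
    by (rule p(3)) (rule q(3)[OF assms(3)[symmetric], symmetric])
  then show ?thesis
    using norm_commuting_selfadjoint(2)[of p q] p(1,2) q(1,2) by (simp add: pos_star)
qed

text \<open>\<open>norm_diff_le_norm_add\<close> for \<open>a\<close> and \<open>- a\<close> bounds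
  \<open>2 a\<close> by the norm of 0.\<close>

lemma pos_antisym:
  assumes "pos a" "pos (- a)"
  shows "a = 0"
proof -
  have "2 *\<^sub>R a = 0"
    using norm_diff_le_norm_add[OF assms] by (simp add: scaleR_2)
  then show ?thesis by simp
qed

text \<open>\<open>a\<close> and \<open>b\<close> need not commute, but \<open>a\<close> commutes
  with \<open>?c = norm b - a\<close>, which is positive as the sum of \<open>norm b - b\<close> and
  \<open>b - a\<close>. As \<open>a + ?c\<close> is a scalar, \<open>norm_diff_le_norm_add\<close>
  bounds \<open>a - ?c\<close>, and \<open>2 a\<close> is the sum of both.\<close>

lemma pos_norm_mono:
  assumes "pos a" "pos (b - a)"
  shows "norm a \<le> norm b"
proof -
  let ?c = "norm b *\<^sub>R 1 - a"
  have "star b = b"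
    using pos_star[OF assms(1)] pos_star[OF assms(2)] by (simp add: star_simps)
  then have "pos ((norm b *\<^sub>R 1 - b) + (b - a))"
    by (intro pos_add assms pos_scaleR_one_diff) auto
  then have "pos ?c" by simp
  then have "norm (a - ?c) \<le> norm (a + ?c)"
    by (intro norm_diff_le_norm_add assms) (auto simp: algebra_simps)
  also have "\<dots> \<le> norm b" using norm_scaleR_one_le[of "norm b"] by simp
  finally have 1: "norm (a - ?c) \<le> norm b" .
  have "2 *\<^sub>R a = (a - ?c) + norm b *\<^sub>R 1" by (simp add: scaleR_2)
  then have "norm (2 *\<^sub>R a) \<le> norm b + norm b"
    using 1 norm_scaleR_one_le[of "norm b"] norm_triangle_mono by (metis norm_ge_zero)
  then show ?thesis by simp
qed

text \<open>Any bound of the norm can serve as the witness of positivity. A bounded family of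
  positive elements thus has a common witness, which is what a limit argument needs.\<close>

lemma pos_norm_bound:
  assumes "pos a" "norm a \<le> t"
  shows "norm (t *\<^sub>R 1 - a) \<le> t"
proof -
  have t: "t \<ge> 0" using assms(2) norm_ge_zero order_trans by blast
  have "norm (t *\<^sub>R 1 - a) \<le> norm (t *\<^sub>R 1 :: 'a)"
    by (rule pos_norm_mono) (use assms in \<open>auto intro: pos_scaleR_one_diff simp: pos_star\<close>)
  with t norm_scaleR_one_le show ?thesis by (meson order_trans)
qed

section \<open>Zero and self-adjointness detected by the growth of norms\<close>

text \<open>A spectral value \<open>c\<close> of \<open>v\<close> would give
  \<open>(n + c)^2 \<le> K^2 + n^2\<close> for all real \<open>n\<close>, impossible unless
  \<open>c = 0\<close>. Without spectra: for large \<open>n\<close> the hypothesis yields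
  \<open>norm (n + v) \<le> n + e\<close>, which is positivity of \<open>e - v\<close>. The same
  holds for \<open>- v\<close>.\<close>

lemma selfadjoint_zero_of_norm_add:
  fixes v :: "'a::cstar_algebra"
  assumes sa: "star v = v" and le: "\<And>n::real. (norm (n *\<^sub>R 1 + v))\<^sup>2 \<le> K\<^sup>2 + n\<^sup>2"
  shows "v = 0"
proof -
  have main: "pos (e *\<^sub>R 1 - w)"
    if e: "e > 0" and w: "star w = w" "\<And>n::real. (norm (n *\<^sub>R 1 + w))\<^sup>2 \<le> K\<^sup>2 + n\<^sup>2" for w :: 'a and e :: real
  proof -
    \<comment> \<open>This value makes the cross term \<open>2 n e\<close> of
      \<open>(n + e)^2\<close> equal to \<open>K^2\<close>.\<close>
    define n where "n = K\<^sup>2 / (2 * e)"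
    have n: "n \<ge> 0" using e by (simp add: n_def)
    have "(n + e)\<^sup>2 = n\<^sup>2 + K\<^sup>2 + e\<^sup>2"
      using e by (simp add: n_def power2_eq_square field_simps)
    then have "(norm (n *\<^sub>R 1 + w))\<^sup>2 \<le> (n + e)\<^sup>2"
      using w(2)[of n] zero_le_power2[of e] by linarith
    then have "norm (n *\<^sub>R 1 + w) \<le> n + e"
      by (rule power2_le_imp_le) (use n e in auto)
    moreover have "n *\<^sub>R 1 + w = (n + e) *\<^sub>R 1 - (e *\<^sub>R 1 - w)" by (simp add: algebra_simps)
    ultimately show ?thesis using n e w(1) unfolding pos_def
      by (auto simp: star_simps intro!: exI[of _ "n + e"])
  qed
  have "norm v \<le> e" if e: "e > 0" for e
  proof -
    have le': "(norm (n *\<^sub>R 1 + - v))\<^sup>2 \<le> K\<^sup>2 + n\<^sup>2" for n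
    proof -
      have "n *\<^sub>R 1 + - v = - ((- n) *\<^sub>R 1 + v)" by simp
      then show ?thesis using le[of "- n"] by (metis norm_minus_cancel power2_minus)
    qed
    have "pos (e *\<^sub>R 1 - v)" by (rule main[OF e sa le])
    moreover have "pos (e *\<^sub>R 1 - - v)" by (rule main[OF e _ le']) (simp add: sa star_simps)
    ultimately have "norm ((e *\<^sub>R 1 - v) - (e *\<^sub>R 1 - - v)) \<le> norm ((e *\<^sub>R 1 - v) + (e *\<^sub>R 1 - - v))"
      by (intro norm_diff_le_norm_add) (auto simp: algebra_simps)
    also have "(e *\<^sub>R 1 - v) - (e *\<^sub>R 1 - - v) = - (2 *\<^sub>R v)" by (simp add: scaleR_2)
    also have "(e *\<^sub>R 1 - v) + (e *\<^sub>R 1 - - v) = (2 * e) *\<^sub>R 1"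
      by (simp only: mult_2 scaleR_add_left) simp
    also have "norm ((2 * e) *\<^sub>R 1 :: 'a) \<le> 2 * e" using e by (intro norm_scaleR_one_le) auto
    finally show ?thesis by simp
  qed
  then have "norm v \<le> 0" by - (rule field_le_epsilon, simp)
  then show ?thesis by simp
qed

text \<open>The cross terms cancel since \<open>imag\<close> is central and skew-adjoint. The next
  lemma is the converse.\<close>

lemma norm_selfadjoint_add_imag_le:
  fixes a :: "'a::cstar_algebra"
  assumes "star a = a"
  shows "(norm (a + n *\<^sub>R imag))\<^sup>2 \<le> (norm a)\<^sup>2 + n\<^sup>2"
proof -
  have "star (a + n *\<^sub>R imag) * (a + n *\<^sub>R imag) = a * a + n\<^sup>2 *\<^sub>R 1"
    using assms by (simp add: star_simps algebra_simps imag_mult_imag imag_commute[of a] power2_eq_square)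
  then have "(norm (a + n *\<^sub>R imag))\<^sup>2 = norm (a * a + n\<^sup>2 *\<^sub>R 1)"
    by (metis norm_star_mult_self)
  also have "\<dots> \<le> (norm a)\<^sup>2 + n\<^sup>2"
    using norm_star_mult_self[of a] assms by (intro norm_triangle_mono norm_scaleR_one_le) auto
  finally show ?thesis .
qed

text \<open>If \<open>v\<close> is the imaginary part of \<open>z\<close>, then \<open>n + v\<close>
  is that of \<open>z + n imag\<close> and its norm is no larger. So \<open>v\<close> satisfies the
  hypothesis of \<open>selfadjoint_zero_of_norm_add\<close>.\<close>

lemma selfadjoint_of_norm_add_imag:
  fixes z :: "'a::cstar_algebra"
  assumes "\<And>n::real. (norm (z + n *\<^sub>R imag))\<^sup>2 \<le> K\<^sup>2 + n\<^sup>2"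
  shows "star z = z"
proof -
  define u where "u = (1/2) *\<^sub>R (z + star z)"
  define v where "v = (1/2) *\<^sub>R (imag * (star z - z))"
  have z: "z = u + imag * v"
    by (simp add: u_def v_def algebra_simps imag_mult_imag flip: mult.assoc scaleR_add_left)
  have sa: "star u = u" "star v = v"
    by (simp_all add: u_def v_def star_simps add.commute imag_commute algebra_simps)
  have "(norm (n *\<^sub>R 1 + v))\<^sup>2 \<le> K\<^sup>2 + n\<^sup>2" for n
  proof -
    have "norm (n *\<^sub>R 1 + v) \<le> norm (u + imag * (n *\<^sub>R 1 + v))"
      using sa by (intro norm_selfadjoint_parts_le) (simp_all add: star_simps)
    also have "u + imag * (n *\<^sub>R 1 + v) = z + n *\<^sub>R imag" by (simp add: z algebra_simps)
    finally show ?thesis using assms[of n] by (meson norm_ge_zero order_trans power_mono)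
  qed
  then have "v = 0" using selfadjoint_zero_of_norm_add sa by blast
  then show ?thesis using z sa by simp
qed

section \<open>Positivity of \<open>star x * x\<close>\<close>

text \<open>The roots \<open>p\<close> and \<open>q\<close> commute, so the product is the square of
  the self-adjoint \<open>p * q\<close>.\<close>

lemma pos_mult_commuting:
  assumes "pos a" "pos b" "a * b = b * a"
  shows "pos (a * b)"
proof -
  obtain p where p: "pos p" "p * p = a" "\<And>c. a * c = c * a \<Longrightarrow> p * c = c * p"
    using sqrt_exists[OF assms(1)] by blast
  obtain q where q: "pos q" "q * q = b" "\<And>c. b * c = c * b \<Longrightarrow> q * c = c * q"
    using sqrt_exists[OF assms(2)] by blast
  have pq: "p * q = q * p"
    by (rule p(3)) (rule q(3)[OF assms(3)[symmetric], symmetric])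
  have "pos ((p * q) * (p * q))"
    by (rule pos_square) (simp add: star_simps pos_star p(1) q(1) pq)
  also have "(p * q) * (p * q) = p * (q * p) * q" by (simp only: mult.assoc)
  also have "\<dots> = p * (p * q) * q" by (simp only: pq)
  also have "\<dots> = (p * p) * (q * q)" by (simp only: mult.assoc)
  finally show ?thesis by (simp only: p(2) q(2))
qed

text \<open>In the next proof the spectra of \<open>y\<^sup>* y\<close> and \<open>l = y y\<^sup>*\<close> are not compared directly. Instead
  \<open>\<parallel>z\<^sup>* z\<parallel> = \<parallel>z z\<^sup>*\<parallel>\<close> is applied to \<open>z = y (w + L)\<close> with \<open>L = \<parallel>y\<parallel>\<^sup>2\<close>, which gives
  \<open>L\<^sup>3 \<le> \<parallel>w (w + L)\<^sup>2\<parallel> = \<parallel>l (L - l)\<^sup>2\<parallel> \<le> L\<^sup>3 / 4\<close>.\<close>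

lemma zero_of_pos_neg_star_mult:
  fixes y :: "'a::cstar_algebra"
  assumes w: "pos w" "star y * y = - w"
  shows "w = 0"
proof -
  define u where "u = (1/2) *\<^sub>R (y + star y)"
  define v where "v = (1/2) *\<^sub>R (imag * (star y - y))"
  define l where "l = y * star y"
  define L where "L = norm w"
  have y: "y = u + imag * v"
    by (simp add: u_def v_def algebra_simps imag_mult_imag flip: mult.assoc scaleR_add_left)
  have sa: "star u = u" "star v = v"
    by (simp_all add: u_def v_def star_simps add.commute imag_commute algebra_simps)
  have sy: "star y = u - imag * v" using sa by (simp add: y star_simps imag_commute[of v])
  \<comment> \<open>In the sum of both products the mixed terms in \<open>u\<close> and
    \<open>v\<close> cancel, so \<open>l\<close> is a sum of squares plus \<open>w\<close>, hence
    positive.\<close>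
  have "l + star y * y = 2 *\<^sub>R (u * u) + 2 *\<^sub>R (v * v)"
    unfolding l_def sy by (simp add: y algebra_simps imag_left_commute[of u] imag_left_commute[of v] imag_imag scaleR_2)
  then have "l = 2 *\<^sub>R (u * u) + 2 *\<^sub>R (v * v) + w" using w(2) by (simp add: algebra_simps)
  then have pl: "pos l" using sa w(1) by (auto intro!: pos_add pos_scaleR pos_square)
  have L: "(norm y)\<^sup>2 = L" "norm l = L"
    using norm_star_mult_self[of y] norm_mult_star_self[of y] w(2) by (simp_all add: L_def l_def)
  have L0: "L \<ge> 0" by (simp add: L_def)
  have sw: "star w = w" and sl: "star l = l" using w(1) pl by (simp_all add: pos_star)
  define z where "z = y * (w + L *\<^sub>R 1)"
  have "star z * z = (w + L *\<^sub>R 1) * (star y * y) * (w + L *\<^sub>R 1)"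
    by (simp add: z_def star_simps sw mult.assoc)
  also have "\<dots> = - (w * w * w + L *\<^sub>R (w * w + w * w) + (L * L) *\<^sub>R w)"
    by (simp add: w(2) algebra_simps)
  finally have zz: "norm (w * w * w + L *\<^sub>R (w * w + w * w) + (L * L) *\<^sub>R w) = (norm z)\<^sup>2"
    by (metis norm_minus_cancel norm_star_mult_self)
  have "norm ((L * L) *\<^sub>R w) \<le> norm (w * w * w + L *\<^sub>R (w * w + w * w) + (L * L) *\<^sub>R w)"
  proof (rule pos_norm_mono)
    have "pos (w * w * w)" by (intro pos_mult_commuting w pos_square sw) (simp add: mult.assoc)
    then have "pos (w * w * w + L *\<^sub>R (w * w + w * w))"
      using sw L0 by (intro pos_add pos_scaleR[OF pos_add] pos_square) auto
    then show "pos (w * w * w + L *\<^sub>R (w * w + w * w) + (L * L) *\<^sub>R w - (L * L) *\<^sub>R w)" by simp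
  qed (use w L0 in \<open>auto intro: pos_scaleR\<close>)
  then have lower: "L * L * L \<le> (norm z)\<^sup>2"
    using zz by (simp add: L_def)
  \<comment> \<open>This exchange of \<open>w\<close> for \<open>l\<close> rewrites \<open>z\<close>
    with its factor on the left, so that \<open>z * star z\<close> involves \<open>l\<close>
    only.\<close>
  have yw: "y * w = - (l * y)"
    using w(2) by (simp add: l_def mult.assoc)
  have z: "z = (L *\<^sub>R 1 - l) * y" by (simp add: z_def algebra_simps yw)
  have "z * star z = (L *\<^sub>R 1 - l) * (y * star y) * (L *\<^sub>R 1 - l)"
    by (simp add: z star_simps sl mult.assoc)
  then have "(norm z)\<^sup>2 = norm ((L *\<^sub>R 1 - l) * l * (L *\<^sub>R 1 - l))"
    by (metis l_def norm_mult_star_self)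
  also have "\<dots> \<le> norm ((L *\<^sub>R 1 - l) * l) * norm (L *\<^sub>R 1 - l)" by (rule norm_mult_ineq)
  also have "norm ((L *\<^sub>R 1 - l) * l) \<le> L * L / 4"
  proof -
    have "pos ((L *\<^sub>R 1 - l) * l)"
      by (intro pos_mult_commuting pl pos_scaleR_one_diff sl) (simp_all add: L(2) algebra_simps)
    \<comment> \<open>Completing the square; this is the origin of the factor 1/4.\<close>
    moreover have "(L * L / 4) *\<^sub>R 1 - (L *\<^sub>R 1 - l) * l = ((L / 2) *\<^sub>R 1 - l) * ((L / 2) *\<^sub>R 1 - l)"
      by (simp add: algebra_simps flip: scaleR_add_left)
    moreover have "pos (((L / 2) *\<^sub>R 1 - l) * ((L / 2) *\<^sub>R 1 - l))"
      by (rule pos_square) (simp add: star_simps sl)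
    ultimately have "norm ((L *\<^sub>R 1 - l) * l) \<le> norm ((L * L / 4) *\<^sub>R 1 :: 'a)"
      using pos_norm_mono by metis
    then show ?thesis using norm_scaleR_one_le[of "L * L / 4", where 'a='a] L0 by simp
  qed
  also have "norm (L *\<^sub>R 1 - l) \<le> L" by (rule pos_norm_bound[OF pl]) (simp add: L(2))
  finally have "(norm z)\<^sup>2 \<le> L * L / 4 * L" using L0 by (simp add: mult_left_mono mult_right_mono)
  with lower have "L * L * L \<le> L * L * L / 4" by simp
  then have "L * L * L \<le> 0" by simp
  with L0 have "L = 0" by (metis mult_eq_0_iff mult_nonneg_nonneg order_antisym)
  then show ?thesis by (simp add: L_def)
qed

text \<open>Kaplansky's argument: write \<open>h = x\<^sup>* x\<close>, \<open>k = \<bar>h\<bar>\<close> and \<open>n = k - h\<close>, which is twice the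
  negative part of \<open>h\<close>. Then \<open>(x n)\<^sup>* (x n) = - k n\<^sup>2\<close> is negative, hence zero, and \<open>h = k\<close>.\<close>

lemma pos_star_mult: "pos (star x * x)" for x :: "'a::cstar_algebra"
proof -
  define h where "h = star x * x"
  have sh: "star h = h" by (simp add: h_def star_simps)
  obtain k where k: "pos k" "k * k = h * h" and kc: "\<And>c. h * h * c = c * (h * h) \<Longrightarrow> k * c = c * k"
    using sqrt_exists[OF pos_square[OF sh]] by blast
  have kh: "k * h = h * k" by (rule kc) (simp add: mult.assoc)
  obtain r where r: "pos r" "r * r = k" and rc: "\<And>c. k * c = c * k \<Longrightarrow> r * c = c * r"
    using sqrt_exists[OF k(1)] by blast
  define n where "n = k - h"
  have sn: "star n = n" by (simp add: n_def star_simps sh pos_star[OF k(1)])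
  have kn: "k * n = n * k" by (simp add: n_def algebra_simps kh)
  have rn: "r * n = n * r" by (rule rc[OF kn])
  have hn: "h * n = - (k * n)" by (simp add: n_def algebra_simps k(2) kh)
  have srn: "star (r * n) = r * n" by (simp add: star_simps sn pos_star[OF r(1)] rn)
  have "star (x * n) * (x * n) = n * (h * n)"
    by (simp add: h_def star_simps sn mult.assoc)
  also have "\<dots> = - (n * (k * n))" by (simp add: hn)
  also have "n * (k * n) = n * (r * r) * n" by (simp only: r(2) mult.assoc)
  also have "\<dots> = (n * r) * (r * n)" by (simp only: mult.assoc)
  also have "\<dots> = (r * n) * (r * n)" by (simp only: rn)
  finally have "(r * n) * (r * n) = 0"
    by (rule zero_of_pos_neg_star_mult[OF pos_square[OF srn]])
  then have "r * n = 0"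
    using norm_star_mult_self[of "r * n"] srn by simp
  then have "k * n = 0" by (metis r(2) mult.assoc mult_zero_right)
  with hn have "n * n = 0" by (simp add: n_def left_diff_distrib)
  then have "n = 0" using norm_star_mult_self[of n] sn by simp
  then show ?thesis using k(1) by (simp add: n_def h_def)
qed

section \<open>Calculus in a C*-category\<close>

locale cstar_category =
  fixes C :: "('o,'m) wcat"
  assumes cstar_cat: "cstar_cat C"
begin

abbreviation hsub :: "'m \<Rightarrow> 'm \<Rightarrow> 'm" where
  "hsub x y \<equiv> hadd C x (hsmul C (- 1) y)"

lemma
  shows cat: "category_axioms C" and vec: "vector_space_axioms C" and bil: "bilinear_comp C"
    and inv: "involution_axioms C" and nor: "norm_axioms C"
  using cstar_cat by (auto simp: cstar_cat_def)

lemma cmp_hom [intro]: "f \<in> Hom C A B \<Longrightarrow> g \<in> Hom C B D \<Longrightarrow> cmp C g f \<in> Hom C A D"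
  using cat unfolding category_axioms_def by metis

lemma cmp_assoc:
  "f \<in> Hom C A B \<Longrightarrow> g \<in> Hom C B D \<Longrightarrow> h \<in> Hom C D E \<Longrightarrow>
    cmp C (cmp C h g) f = cmp C h (cmp C g f)"
  using cat unfolding category_axioms_def by metis

lemma id_hom [intro, simp]: "idm C A \<in> Hom C A A"
  using cat by (simp add: category_axioms_def)

lemma cmp_id: "f \<in> Hom C A B \<Longrightarrow> cmp C f (idm C A) = f" "f \<in> Hom C A B \<Longrightarrow> cmp C (idm C B) f = f"
  using cat by (auto simp: category_axioms_def)

lemma zero_hom [intro, simp]: "hzero C A B \<in> Hom C A B"
  using vec by (simp add: vector_space_axioms_def)

lemma add_hom [intro]: "x \<in> Hom C A B \<Longrightarrow> y \<in> Hom C A B \<Longrightarrow> hadd C x y \<in> Hom C A B"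
  using vec unfolding vector_space_axioms_def by metis

lemma smul_hom [intro]: "x \<in> Hom C A B \<Longrightarrow> hsmul C c x \<in> Hom C A B"
  using vec unfolding vector_space_axioms_def by metis

lemma add_assoc:
  "x \<in> Hom C A B \<Longrightarrow> y \<in> Hom C A B \<Longrightarrow> z \<in> Hom C A B \<Longrightarrow>
    hadd C (hadd C x y) z = hadd C x (hadd C y z)"
  using vec unfolding vector_space_axioms_def by metis

lemma add_commute: "x \<in> Hom C A B \<Longrightarrow> y \<in> Hom C A B \<Longrightarrow> hadd C x y = hadd C y x"
  using vec unfolding vector_space_axioms_def by metis

lemma add_zero: "x \<in> Hom C A B \<Longrightarrow> hadd C x (hzero C A B) = x"
  using vec unfolding vector_space_axioms_def by metis

lemma zero_add: "x \<in> Hom C A B \<Longrightarrow> hadd C (hzero C A B) x = x"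
  using add_zero add_commute zero_hom by metis

lemma sub_self: "x \<in> Hom C A B \<Longrightarrow> hsub x x = hzero C A B"
  using vec unfolding vector_space_axioms_def by metis

lemma smul_smul: "x \<in> Hom C A B \<Longrightarrow> hsmul C a (hsmul C b x) = hsmul C (a * b) x"
  using vec unfolding vector_space_axioms_def by metis

lemma smul_one: "x \<in> Hom C A B \<Longrightarrow> hsmul C 1 x = x"
  using vec unfolding vector_space_axioms_def by metis

lemma smul_add:
  "x \<in> Hom C A B \<Longrightarrow> y \<in> Hom C A B \<Longrightarrow> hsmul C a (hadd C x y) = hadd C (hsmul C a x) (hsmul C a y)"
  using vec unfolding vector_space_axioms_def by metis

lemma add_smul: "x \<in> Hom C A B \<Longrightarrow> hsmul C (a + b) x = hadd C (hsmul C a x) (hsmul C b x)"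
  using vec unfolding vector_space_axioms_def by metis

lemma add_left_cancel:
  assumes "x \<in> Hom C A B" "y \<in> Hom C A B" "z \<in> Hom C A B" "hadd C x y = hadd C x z"
  shows "y = z"
proof -
  have "hadd C (hsmul C (- 1) x) (hadd C x w) = w" if "w \<in> Hom C A B" for w
  proof -
    have "hadd C (hsmul C (- 1) x) (hadd C x w) = hadd C (hadd C (hsmul C (- 1) x) x) w"
      using assms(1) that by (metis add_assoc smul_hom)
    also have "hadd C (hsmul C (- 1) x) x = hzero C A B"
      using assms(1) by (metis add_commute smul_hom sub_self)
    finally show ?thesis using that zero_add by metis
  qed
  then show ?thesis using assms by metis
qed

lemma smul_zero_left: "x \<in> Hom C A B \<Longrightarrow> hsmul C 0 x = hzero C A B"
  using add_smul[of x A B 0 0] add_left_cancel[of "hsmul C 0 x" A B "hsmul C 0 x" "hzero C A B"]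
  by (simp add: smul_hom add_zero)

lemma smul_zero_right: "hsmul C c (hzero C A B) = hzero C A B"
  using smul_smul[of "hzero C A B" A B c 0] smul_zero_left[of "hzero C A B" A B] by simp

lemma sub_eq_zero:
  assumes "x \<in> Hom C A B" "y \<in> Hom C A B" "hsub x y = hzero C A B"
  shows "x = y"
proof -
  have "hadd C (hsmul C (- 1) y) x = hadd C (hsmul C (- 1) y) y"
    using assms by (metis add_commute smul_hom sub_self)
  then show ?thesis using assms add_left_cancel smul_hom by metis
qed

lemma sub_add_cancel: "x \<in> Hom C A B \<Longrightarrow> y \<in> Hom C A B \<Longrightarrow> hadd C (hsub x y) y = x"
  using add_assoc[of x A B "hsmul C (- 1) y" y] add_commute[of "hsmul C (- 1) y" A B y]
  by (simp add: smul_hom sub_self add_zero)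

lemma cmp_add_right:
  "f \<in> Hom C A B \<Longrightarrow> f' \<in> Hom C A B \<Longrightarrow> g \<in> Hom C B D \<Longrightarrow>
    cmp C g (hadd C f f') = hadd C (cmp C g f) (cmp C g f')"
  using bil unfolding bilinear_comp_def by metis

lemma cmp_add_left:
  "f \<in> Hom C A B \<Longrightarrow> g \<in> Hom C B D \<Longrightarrow> g' \<in> Hom C B D \<Longrightarrow>
    cmp C (hadd C g g') f = hadd C (cmp C g f) (cmp C g' f)"
  using bil unfolding bilinear_comp_def by metis

lemma cmp_smul_right:
  "f \<in> Hom C A B \<Longrightarrow> g \<in> Hom C B D \<Longrightarrow> cmp C g (hsmul C c f) = hsmul C c (cmp C g f)"
  using bil unfolding bilinear_comp_def by metis

lemma cmp_smul_left:
  "f \<in> Hom C A B \<Longrightarrow> g \<in> Hom C B D \<Longrightarrow> cmp C (hsmul C c g) f = hsmul C c (cmp C g f)"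
  using bil unfolding bilinear_comp_def by metis

lemma cmp_sub_right:
  "f \<in> Hom C A B \<Longrightarrow> f' \<in> Hom C A B \<Longrightarrow> g \<in> Hom C B D \<Longrightarrow>
    cmp C g (hsub f f') = hsub (cmp C g f) (cmp C g f')"
  by (simp add: cmp_add_right cmp_smul_right smul_hom)

lemma cmp_sub_left:
  "f \<in> Hom C A B \<Longrightarrow> g \<in> Hom C B D \<Longrightarrow> g' \<in> Hom C B D \<Longrightarrow>
    cmp C (hsub g g') f = hsub (cmp C g f) (cmp C g' f)"
  by (simp add: cmp_add_left cmp_smul_left smul_hom)

lemma cmp_zero_right: "g \<in> Hom C B D \<Longrightarrow> cmp C g (hzero C A B) = hzero C A D"
  using cmp_smul_right[of "hzero C A B" A B g D 0]
  by (metis cmp_hom smul_zero_left zero_hom)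

lemma cmp_zero_left: "f \<in> Hom C A B \<Longrightarrow> cmp C (hzero C B D) f = hzero C A D"
  using cmp_smul_left[of f A B "hzero C B D" D 0]
  by (metis cmp_hom smul_zero_left zero_hom)

lemma adj_hom [intro]: "f \<in> Hom C A B \<Longrightarrow> adj C f \<in> Hom C B A"
  using inv unfolding involution_axioms_def by metis

lemma adj_id: "adj C (idm C A) = idm C A"
  using inv by (simp add: involution_axioms_def)

lemma adj_adj: "f \<in> Hom C A B \<Longrightarrow> adj C (adj C f) = f"
  using inv unfolding involution_axioms_def by metis

lemma adj_add: "f \<in> Hom C A B \<Longrightarrow> f' \<in> Hom C A B \<Longrightarrow> adj C (hadd C f f') = hadd C (adj C f) (adj C f')"
  using inv unfolding involution_axioms_def by metis

lemma adj_smul: "f \<in> Hom C A B \<Longrightarrow> adj C (hsmul C c f) = hsmul C (cnj c) (adj C f)"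
  using inv unfolding involution_axioms_def by metis

lemma adj_sub: "f \<in> Hom C A B \<Longrightarrow> f' \<in> Hom C A B \<Longrightarrow> adj C (hsub f f') = hsub (adj C f) (adj C f')"
  by (simp add: adj_add adj_smul smul_hom)

lemma adj_cmp: "f \<in> Hom C A B \<Longrightarrow> g \<in> Hom C B D \<Longrightarrow> adj C (cmp C g f) = cmp C (adj C f) (adj C g)"
  using inv unfolding involution_axioms_def by metis

lemma adj_zero: "adj C (hzero C A B) = hzero C B A"
  using adj_smul[OF zero_hom, of 0 A B] smul_zero_left[OF zero_hom]
    smul_zero_left[OF adj_hom[OF zero_hom]] by simp

lemma star_mult_endo:
  "f \<in> Hom C A B \<Longrightarrow> \<exists>b\<in>Hom C A A. cmp C (adj C f) f = cmp C (adj C b) b"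
  using inv unfolding involution_axioms_def by metis

lemma eq_zero_of_star_mult: "f \<in> Hom C A B \<Longrightarrow> cmp C (adj C f) f = hzero C A A \<Longrightarrow> f = hzero C A B"
  using inv unfolding involution_axioms_def by metis

lemma nrm_nonneg: "x \<in> Hom C A B \<Longrightarrow> 0 \<le> nrm C x"
  using nor unfolding norm_axioms_def by metis

lemma nrm_eq_zero: "x \<in> Hom C A B \<Longrightarrow> nrm C x = 0 \<longleftrightarrow> x = hzero C A B"
  using nor unfolding norm_axioms_def by metis

lemma nrm_zero: "nrm C (hzero C A B) = 0"
  using nrm_eq_zero by blast

lemma nrm_add: "x \<in> Hom C A B \<Longrightarrow> y \<in> Hom C A B \<Longrightarrow> nrm C (hadd C x y) \<le> nrm C x + nrm C y"
  using nor unfolding norm_axioms_def by metis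

lemma nrm_smul: "x \<in> Hom C A B \<Longrightarrow> nrm C (hsmul C c x) = cmod c * nrm C x"
  using nor unfolding norm_axioms_def by metis

lemma nrm_sub: "x \<in> Hom C A B \<Longrightarrow> y \<in> Hom C A B \<Longrightarrow> nrm C (hsub x y) \<le> nrm C x + nrm C y"
  using nrm_add[of x A B "hsmul C (- 1) y"] nrm_smul[of y A B "- 1"] by (simp add: smul_hom)

lemma nrm_cmp: "f \<in> Hom C A B \<Longrightarrow> g \<in> Hom C B D \<Longrightarrow> nrm C (cmp C g f) \<le> nrm C g * nrm C f"
  using nor unfolding norm_axioms_def by metis

lemma nrm_star_mult: "a \<in> Hom C A B \<Longrightarrow> nrm C (cmp C (adj C a) a) = (nrm C a)\<^sup>2"
  using nor unfolding norm_axioms_def by metis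

lemma nrm_adj: "a \<in> Hom C A B \<Longrightarrow> nrm C (adj C a) = nrm C a"
proof -
  have le: "nrm C a \<le> nrm C (adj C a)" if a: "a \<in> Hom C A B" for a A B
  proof (cases "nrm C a = 0")
    case True then show ?thesis using a nrm_nonneg adj_hom by metis
  next
    case False
    have "nrm C a * nrm C a \<le> nrm C (adj C a) * nrm C a"
      using nrm_star_mult[OF a] nrm_cmp[OF a adj_hom[OF a]] by (simp add: power2_eq_square)
    with False nrm_nonneg[OF a] show ?thesis by simp
  qed
  assume "a \<in> Hom C A B"
  with le[of a A B] le[of "adj C a" B A] show ?thesis by (simp add: adj_hom adj_adj)
qed

lemma nrm_mult_star: "a \<in> Hom C A B \<Longrightarrow> nrm C (cmp C a (adj C a)) = (nrm C a)\<^sup>2"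
  using nrm_star_mult[of "adj C a" B A] by (simp add: adj_hom adj_adj nrm_adj)

text \<open>The norm equals its own square. The value 0 occurs when \<open>A\<close> is a zero
  object, hence an inequality only.\<close>

lemma nrm_id_le: "nrm C (idm C A) \<le> 1"
proof -
  have "nrm C (idm C A) * nrm C (idm C A) = nrm C (idm C A)"
    using nrm_star_mult[of "idm C A" A A] cmp_id(1)[OF id_hom] by (simp add: adj_id power2_eq_square)
  then have "nrm C (idm C A) = 0 \<or> nrm C (idm C A) = 1"
    by (simp only: mult_cancel_right2)
  then show ?thesis by linarith
qed

lemma sub_hom [intro]: "x \<in> Hom C A B \<Longrightarrow> y \<in> Hom C A B \<Longrightarrow> hsub x y \<in> Hom C A B"
  by (intro add_hom smul_hom)

lemma nrm_sub_triangle: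
  assumes "x \<in> Hom C A B" "y \<in> Hom C A B" "z \<in> Hom C A B"
  shows "nrm C (hsub x z) \<le> nrm C (hsub x y) + nrm C (hsub y z)"
proof -
  have "hadd C (hsub x y) (hsub y z) = hadd C (hadd C (hsub x y) y) (hsmul C (- 1) z)"
    by (rule add_assoc[symmetric]) (use assms in \<open>auto intro: sub_hom smul_hom\<close>)
  then have "hadd C (hsub x y) (hsub y z) = hsub x z"
    by (simp only: sub_add_cancel[OF assms(1,2)])
  then show ?thesis
    using nrm_add[OF sub_hom[OF assms(1,2)] sub_hom[OF assms(2,3)]] by simp
qed

lemma nrm_sub_commute:
  assumes "x \<in> Hom C A B" "y \<in> Hom C A B"
  shows "nrm C (hsub x y) = nrm C (hsub y x)"
proof -
  have "hsmul C (- 1) (hsub y x) = hadd C (hsmul C (- 1) y) x"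
    using smul_add[OF assms(2) smul_hom[OF assms(1)]] smul_smul[OF assms(1)] smul_one[OF assms(1)]
    by simp
  also have "\<dots> = hsub x y" by (rule add_commute[OF smul_hom[OF assms(2)] assms(1)])
  finally show ?thesis using nrm_smul[OF sub_hom[OF assms(2,1)], of "- 1"] by simp
qed

lemma nrm_le_add_nrm_sub:
  assumes "x \<in> Hom C A B" "y \<in> Hom C A B"
  shows "nrm C x \<le> nrm C y + nrm C (hsub y x)"
  using nrm_add[OF sub_hom[OF assms] assms(2)] nrm_sub_commute[OF assms]
  by (simp only: sub_add_cancel[OF assms] add.commute)

lemma neg_add: "x \<in> Hom C A B \<Longrightarrow> hadd C (hsmul C (- 1) x) x = hzero C A B"
  using add_commute[of x A B "hsmul C (- 1) x"] by (simp add: smul_hom sub_self)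

lemma ii_id_square: "cmp C (hsmul C \<i> (idm C B)) (hsmul C \<i> (idm C B)) = hsmul C (- 1) (idm C B)"
  using cmp_smul_left[OF smul_hom[OF id_hom] id_hom, of \<i> B \<i>] cmp_id(2)[OF smul_hom[OF id_hom]]
    smul_smul[OF id_hom] by simp

lemma ii_id_commute:
  "x \<in> Hom C B B \<Longrightarrow> cmp C (hsmul C \<i> (idm C B)) x = cmp C x (hsmul C \<i> (idm C B))"
  using cmp_smul_left[of x B B "idm C B" B \<i>] cmp_smul_right[of "idm C B" B B x B \<i>]
  by (simp add: cmp_id)

lemma adj_ii_id: "adj C (hsmul C \<i> (idm C B)) = hsmul C (- 1) (hsmul C \<i> (idm C B))"
  using adj_smul[OF id_hom] smul_smul[OF id_hom] by (simp add: adj_id)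

lemma complete:
  assumes "\<And>n. s n \<in> Hom C A B"
    and "\<And>e. e > 0 \<Longrightarrow> \<exists>N. \<forall>m\<ge>N. \<forall>n\<ge>N. nrm C (hsub (s m) (s n)) < e"
  shows "\<exists>x\<in>Hom C A B. (\<lambda>n. nrm C (hsub (s n) x)) \<longlonglongrightarrow> 0"
  using nor assms unfolding norm_axioms_def by metis

end

section \<open>The product of all endomorphism algebras\<close>

text \<open>A type definition cannot depend on the category \<open>C\<close>. The C*-algebras \<open>Hom C B B\<close> of all
  C*-categories \<open>C\<close> with given types of objects and morphisms and of all objects \<open>B\<close> are therefore
  collected in their bounded product, so that results on the type class \<open>cstar_algebra\<close> apply
  to each factor.\<close>

typedef ('o,'m) endos = "{x :: ('o,'m) wcat \<Rightarrow> 'o \<Rightarrow> 'm.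
    (\<forall>C B. if cstar_cat C then x C B \<in> Hom C B B else x C B = undefined) \<and>
    (\<exists>K. \<forall>C B. cstar_cat C \<longrightarrow> nrm C (x C B) \<le> K)}"
  morphisms component Abs_endos
proof -
  have "nrm C (hzero C B B) \<le> 0" "hzero C B B \<in> Hom C B B" if "cstar_cat C"
    for C :: "('o,'m) wcat" and B
    using cstar_category.nrm_zero[of C] cstar_category.zero_hom[of C] that
    by (auto simp: cstar_category_def)
  then show ?thesis
    by (intro exI[of _ "\<lambda>C B. if cstar_cat C then hzero C B B else undefined"]) auto
qed

definition mk_endos :: "(('o,'m) wcat \<Rightarrow> 'o \<Rightarrow> 'm) \<Rightarrow> ('o,'m) endos" where
  "mk_endos g = Abs_endos (\<lambda>C B. if cstar_cat C then g C B else undefined)"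

lemma component_mk:
  assumes "\<And>C B. cstar_cat C \<Longrightarrow> g C B \<in> Hom C B B \<and> nrm C (g C B) \<le> K" and "cstar_cat C"
  shows "component (mk_endos g) C B = g C B"
  unfolding mk_endos_def
  by (subst Abs_endos_inverse) (use assms in \<open>auto intro!: exI[of _ K]\<close>)

lemma component_hom: "cstar_cat C \<Longrightarrow> component x C B \<in> Hom C B B"
  using component[of x] by (auto split: if_splits)

lemma endos_eqI:
  assumes "\<And>C B. cstar_cat C \<Longrightarrow> component x C B = component y C B"
  shows "x = y"
proof -
  have "component x C B = component y C B" for C B
    using assms component[of x] component[of y] by (cases "cstar_cat C") auto
  then show ?thesis by (metis component_inject ext)
qed

text \<open>Inserting 0 keeps the set nonempty. There may be no C*-category at all on the given
  types, since the zero morphisms embed the pairs of objects into the morphisms.\<close>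

definition endos_norm :: "('o,'m) endos \<Rightarrow> real" where
  "endos_norm x = Sup (insert 0 {nrm C (component x C B) | C B. cstar_cat C})"

lemma endos_norm_bdd: "bdd_above (insert 0 {nrm C (component x C B) | C B. cstar_cat C})"
proof -
  obtain K where K: "\<forall>C B. cstar_cat C \<longrightarrow> nrm C (component x C B) \<le> K"
    using component[of x] by blast
  have "y \<le> max 0 K" if "y \<in> insert 0 {nrm C (component x C B) | C B. cstar_cat C}" for y
    using that K by (auto simp: le_max_iff_disj)
  then show ?thesis by (rule bdd_aboveI)
qed

lemma nrm_component_le: "cstar_cat C \<Longrightarrow> nrm C (component x C B) \<le> endos_norm x"
  unfolding endos_norm_def by (rule cSup_upper[OF _ endos_norm_bdd]) auto

lemma endos_norm_nonneg: "0 \<le> endos_norm x"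
  unfolding endos_norm_def by (rule cSup_upper[OF _ endos_norm_bdd]) auto

lemma endos_norm_leI:
  "0 \<le> K \<Longrightarrow> (\<And>C B. cstar_cat C \<Longrightarrow> nrm C (component x C B) \<le> K) \<Longrightarrow> endos_norm x \<le> K"
  unfolding endos_norm_def by (rule cSup_least) auto

instantiation endos :: (type, type) "{real_normed_algebra, monoid_mult}"
begin

definition "(0 :: ('a,'b) endos) = mk_endos (\<lambda>C B. hzero C B B)"
definition "(1 :: ('a,'b) endos) = mk_endos (\<lambda>C B. idm C B)"
definition "(x :: ('a,'b) endos) + y = mk_endos (\<lambda>C B. hadd C (component x C B) (component y C B))"
definition "- (x :: ('a,'b) endos) = mk_endos (\<lambda>C B. hsmul C (- 1) (component x C B))"
definition "(x :: ('a,'b) endos) - y =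
  mk_endos (\<lambda>C B. hadd C (component x C B) (hsmul C (- 1) (component y C B)))"
definition "r *\<^sub>R (x :: ('a,'b) endos) = mk_endos (\<lambda>C B. hsmul C (complex_of_real r) (component x C B))"
definition "(x :: ('a,'b) endos) * y = mk_endos (\<lambda>C B. cmp C (component x C B) (component y C B))"
definition "norm (x :: ('a,'b) endos) = endos_norm x"
definition "dist (x :: ('a,'b) endos) y = norm (x - y)"
definition "sgn (x :: ('a,'b) endos) = scaleR (inverse (norm x)) x"
definition
  "(uniformity :: (('a,'b) endos \<times> ('a,'b) endos) filter) = (INF e\<in>{0 <..}. principal {(x, y). dist x y < e})"
definition
  "open (U :: ('a,'b) endos set) \<longleftrightarrow> (\<forall>x\<in>U. eventually (\<lambda>(x', y). x' = x \<longrightarrow> y \<in> U) uniformity)"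

lemma component_simps:
  fixes x y :: "('a,'b) endos"
  assumes "cstar_cat C"
  shows "component 0 C B = hzero C B B"
    and "component 1 C B = idm C B"
    and "component (x + y) C B = hadd C (component x C B) (component y C B)"
    and "component (- x) C B = hsmul C (- 1) (component x C B)"
    and "component (x - y) C B = hadd C (component x C B) (hsmul C (- 1) (component y C B))"
    and "component (r *\<^sub>R x) C B = hsmul C (complex_of_real r) (component x C B)"
    and "component (x * y) C B = cmp C (component x C B) (component y C B)"
proof -
  have c: "cstar_category C" if "cstar_cat C" for C :: "('a,'b) wcat"
    using that by (simp add: cstar_category_def)
  show "component 0 C B = hzero C B B" unfolding zero_endos_def
    by (rule component_mk[where K=0]) (use assms c in \<open>auto simp: cstar_category.zero_hom cstar_category.nrm_zero\<close>)
  show "component 1 C B = idm C B" unfolding one_endos_def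
    by (rule component_mk[where K=1]) (use assms c in \<open>auto simp: cstar_category.id_hom cstar_category.nrm_id_le\<close>)
  show "component (x + y) C B = hadd C (component x C B) (component y C B)" unfolding plus_endos_def
  proof (rule component_mk[where K="endos_norm x + endos_norm y"])
    fix C :: "('a,'b) wcat" and B assume C: "cstar_cat C"
    then interpret cstar_category C by (rule c)
    note hx = component_hom[OF C, of x B] and hy = component_hom[OF C, of y B]
    note nx = nrm_component_le[OF C, of x B] and ny = nrm_component_le[OF C, of y B]
    show "hadd C (component x C B) (component y C B) \<in> Hom C B B \<and> nrm C (hadd C (component x C B) (component y C B)) \<le> endos_norm x + endos_norm y"
      using nrm_add[OF hx hy] nx ny by (intro conjI add_hom hx hy) linarith
  qed fact
  show "component (- x) C B = hsmul C (- 1) (component x C B)" unfolding uminus_endos_def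
  proof (rule component_mk[where K="endos_norm x"])
    fix C :: "('a,'b) wcat" and B assume C: "cstar_cat C"
    then interpret cstar_category C by (rule c)
    note hx = component_hom[OF C, of x B] and hy = component_hom[OF C, of y B]
    note nx = nrm_component_le[OF C, of x B] and ny = nrm_component_le[OF C, of y B]
    show "hsmul C (- 1) (component x C B) \<in> Hom C B B \<and> nrm C (hsmul C (- 1) (component x C B)) \<le> endos_norm x"
      using nrm_smul[OF hx, of "- 1"] nx by (intro conjI smul_hom hx) simp
  qed fact
  show "component (x - y) C B = hadd C (component x C B) (hsmul C (- 1) (component y C B))" unfolding minus_endos_def
  proof (rule component_mk[where K="endos_norm x + endos_norm y"])
    fix C :: "('a,'b) wcat" and B assume C: "cstar_cat C"
    then interpret cstar_category C by (rule c)
    note hx = component_hom[OF C, of x B] and hy = component_hom[OF C, of y B]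
    note nx = nrm_component_le[OF C, of x B] and ny = nrm_component_le[OF C, of y B]
    show "hadd C (component x C B) (hsmul C (- 1) (component y C B)) \<in> Hom C B B \<and> nrm C (hadd C (component x C B) (hsmul C (- 1) (component y C B))) \<le> endos_norm x + endos_norm y"
      using nrm_sub[OF hx hy] nx ny by (intro conjI add_hom smul_hom hx hy) linarith
  qed fact
  show "component (r *\<^sub>R x) C B = hsmul C (complex_of_real r) (component x C B)" unfolding scaleR_endos_def
  proof (rule component_mk[where K="\<bar>r\<bar> * endos_norm x"])
    fix C :: "('a,'b) wcat" and B assume C: "cstar_cat C"
    then interpret cstar_category C by (rule c)
    note hx = component_hom[OF C, of x B] and hy = component_hom[OF C, of y B]
    note nx = nrm_component_le[OF C, of x B] and ny = nrm_component_le[OF C, of y B]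
    show "hsmul C (complex_of_real r) (component x C B) \<in> Hom C B B \<and> nrm C (hsmul C (complex_of_real r) (component x C B)) \<le> \<bar>r\<bar> * endos_norm x"
      using nrm_smul[OF hx, of "complex_of_real r"] nx by (intro conjI smul_hom hx) (simp add: mult_left_mono)
  qed fact
  show "component (x * y) C B = cmp C (component x C B) (component y C B)" unfolding times_endos_def
  proof (rule component_mk[where K="endos_norm x * endos_norm y"])
    fix C :: "('a,'b) wcat" and B assume C: "cstar_cat C"
    then interpret cstar_category C by (rule c)
    note hx = component_hom[OF C, of x B] and hy = component_hom[OF C, of y B]
    note nx = nrm_component_le[OF C, of x B] and ny = nrm_component_le[OF C, of y B]
    have le: "nrm C (component x C B) * nrm C (component y C B) \<le> endos_norm x * endos_norm y"
      using nx ny nrm_nonneg[OF hy] by (intro mult_mono endos_norm_nonneg)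
    show "cmp C (component x C B) (component y C B) \<in> Hom C B B \<and> nrm C (cmp C (component x C B) (component y C B)) \<le> endos_norm x * endos_norm y"
      using nrm_cmp[OF hy hx] le by (intro conjI cmp_hom[OF hy hx]) linarith
  qed fact
qed

instance
proof
  have c: "cstar_category C" if "cstar_cat C" for C :: "('a,'b) wcat"
    using that by (simp add: cstar_category_def)
  note eqI = endos_eqI
  fix x y z :: "('a,'b) endos" and r s :: real
  show "x + y + z = x + (y + z)"
    by (rule eqI, simp only: component_simps, rule cstar_category.add_assoc[OF c]) (assumption | rule component_hom)+
  show "x + y = y + x"
    by (rule eqI, simp only: component_simps, rule cstar_category.add_commute[OF c]) (assumption | rule component_hom)+
  show "0 + x = x"
    by (rule eqI, simp only: component_simps, rule cstar_category.zero_add[OF c]) (assumption | rule component_hom)+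
  show "- x + x = 0"
    by (rule eqI, simp only: component_simps, rule cstar_category.neg_add[OF c]) (assumption | rule component_hom)+
  show "r *\<^sub>R (x + y) = r *\<^sub>R x + r *\<^sub>R y"
    by (rule eqI, simp only: component_simps, rule cstar_category.smul_add[OF c]) (assumption | rule component_hom)+
  show "x * y * z = x * (y * z)"
    by (rule eqI, simp only: component_simps, rule cstar_category.cmp_assoc[OF c]) (assumption | rule component_hom)+
  show "(x + y) * z = x * z + y * z"
    by (rule eqI, simp only: component_simps, rule cstar_category.cmp_add_left[OF c]) (assumption | rule component_hom)+
  show "x * (y + z) = x * y + x * z"
    by (rule eqI, simp only: component_simps, rule cstar_category.cmp_add_right[OF c]) (assumption | rule component_hom)+
  show "(r *\<^sub>R x) * y = r *\<^sub>R (x * y)"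
    by (rule eqI, simp only: component_simps, rule cstar_category.cmp_smul_left[OF c]) (assumption | rule component_hom)+
  show "x * (r *\<^sub>R y) = r *\<^sub>R (x * y)"
    by (rule eqI, simp only: component_simps, rule cstar_category.cmp_smul_right[OF c]) (assumption | rule component_hom)+
  show "1 * x = x"
    by (rule eqI, simp only: component_simps, rule cstar_category.cmp_id(2)[OF c]) (assumption | rule component_hom)+
  show "x * 1 = x"
    by (rule eqI, simp only: component_simps, rule cstar_category.cmp_id(1)[OF c]) (assumption | rule component_hom)+
  show "x - y = x + - y"
    by (rule eqI) (simp add: component_simps)
  show "(r + s) *\<^sub>R x = r *\<^sub>R x + s *\<^sub>R x"
    by (rule eqI, simp only: component_simps of_real_add, rule cstar_category.add_smul[OF c])
      (assumption | rule component_hom)+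
  show "r *\<^sub>R s *\<^sub>R x = (r * s) *\<^sub>R x"
    by (rule eqI, simp only: component_simps of_real_mult, rule cstar_category.smul_smul[OF c])
      (assumption | rule component_hom)+
  show "1 *\<^sub>R x = x"
    by (rule eqI, simp only: component_simps of_real_1, rule cstar_category.smul_one[OF c])
      (assumption | rule component_hom)+
  show "dist x y = norm (x - y)" by (rule dist_endos_def)
  show "sgn x = scaleR (inverse (norm x)) x" by (rule sgn_endos_def)
  show "uniformity = (INF e\<in>{0 <..}. principal {(x :: ('a,'b) endos, y). dist x y < e})"
    by (rule uniformity_endos_def)
  show "open U \<longleftrightarrow> (\<forall>x\<in>U. eventually (\<lambda>(x', y). x' = x \<longrightarrow> y \<in> U) uniformity)"
    for U :: "('a,'b) endos set" by (rule open_endos_def)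
  show "norm x = 0 \<longleftrightarrow> x = 0"
  proof
    assume n: "norm x = 0"
    show "x = 0"
    proof (rule eqI)
      fix C :: "('a,'b) wcat" and B assume C: "cstar_cat C"
      then interpret cstar_category C by (rule c)
      have "nrm C (component x C B) = 0"
        using nrm_component_le[OF C, of x B] n nrm_nonneg[OF component_hom[OF C, of x B]]
        by (simp add: norm_endos_def)
      then show "component x C B = component 0 C B"
        using nrm_eq_zero[OF component_hom[OF C, of x B]] by (simp add: component_simps[OF C])
    qed
  next
    assume "x = 0"
    then have "endos_norm x \<le> 0"
      by (intro endos_norm_leI) (auto simp: component_simps cstar_category.nrm_zero[OF c])
    then show "norm x = 0" using endos_norm_nonneg[of x] by (simp add: norm_endos_def)
  qed
  show "norm (x + y) \<le> norm x + norm y"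
    unfolding norm_endos_def
  proof (rule endos_norm_leI)
    fix C :: "('a,'b) wcat" and B assume C: "cstar_cat C"
    then interpret cstar_category C by (rule c)
    show "nrm C (component (x + y) C B) \<le> endos_norm x + endos_norm y"
      using nrm_add[OF component_hom[OF C, of x B] component_hom[OF C, of y B]]
        nrm_component_le[OF C, of x B] nrm_component_le[OF C, of y B]
      by (simp add: component_simps[OF C])
  qed (simp add: endos_norm_nonneg)
  have norm_scaleR_le: "norm (r *\<^sub>R x) \<le> \<bar>r\<bar> * norm x" for r and x :: "('a,'b) endos"
    unfolding norm_endos_def
  proof (rule endos_norm_leI)
    fix C :: "('a,'b) wcat" and B assume C: "cstar_cat C"
    then interpret cstar_category C by (rule c)
    show "nrm C (component (r *\<^sub>R x) C B) \<le> \<bar>r\<bar> * endos_norm x"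
      using nrm_smul[OF component_hom[OF C, of x B], of "complex_of_real r"]
        nrm_component_le[OF C, of x B]
      by (simp add: component_simps[OF C] mult_left_mono)
  qed (simp add: endos_norm_nonneg)
  show "norm (r *\<^sub>R x) = \<bar>r\<bar> * norm x"
  proof (cases "r = 0")
    case True
    then show ?thesis
      using norm_scaleR_le[of r x] endos_norm_nonneg[of "r *\<^sub>R x"] by (simp add: norm_endos_def)
  next
    case False
    have "x = (1 / r) *\<^sub>R (r *\<^sub>R x)"
      by (rule eqI, simp only: component_simps, subst cstar_category.smul_smul[OF c])
        (use False in \<open>auto intro: component_hom cstar_category.smul_one[OF c, symmetric] simp flip: of_real_mult\<close>)
    then have "norm x \<le> \<bar>1 / r\<bar> * norm (r *\<^sub>R x)" by (metis norm_scaleR_le)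
    then have "\<bar>r\<bar> * norm x \<le> norm (r *\<^sub>R x)" using False by (simp add: field_simps)
    then show ?thesis using norm_scaleR_le[of r x] by simp
  qed
  show "norm (x * y) \<le> norm x * norm y"
    unfolding norm_endos_def
  proof (rule endos_norm_leI)
    fix C :: "('a,'b) wcat" and B assume C: "cstar_cat C"
    then interpret cstar_category C by (rule c)
    have "nrm C (component x C B) * nrm C (component y C B) \<le> endos_norm x * endos_norm y"
      by (intro mult_mono endos_norm_nonneg nrm_component_le[OF C] nrm_nonneg[OF component_hom[OF C]])
    then show "nrm C (component (x * y) C B) \<le> endos_norm x * endos_norm y"
      using nrm_cmp[OF component_hom[OF C, of y B] component_hom[OF C, of x B]]
      by (simp add: component_simps[OF C])
  qed (simp add: endos_norm_nonneg)
qed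

end

text \<open>Completeness as for bounded functions: limits exist in each component by
  \<open>complete\<close>, and the Cauchy condition controls all components at the same
  rate.\<close>

instance endos :: (type, type) banach
proof
  fix X :: "nat \<Rightarrow> ('a,'b) endos"
  assume Cauchy: "Cauchy X"
  have c: "cstar_category C" if "cstar_cat C" for C :: "('a,'b) wcat"
    using that by (simp add: cstar_category_def)
  have Cauchy': "\<exists>N. \<forall>m\<ge>N. \<forall>n\<ge>N. endos_norm (X m - X n) < e" if "e > 0" for e
    using Cauchy that unfolding Cauchy_def dist_endos_def norm_endos_def by blast
  have comp_sub: "nrm C (hadd C (component (X m) C B) (hsmul C (- 1) (component (X n) C B))) \<le> endos_norm (X m - X n)"
    if "cstar_cat C" for C B m n
    using nrm_component_le[OF that, of "X m - X n" B] by (simp add: component_simps[OF that])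
  have "\<exists>l\<in>Hom C B B. (\<lambda>n. nrm C (hadd C (component (X n) C B) (hsmul C (- 1) l))) \<longlonglongrightarrow> 0"
    if C: "cstar_cat C" for C B
    using Cauchy' comp_sub[OF C] by (intro cstar_category.complete[OF c[OF C]] component_hom[OF C]) (meson order_le_less_trans)
  then obtain l where l: "\<And>C B. cstar_cat C \<Longrightarrow> l C B \<in> Hom C B B"
    "\<And>C B. cstar_cat C \<Longrightarrow> (\<lambda>n. nrm C (hadd C (component (X n) C B) (hsmul C (- 1) (l C B)))) \<longlonglongrightarrow> 0"
    by metis
  \<comment> \<open>Letting \<open>m\<close> tend to infinity in the Cauchy estimate gives a bound
    that does not depend on \<open>C\<close> and \<open>B\<close>.\<close>
  have close: "nrm C (hadd C (component (X n) C B) (hsmul C (- 1) (l C B))) \<le> e"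
    if N: "\<forall>m\<ge>N. \<forall>n\<ge>N. endos_norm (X m - X n) < e" and n: "n \<ge> N" and C: "cstar_cat C" for N n e C B
  proof -
    interpret cstar_category C by (rule c[OF C])
    let ?x = "\<lambda>n. component (X n) C B"
    have x: "?x n \<in> Hom C B B" for n by (rule component_hom[OF C])
    have "nrm C (hsub (?x n) (l C B)) \<le> e + nrm C (hsub (?x m) (l C B))" if "m \<ge> N" for m
    proof -
      have "nrm C (hsub (?x n) (l C B)) \<le> nrm C (hsub (?x n) (?x m)) + nrm C (hsub (?x m) (l C B))"
        by (rule nrm_sub_triangle[OF x x l(1)[OF C]])
      also have "nrm C (hsub (?x n) (?x m)) \<le> e" 
        using comp_sub[OF C, of n B m] N[rule_format, OF n that] by linarith
      finally show ?thesis by simp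
    qed
    moreover have "(\<lambda>m. e + nrm C (hsub (?x m) (l C B))) \<longlonglongrightarrow> e + 0"
      by (intro tendsto_intros l(2)[OF C])
    ultimately show ?thesis using LIMSEQ_le_const[of _ "e + 0" "nrm C (hsub (?x n) (l C B))"] by fastforce
  qed
  obtain N1 where N1: "\<forall>m\<ge>N1. \<forall>n\<ge>N1. endos_norm (X m - X n) < 1" using Cauchy'[of 1] by auto
  have lb: "l C B \<in> Hom C B B \<and> nrm C (l C B) \<le> endos_norm (X N1) + 1" if C: "cstar_cat C" for C B
  proof -
    interpret cstar_category C by (rule c[OF C])
    let ?x = "component (X N1) C B"
    have x: "?x \<in> Hom C B B" by (rule component_hom[OF C])
    note lh = l(1)[OF C, of B]
    have "nrm C (l C B) \<le> nrm C ?x + nrm C (hsub ?x (l C B))"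
      by (rule nrm_le_add_nrm_sub[OF lh x])
    then show ?thesis
      using close[OF N1 _ C, of N1 B] nrm_component_le[OF C, of "X N1" B] lh by simp
  qed
  define L where "L = mk_endos l"
  have L: "component L C B = l C B" if "cstar_cat C" for C B
    unfolding L_def by (rule component_mk[OF lb that])
  have "X \<longlonglongrightarrow> L"
  proof (rule LIMSEQ_I)
    fix e :: real assume "e > 0"
    then obtain N where N: "\<forall>m\<ge>N. \<forall>n\<ge>N. endos_norm (X m - X n) < e / 2" using Cauchy'[of "e / 2"] by auto
    have "norm (X n - L) < e" if "n \<ge> N" for n
    proof -
      have "endos_norm (X n - L) \<le> e / 2"
        using \<open>e > 0\<close> close[OF N that] by (intro endos_norm_leI) (auto simp: component_simps L)
      then show ?thesis using \<open>e > 0\<close> by (simp add: norm_endos_def)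
    qed
    then show "\<exists>N. \<forall>n\<ge>N. norm (X n - L) < e" by blast
  qed
  then show "convergent X" by (auto simp: convergent_def)
qed

instantiation endos :: (type, type) cstar_algebra
begin

definition "(imag :: ('a,'b) endos) = mk_endos (\<lambda>C B. hsmul C \<i> (idm C B))"
definition "star (x :: ('a,'b) endos) = mk_endos (\<lambda>C B. adj C (component x C B))"

lemma component_star:
  fixes x :: "('a,'b) endos"
  assumes "cstar_cat C"
  shows "component imag C B = hsmul C \<i> (idm C B)"
    and "component (star x) C B = adj C (component x C B)"
proof -
  have c: "cstar_category C" if "cstar_cat C" for C :: "('a,'b) wcat"
    using that by (simp add: cstar_category_def)
  show "component imag C B = hsmul C \<i> (idm C B)" unfolding imag_endos_def
  proof (rule component_mk[where K=1])
    fix C :: "('a,'b) wcat" and B assume "cstar_cat C"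
    then interpret cstar_category C by (rule c)
    show "hsmul C \<i> (idm C B) \<in> Hom C B B \<and> nrm C (hsmul C \<i> (idm C B)) \<le> 1"
      using nrm_smul[OF id_hom, of \<i> B] nrm_id_le[of B] by (intro conjI smul_hom id_hom) simp
  qed fact
  show "component (star x) C B = adj C (component x C B)" unfolding star_endos_def
  proof (rule component_mk[where K="endos_norm x"])
    fix C :: "('a,'b) wcat" and B assume C: "cstar_cat C"
    then interpret cstar_category C by (rule c)
    note hx = component_hom[OF C, of x B]
    note nx = nrm_component_le[OF C, of x B]
    show "adj C (component x C B) \<in> Hom C B B \<and> nrm C (adj C (component x C B)) \<le> endos_norm x"
      using nrm_adj[OF hx] nx by (intro conjI adj_hom hx) simp
  qed fact
qed

instance
proof
  have c: "cstar_category C" if "cstar_cat C" for C :: "('a,'b) wcat"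
    using that by (simp add: cstar_category_def)
  note eqI = endos_eqI
  note component_simps = component_simps component_star
  fix x y z :: "('a,'b) endos" and r s :: real
  show "star (x + y) = star x + star y"
    by (rule eqI, simp only: component_simps, rule cstar_category.adj_add[OF c]) (assumption | rule component_hom)+
  show "star (x * y) = star y * star x"
    by (rule eqI, simp only: component_simps, rule cstar_category.adj_cmp[OF c]) (assumption | rule component_hom)+
  show "star (star x) = x"
    by (rule eqI, simp only: component_simps, rule cstar_category.adj_adj[OF c]) (assumption | rule component_hom)+
  show "(imag :: ('a,'b) endos) * imag = - 1"
    by (rule eqI, simp only: component_simps, rule cstar_category.ii_id_square[OF c]) (assumption | rule component_hom)+
  show "imag * x = x * imag"
    by (rule eqI, simp only: component_simps, rule cstar_category.ii_id_commute[OF c]) (assumption | rule component_hom)+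
  show "star (imag :: ('a,'b) endos) = - imag"
    by (rule eqI, simp only: component_simps, rule cstar_category.adj_ii_id[OF c]) (assumption | rule component_hom)+
  show "star (r *\<^sub>R x) = r *\<^sub>R star x"
    by (rule eqI, simp only: component_simps, rule trans[OF cstar_category.adj_smul[OF c]])
      (assumption | rule component_hom | simp)+
  show "norm (star x * x) = (norm x)\<^sup>2"
  proof (rule antisym)
    show "norm (star x * x) \<le> (norm x)\<^sup>2"
      unfolding norm_endos_def
    proof (rule endos_norm_leI)
      fix C :: "('a,'b) wcat" and B assume C: "cstar_cat C"
      then interpret cstar_category C by (rule c)
      show "nrm C (component (star x * x) C B) \<le> (endos_norm x)\<^sup>2"
        using nrm_star_mult[OF component_hom[OF C, of x B]] nrm_component_le[OF C, of x B]
          nrm_nonneg[OF component_hom[OF C, of x B]]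
        by (simp add: component_simps[OF C] power_mono)
    qed simp
    have "norm x \<le> sqrt (norm (star x * x))"
      unfolding norm_endos_def
    proof (rule endos_norm_leI)
      fix C :: "('a,'b) wcat" and B assume C: "cstar_cat C"
      then interpret cstar_category C by (rule c)
      have "(nrm C (component x C B))\<^sup>2 \<le> endos_norm (star x * x)"
        using nrm_star_mult[OF component_hom[OF C, of x B]] nrm_component_le[OF C, of "star x * x" B]
        by (simp add: component_simps[OF C])
      then show "nrm C (component x C B) \<le> sqrt (endos_norm (star x * x))"
        by (rule real_le_rsqrt)
    qed (simp add: endos_norm_nonneg)
    then have "(norm x)\<^sup>2 \<le> (sqrt (norm (star x * x)))\<^sup>2"
      using endos_norm_nonneg[of x] by (intro power_mono) (auto simp: norm_endos_def)
    then show "(norm x)\<^sup>2 \<le> norm (star x * x)"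
      using endos_norm_nonneg[of "star x * x"] by (simp add: norm_endos_def)
  qed
qed

end

context cstar_category
begin

lemma zero_add_zero: "hadd C (hzero C A B) (hzero C A B) = hzero C A B"
  by (rule add_zero[OF zero_hom])

lemma cmp_zero_zero: "cmp C (hzero C B D) (hzero C A B) = hzero C A D"
  by (rule cmp_zero_left[OF zero_hom])

section \<open>Endomorphism algebras as direct factors of the product\<close>

definition emb :: "'o \<Rightarrow> 'm \<Rightarrow> ('o,'m) endos" where
  "emb B a = mk_endos (\<lambda>D E. if D = C \<and> E = B then a else hzero D E E)"

lemma component_emb:
  assumes "a \<in> Hom C B B" "cstar_cat D"
  shows "component (emb B a) D E = (if D = C \<and> E = B then a else hzero D E E)"
  unfolding emb_def
proof (rule component_mk[where K="nrm C a", OF _ assms(2)])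
  fix D :: "('o,'m) wcat" and E assume "cstar_cat D"
  then interpret D: cstar_category D by (simp add: cstar_category_def)
  show "(if D = C \<and> E = B then a else hzero D E E) \<in> Hom D E E \<and>
      nrm D (if D = C \<and> E = B then a else hzero D E E) \<le> nrm C a"
    using assms(1) by (auto simp: D.nrm_zero nrm_nonneg)
qed

lemma emb_eqI:
  assumes "a \<in> Hom C B B" "component x C B = a"
    and "\<And>D E. cstar_cat D \<Longrightarrow> D \<noteq> C \<or> E \<noteq> B \<Longrightarrow> component x D E = hzero D E E"
  shows "x = emb B a"
  using assms by (intro endos_eqI) (auto simp: component_emb)

lemma emb_add:
  assumes "a \<in> Hom C B B" "b \<in> Hom C B B"
  shows "emb B (hadd C a b) = emb B a + emb B b"
  by (rule emb_eqI[symmetric])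
    (use assms cstar_cat in \<open>auto simp: component_simps component_emb cstar_category_def
      simp: cstar_category.zero_add_zero\<close>)

lemma emb_smul:
  assumes "a \<in> Hom C B B"
  shows "emb B (hsmul C (complex_of_real r) a) = r *\<^sub>R emb B a"
  by (rule emb_eqI[symmetric])
    (use assms cstar_cat in \<open>auto simp: component_simps component_emb cstar_category_def
      intro: cstar_category.smul_zero_right\<close>)

lemma emb_neg: "a \<in> Hom C B B \<Longrightarrow> emb B (hsmul C (- 1) a) = - emb B a"
  using emb_smul[of a B "- 1"] by simp

lemma emb_sub:
  "a \<in> Hom C B B \<Longrightarrow> b \<in> Hom C B B \<Longrightarrow> emb B (hsub a b) = emb B a - emb B b"
  by (simp add: emb_add emb_neg smul_hom)

lemma emb_zero: "emb B (hzero C B B) = 0"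
  by (rule emb_eqI[symmetric]) (use cstar_cat in \<open>auto simp: component_simps\<close>)

lemma emb_cmp:
  assumes "a \<in> Hom C B B" "b \<in> Hom C B B"
  shows "emb B (cmp C a b) = emb B a * emb B b"
  by (rule emb_eqI[symmetric])
    (use assms cstar_cat in \<open>auto simp: component_simps component_emb cstar_category_def
      simp: cstar_category.cmp_zero_zero\<close>)

lemma emb_adj:
  assumes "a \<in> Hom C B B"
  shows "emb B (adj C a) = star (emb B a)"
  by (rule emb_eqI[symmetric])
    (use assms cstar_cat in \<open>auto simp: component_star component_emb cstar_category_def
      simp: cstar_category.adj_zero\<close>)

lemma emb_inject:
  assumes "a \<in> Hom C B B" "b \<in> Hom C B B"
  shows "emb B a = emb B b \<longleftrightarrow> a = b"
proof
  assume "emb B a = emb B b"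
  then have "component (emb B a) C B = component (emb B b) C B" by simp
  then show "a = b" by (simp add: component_emb assms cstar_cat)
qed simp

lemma norm_emb:
  assumes "a \<in> Hom C B B"
  shows "norm (emb B a) = nrm C a"
proof (rule antisym)
  show "norm (emb B a) \<le> nrm C a"
    unfolding norm_endos_def
    by (rule endos_norm_leI)
      (use assms in \<open>auto simp: component_emb nrm_nonneg cstar_category.nrm_zero[unfolded cstar_category_def]\<close>)
  show "nrm C a \<le> norm (emb B a)"
    using nrm_component_le[OF cstar_cat, of "emb B a" B] assms cstar_cat
    by (simp add: component_emb norm_endos_def)
qed

text \<open>Since \<open>emb B\<close> maps the identity to a projection and not to \<open>1\<close>, the components outside
  \<open>(C, B)\<close> of the next two elements are scalars.\<close>

lemma norm_emb_add_scaleR_one_le: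
  assumes "a \<in> Hom C B B" "nrm C (hadd C a (hsmul C (complex_of_real r) (idm C B))) \<le> t" "\<bar>r\<bar> \<le> t"
  shows "norm (emb B a + r *\<^sub>R 1) \<le> t"
  unfolding norm_endos_def
proof (rule endos_norm_leI)
  fix D :: "('o,'m) wcat" and E assume D: "cstar_cat D"
  then interpret D: cstar_category D by (simp add: cstar_category_def)
  have "nrm D (hsmul D (complex_of_real r) (idm D E)) \<le> t"
    using D.nrm_smul[OF D.id_hom, of "complex_of_real r" E] D.nrm_id_le[of E] assms(3)
      mult_left_le[of "nrm D (idm D E)" "\<bar>r\<bar>"] by simp
  then show "nrm D (component (emb B a + r *\<^sub>R 1) D E) \<le> t"
    using assms(1,2) D by (auto simp: component_simps component_emb D.zero_add[OF D.smul_hom[OF D.id_hom]])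
qed (use assms(3) in simp)

lemma norm_emb_add_imag_le:
  assumes "a \<in> Hom C B B" "nrm C (hadd C a (hsmul C (complex_of_real r * \<i>) (idm C B))) \<le> t" "\<bar>r\<bar> \<le> t"
  shows "norm (emb B a + r *\<^sub>R imag) \<le> t"
  unfolding norm_endos_def
proof (rule endos_norm_leI)
  fix D :: "('o,'m) wcat" and E assume D: "cstar_cat D"
  then interpret D: cstar_category D by (simp add: cstar_category_def)
  have "nrm D (hsmul D (complex_of_real r * \<i>) (idm D E)) \<le> t"
    using D.nrm_smul[OF D.id_hom, of "complex_of_real r * \<i>" E] D.nrm_id_le[of E] assms(3)
      mult_left_le[of "nrm D (idm D E)" "\<bar>r\<bar>"] by (simp add: norm_mult)
  then show "nrm D (component (emb B a + r *\<^sub>R imag) D E) \<le> t"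
    using assms(1,2) D by (auto simp: component_simps component_star component_emb
        D.smul_smul[OF D.id_hom] D.zero_add[OF D.smul_hom[OF D.id_hom]])
qed (use assms(3) in simp)

lemma nrm_add_smul_id_le:
  assumes "a \<in> Hom C B B"
  shows "nrm C (hadd C a (hsmul C (complex_of_real r) (idm C B))) \<le> norm (emb B a + r *\<^sub>R 1)"
    and "nrm C (hadd C a (hsmul C (complex_of_real r * \<i>) (idm C B))) \<le> norm (emb B a + r *\<^sub>R imag)"
  using nrm_component_le[OF cstar_cat, of "emb B a + r *\<^sub>R 1" B]
    nrm_component_le[OF cstar_cat, of "emb B a + r *\<^sub>R imag" B] assms cstar_cat
  by (simp_all add: component_simps component_star component_emb norm_endos_def smul_smul[OF id_hom])

subsection \<open>Positive endomorphisms\<close>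

definition hpos :: "'o \<Rightarrow> 'm \<Rightarrow> bool" where
  "hpos B a \<longleftrightarrow> a \<in> Hom C B B \<and> pos (emb B a)"

lemma hpos_hom: "hpos B a \<Longrightarrow> a \<in> Hom C B B"
  by (simp add: hpos_def)

lemma hpos_adj: "hpos B a \<Longrightarrow> adj C a = a"
  using pos_star[of "emb B a"] emb_inject[of "adj C a" B a] by (auto simp: hpos_def emb_adj)

text \<open>With \<open>hpos_bound\<close> this describes positivity in \<open>Hom C B B\<close>
  relative to its own unit instead of the larger unit of the product. The shift is written as a
  fixed summand so that \<open>wlim_add_nrm_le\<close> applies to it.\<close>

lemma hposI:
  assumes a: "a \<in> Hom C B B" "adj C a = a" and t: "t \<ge> 0"
    "nrm C (hadd C a (hsmul C (complex_of_real (- t)) (idm C B))) \<le> t"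
  shows "hpos B a"
proof -
  have "norm (emb B a + (- t) *\<^sub>R 1) \<le> t"
    by (rule norm_emb_add_scaleR_one_le) (use a t in auto)
  also have "emb B a + (- t) *\<^sub>R 1 = - (t *\<^sub>R 1 - emb B a)" by simp
  finally have "norm (t *\<^sub>R 1 - emb B a) \<le> t" by (simp only: norm_minus_cancel)
  moreover have "star (emb B a) = emb B a" using a emb_adj[OF a(1)] by simp
  ultimately show ?thesis using a t(1) by (auto simp: hpos_def pos_def)
qed

lemma hpos_bound:
  assumes "hpos B a" "nrm C a \<le> t"
  shows "nrm C (hadd C a (hsmul C (complex_of_real (- t)) (idm C B))) \<le> t"
proof -
  have a: "a \<in> Hom C B B" "pos (emb B a)" using assms by (auto simp: hpos_def)
  have "norm (t *\<^sub>R 1 - emb B a) \<le> t"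
    using assms(2) by (intro pos_norm_bound a) (simp add: norm_emb a)
  also have "t *\<^sub>R 1 - emb B a = - (emb B a + (- t) *\<^sub>R 1)" by simp
  finally have "norm (emb B a + (- t) *\<^sub>R 1) \<le> t" by (simp only: norm_minus_cancel)
  then show ?thesis using nrm_add_smul_id_le(1)[OF a(1), of "- t"] by linarith
qed

text \<open>For \<open>x\<close> between different objects \<open>pos_star_mult\<close> does not
  apply directly. The axiom that \<open>x\<close> may be replaced by an endomorphism
  \<open>b\<close> closes this gap.\<close>

lemma hpos_star_mult:
  assumes "x \<in> Hom C A B"
  shows "hpos A (cmp C (adj C x) x)"
proof -
  obtain b where b: "b \<in> Hom C A A" "cmp C (adj C x) x = cmp C (adj C b) b"
    using star_mult_endo[OF assms] by blast
  then have "emb A (cmp C (adj C x) x) = star (emb A b) * emb A b"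
    by (simp add: emb_cmp emb_adj adj_hom)
  then show ?thesis
    using b by (auto simp: hpos_def pos_star_mult adj_hom intro: cmp_hom)
qed

lemma hpos_mult_star: "x \<in> Hom C A B \<Longrightarrow> hpos B (cmp C x (adj C x))"
  using hpos_star_mult[of "adj C x" B A] by (simp add: adj_hom adj_adj)

lemma hpos_antisym:
  assumes "a \<in> Hom C B B" "b \<in> Hom C B B" "hpos B (hsub a b)" "hpos B (hsub b a)"
  shows "a = b"
proof -
  have "emb B a - emb B b = 0"
    using assms by (intro pos_antisym) (simp_all add: hpos_def emb_sub)
  then show ?thesis using emb_inject assms by simp
qed

lemma hpos_norm_mono:
  assumes "hpos B a" "b \<in> Hom C B B" "hpos B (hsub b a)"
  shows "nrm C a \<le> nrm C b"
  using pos_norm_mono[of "emb B a" "emb B b"] assms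
  by (auto simp: hpos_def emb_sub norm_emb)

lemma hpos_id_sub:
  assumes "a \<in> Hom C B B" "adj C a = a" "nrm C a \<le> 1"
  shows "hpos B (hsub (idm C B) a)"
proof (rule hposI[where t=1])
  \<comment> \<open>With witness 1 the identity cancels, and only \<open>- a\<close> is left to be
    bounded.\<close>
  have "hadd C (hsub (idm C B) a) (hsmul C (complex_of_real (- 1)) (idm C B)) = hsmul C (- 1) a"
    using assms(1) add_commute[of "idm C B" B B "hsmul C (- 1) a"]
      add_assoc[of "hsmul C (- 1) a" B B "idm C B" "hsmul C (- 1) (idm C B)"]
    by (simp add: smul_hom sub_self[of "idm C B" B B] add_zero)
  then show "nrm C (hadd C (hsub (idm C B) a) (hsmul C (complex_of_real (- 1)) (idm C B))) \<le> 1"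
    using assms(3) nrm_smul[OF assms(1), of "- 1"] by simp
qed (use assms in \<open>auto simp: adj_sub[OF id_hom assms(1)] adj_id intro: sub_hom\<close>)

lemma selfadjoint_of_nrm_add_imag:
  assumes a: "a \<in> Hom C B B"
    and le: "\<And>n::real. (nrm C (hadd C a (hsmul C (complex_of_real n * \<i>) (idm C B))))\<^sup>2 \<le> K\<^sup>2 + n\<^sup>2"
  shows "adj C a = a"
proof -
  have "(norm (emb B a + n *\<^sub>R imag))\<^sup>2 \<le> K\<^sup>2 + n\<^sup>2" for n
  proof -
    \<comment> \<open>The right-hand side is at least the modulus of \<open>n\<close>, so it also
      bounds the scalar components outside \<open>(C, B)\<close>.\<close>
    have "norm (emb B a + n *\<^sub>R imag) \<le> sqrt (K\<^sup>2 + n\<^sup>2)"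
      by (rule norm_emb_add_imag_le[OF a]) (use le[of n] in \<open>auto intro: real_le_rsqrt\<close>)
    then show ?thesis by (simp add: sqrt_ge_absD)
  qed
  then have "star (emb B a) = emb B a" by (rule selfadjoint_of_norm_add_imag)
  then show ?thesis using emb_inject[OF adj_hom[OF a] a] emb_adj[OF a] by simp
qed

lemma nrm_selfadjoint_add_imag_le:
  assumes a: "a \<in> Hom C B B" "adj C a = a"
  shows "(nrm C (hadd C a (hsmul C (complex_of_real n * \<i>) (idm C B))))\<^sup>2 \<le> (nrm C a)\<^sup>2 + n\<^sup>2"
proof -
  let ?b = "hadd C a (hsmul C (complex_of_real n * \<i>) (idm C B))"
  have "?b \<in> Hom C B B" using a by (intro add_hom smul_hom id_hom)
  then have "(nrm C ?b)\<^sup>2 \<le> (norm (emb B a + n *\<^sub>R imag))\<^sup>2"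
    by (intro power_mono nrm_add_smul_id_le a nrm_nonneg)
  also have "\<dots> \<le> (norm (emb B a))\<^sup>2 + n\<^sup>2"
    using a emb_adj[OF a(1)] by (intro norm_selfadjoint_add_imag_le) simp
  finally show ?thesis by (simp add: norm_emb a)
qed

lemma eq_zero_of_nrm_add_smul_id:
  assumes a: "a \<in> Hom C B B" "adj C a = a"
    and le: "\<And>n::real. (nrm C (hadd C a (hsmul C (complex_of_real n) (idm C B))))\<^sup>2 \<le> K\<^sup>2 + n\<^sup>2"
  shows "a = hzero C B B"
proof -
  have "(norm (n *\<^sub>R 1 + emb B a))\<^sup>2 \<le> K\<^sup>2 + n\<^sup>2" for n
  proof -
    have "norm (emb B a + n *\<^sub>R 1) \<le> sqrt (K\<^sup>2 + n\<^sup>2)"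
      by (rule norm_emb_add_scaleR_one_le[OF a(1)]) (use le[of n] in \<open>auto intro: real_le_rsqrt\<close>)
    then show ?thesis by (simp add: sqrt_ge_absD add.commute)
  qed
  then have "emb B a = 0"
    using a emb_adj[OF a(1)] by (intro selfadjoint_zero_of_norm_add[where K=K]) simp
  then show ?thesis using emb_inject[OF a(1) zero_hom] by (simp add: emb_zero)
qed

text \<open>The mixed products with adjoints vanish, so the product of \<open>a + b\<close> with its
  adjoint is the sum of the corresponding products for \<open>a\<close> and
  \<open>b\<close>.\<close>

lemma pythagoras_le:
  assumes a: "a \<in> Hom C A B" and b: "b \<in> Hom C A B" and ab: "cmp C a (adj C b) = hzero C B B"
  shows "(nrm C (hadd C a b))\<^sup>2 \<le> (nrm C a)\<^sup>2 + (nrm C b)\<^sup>2"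
proof -
  have ba: "cmp C b (adj C a) = hzero C B B"
    using arg_cong[OF ab, of "adj C"] adj_cmp[OF adj_hom[OF b] a] by (simp add: adj_adj[OF b] adj_zero)
  have "cmp C (hadd C a b) (adj C (hadd C a b)) =
      hadd C (cmp C a (adj C a)) (cmp C b (adj C b))"
    using a b ab ba
    by (simp add: adj_add[OF a b] cmp_add_left[OF add_hom[OF adj_hom[OF a] adj_hom[OF b]] a b]
        cmp_add_right[OF adj_hom[OF a] adj_hom[OF b] a] cmp_add_right[OF adj_hom[OF a] adj_hom[OF b] b]
        add_zero[OF cmp_hom[OF adj_hom[OF a] a]] zero_add[OF cmp_hom[OF adj_hom[OF b] b]])
  then have "(nrm C (hadd C a b))\<^sup>2 = nrm C (hadd C (cmp C a (adj C a)) (cmp C b (adj C b)))"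
    using nrm_mult_star[OF add_hom[OF a b]] by simp
  also have "\<dots> \<le> (nrm C a)\<^sup>2 + (nrm C b)\<^sup>2"
    using nrm_add[OF cmp_hom[OF adj_hom[OF a] a] cmp_hom[OF adj_hom[OF b] b]]
    by (simp add: nrm_mult_star[OF a] nrm_mult_star[OF b])
  finally show ?thesis .
qed

lemma nrm_projection_le:
  assumes "p \<in> Hom C A A" "cmp C p p = p" "adj C p = p"
  shows "nrm C p \<le> 1"
proof -
  have "nrm C p * nrm C p = nrm C p"
    using nrm_star_mult[OF assms(1)] assms(2,3) by (simp add: power2_eq_square)
  then have "nrm C p = 0 \<or> nrm C p = 1" by (simp only: mult_cancel_right2)
  then show ?thesis by linarith
qed

subsection \<open>Finite sums of morphisms\<close>

text \<open>\<open>fsum\<close> covers endomorphisms only. Sums of morphisms from \<open>A\<close>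
  to \<open>B\<close> are needed to assemble a morphism out of a direct sum.\<close>

definition hsum :: "'o \<Rightarrow> 'o \<Rightarrow> 'i set \<Rightarrow> ('i \<Rightarrow> 'm) \<Rightarrow> 'm" where
  "hsum A B F g = Finite_Set.fold (\<lambda>i acc. hadd C (g i) acc) (hzero C A B) F"

lemma fsum_eq_hsum: "fsum C B F g = hsum B B F g"
  by (simp add: fsum_def hsum_def)

lemma hsum_empty [simp]: "hsum A B {} g = hzero C A B"
  by (simp add: hsum_def)

text \<open>\<open>hadd C\<close> is associative and commutative on a hom-set only, so the folded
  function need not commute on all arguments. Replacing it by the identity outside the hom-set
  repairs this, and the fold never leaves the hom-set.\<close>

lemma hsum_insert_hom:
  assumes "finite F" "i \<notin> F" "\<And>j. j \<in> insert i F \<Longrightarrow> g j \<in> Hom C A B"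
  shows "hsum A B (insert i F) g = hadd C (g i) (hsum A B F g) \<and> hsum A B F g \<in> Hom C A B"
proof -
  define f where "f j acc = (if acc \<in> Hom C A B then hadd C (g j) acc else acc)" for j acc
  have f_eq: "hsum A B F' g = Finite_Set.fold f (hzero C A B) F'" if "F' \<subseteq> insert i F" for F'
    unfolding hsum_def
    by (rule fold_closed_eq[where B="Hom C A B"]) (use that assms(3) in \<open>auto simp: f_def\<close>)
  interpret comp_fun_commute_on "insert i F" f
  proof
    fix j k assume jk: "j \<in> insert i F" "k \<in> insert i F"
    note g = assms(3)[OF jk(1)] assms(3)[OF jk(2)]
    show "f k \<circ> f j = f j \<circ> f k"
    proof
      fix acc
      show "(f k \<circ> f j) acc = (f j \<circ> f k) acc"
      proof (cases "acc \<in> Hom C A B")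
        case True
        have "hadd C (g k) (hadd C (g j) acc) = hadd C (hadd C (g j) (g k)) acc"
          using add_assoc[OF g(2,1) True] add_commute[OF g] by simp
        also have "\<dots> = hadd C (g j) (hadd C (g k) acc)" by (rule add_assoc[OF g True])
        finally show ?thesis using True g by (simp add: f_def add_hom)
      qed (simp add: f_def)
    qed
  qed
  have "Finite_Set.fold f (hzero C A B) F' \<in> Hom C A B" if "finite F'" "F' \<subseteq> insert i F" for F'
    using that
  proof (induction F')
    case (insert j F')
    have "f j acc \<in> Hom C A B" if "acc \<in> Hom C A B" for acc
      using insert(4) assms(3)[of j] that by (auto simp: f_def)
    then show ?case using insert by (subst fold_insert) auto
  qed simp
  with assms(1) have F: "hsum A B F g \<in> Hom C A B"
    by (simp add: f_eq[OF subset_insertI] subset_insertI)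
  have "hsum A B (insert i F) g = f i (Finite_Set.fold f (hzero C A B) F)"
    unfolding f_eq[OF order_refl] using assms by (subst fold_insert) auto
  then show ?thesis
    using F by (simp add: f_eq[OF subset_insertI, symmetric] f_def)
qed

lemma hsum_insert:
  assumes "finite F" "i \<notin> F" "g i \<in> Hom C A B" "\<And>j. j \<in> F \<Longrightarrow> g j \<in> Hom C A B"
  shows "hsum A B (insert i F) g = hadd C (g i) (hsum A B F g)"
  using hsum_insert_hom[of F i g A B] assms by auto

lemma hsum_hom:
  assumes "finite F" "\<And>j. j \<in> F \<Longrightarrow> g j \<in> Hom C A B"
  shows "hsum A B F g \<in> Hom C A B"
  using assms
proof (induction F)
  case (insert i F)
  then show ?case using add_hom[of "g i" A B "hsum A B F g"] by (simp add: hsum_insert)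
qed simp

lemma hsum_cong:
  assumes "finite F" "\<And>j. j \<in> F \<Longrightarrow> g j \<in> Hom C A B" "\<And>j. j \<in> F \<Longrightarrow> g j = h j"
  shows "hsum A B F g = hsum A B F h"
proof -
  have "h j \<in> Hom C A B" if "j \<in> F" for j using assms(2,3)[OF that] by simp
  with assms show ?thesis by (induction F) (auto simp: hsum_insert)
qed

lemma cmp_hsum_right:
  assumes "finite F" "\<And>j. j \<in> F \<Longrightarrow> g j \<in> Hom C A B" "h \<in> Hom C B D"
  shows "cmp C h (hsum A B F g) = hsum A D F (\<lambda>j. cmp C h (g j))"
  using assms(1,2)
proof (induction F)
  case (insert i F)
  then show ?case
    using assms(3) cmp_add_right[OF _ hsum_hom[OF insert(1)], of "g i" A B g h D]
    by (simp add: hsum_insert cmp_hom[OF _ assms(3)])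
qed (use assms(3) in \<open>simp add: cmp_zero_right\<close>)

lemma cmp_hsum_left:
  assumes "finite F" "\<And>j. j \<in> F \<Longrightarrow> g j \<in> Hom C B D" "h \<in> Hom C A B"
  shows "cmp C (hsum B D F g) h = hsum A D F (\<lambda>j. cmp C (g j) h)"
  using assms(1,2)
proof (induction F)
  case (insert i F)
  then show ?case
    using assms(3) cmp_add_left[OF assms(3) _ hsum_hom[OF insert(1)], of "g i" D g]
    by (simp add: hsum_insert cmp_hom[OF assms(3)])
qed (use assms(3) in \<open>simp add: cmp_zero_left\<close>)

lemma adj_hsum:
  assumes "finite F" "\<And>j. j \<in> F \<Longrightarrow> g j \<in> Hom C A B"
  shows "adj C (hsum A B F g) = hsum B A F (\<lambda>j. adj C (g j))"
  using assms
proof (induction F)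
  case (insert i F)
  then show ?case
    using adj_add[OF _ hsum_hom[OF insert(1)], of "g i" A B g]
    by (simp add: hsum_insert adj_hom)
qed (simp add: adj_zero)

lemma hsum_single:
  assumes "finite F" "j \<in> F \<Longrightarrow> g j \<in> Hom C A B" "\<And>i. i \<in> F \<Longrightarrow> i \<noteq> j \<Longrightarrow> g i = hzero C A B"
  shows "hsum A B F g = (if j \<in> F then g j else hzero C A B)"
proof -
  have hom: "g i \<in> Hom C A B" if "i \<in> F" for i
    using assms(2,3) that by (cases "i = j") auto
  with assms show ?thesis
  proof (induction F)
    case (insert i F)
    then have "hsum A B (insert i F) g = hadd C (g i) (if j \<in> F then g j else hzero C A B)"
      by (simp add: hsum_insert)
    then show ?case
      using insert by (cases "i = j") (auto simp: add_zero zero_add)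
  qed simp
qed

lemma emb_hsum:
  assumes "finite F" "\<And>j. j \<in> F \<Longrightarrow> g j \<in> Hom C B B"
  shows "emb B (hsum B B F g) = (\<Sum>j\<in>F. emb B (g j))"
  using assms
proof (induction F)
  case (insert i F)
  then show ?case by (simp add: hsum_insert emb_add[OF _ hsum_hom])
qed (simp add: emb_zero)

lemma hpos_hsum_sub:
  assumes "finite F" "F' \<subseteq> F" "\<And>j. j \<in> F \<Longrightarrow> hpos B (g j)"
  shows "hpos B (hsub (hsum B B F g) (hsum B B F' g))"
proof -
  have hom: "g j \<in> Hom C B B" if "j \<in> F" for j using assms(3) that by (simp add: hpos_def)
  have fin: "finite F'" using assms finite_subset by blast
  have "pos (\<Sum>j\<in>G. emb B (g j))" if "finite G" "G \<subseteq> F" for G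
    using that by (induction G) (use assms(3) in \<open>auto simp: hpos_def intro: pos_add\<close>)
  moreover have "emb B (hsub (hsum B B F g) (hsum B B F' g)) = (\<Sum>j\<in>F - F'. emb B (g j))"
    using assms fin hom by (subst emb_sub) (auto simp: emb_hsum hsum_hom sum_diff subset_iff)
  ultimately show ?thesis
    using assms fin hom by (auto simp: hpos_def intro!: sub_hom hsum_hom)
qed

end

section \<open>Weak limits in hom-sets with a predual\<close>

context cstar_category
begin

lemma blfD:
  assumes "blf C A B \<phi>"
  shows "x \<in> Hom C A B \<Longrightarrow> y \<in> Hom C A B \<Longrightarrow> \<phi> (hadd C x y) = \<phi> x + \<phi> y"
    and "x \<in> Hom C A B \<Longrightarrow> \<phi> (hsmul C c x) = c * \<phi> x"
  using assms by (auto simp: blf_def)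

lemma blf_zero:
  assumes "blf C A B \<phi>"
  shows "\<phi> (hzero C A B) = 0"
  using blfD(2)[OF assms zero_hom, of 0] by (simp add: smul_zero_right)

lemma blf_hsum:
  assumes "blf C A B \<phi>" "finite F" "\<And>j. j \<in> F \<Longrightarrow> g j \<in> Hom C A B"
  shows "\<phi> (hsum A B F g) = (\<Sum>j\<in>F. \<phi> (g j))"
  using assms(2,3)
proof (induction F)
  case (insert i F)
  then show ?case by (simp add: hsum_insert blfD(1)[OF assms(1) _ hsum_hom])
qed (simp add: blf_zero[OF assms(1)])

lemma blf_le_fnorm:
  assumes \<phi>: "blf C A B \<phi>" and x: "x \<in> Hom C A B"
  shows "cmod (\<phi> x) \<le> fnorm C A B \<phi> * nrm C x"
proof (cases "nrm C x = 0")
  case True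
  then have "x = hzero C A B" using nrm_eq_zero[OF x] by simp
  then show ?thesis using blf_zero[OF \<phi>] True by simp
next
  case False
  then have pos: "nrm C x > 0" using nrm_nonneg[OF x] by simp
  obtain K where K: "\<forall>x\<in>Hom C A B. cmod (\<phi> x) \<le> K * nrm C x"
    using \<phi> unfolding blf_def by blast
  have "bdd_above ((\<lambda>x. cmod (\<phi> x)) ` {x \<in> Hom C A B. nrm C x \<le> 1})"
  proof (rule bdd_aboveI2)
    fix z assume z: "z \<in> {x \<in> Hom C A B. nrm C x \<le> 1}"
    have "cmod (\<phi> z) \<le> K * nrm C z" using K z by simp
    also have "\<dots> \<le> \<bar>K\<bar> * 1" using z nrm_nonneg by (intro mult_mono) auto
    finally show "cmod (\<phi> z) \<le> \<bar>K\<bar>" by simp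
  qed
  moreover have "hsmul C (complex_of_real (1 / nrm C x)) x \<in> {x \<in> Hom C A B. nrm C x \<le> 1}"
    using x pos nrm_smul[OF x, of "complex_of_real (1 / nrm C x)"] by (auto simp: norm_divide)
  ultimately have "cmod (\<phi> (hsmul C (complex_of_real (1 / nrm C x)) x)) \<le> fnorm C A B \<phi>"
    unfolding fnorm_def by (intro cSUP_upper)
  then show ?thesis
    using pos by (simp add: blfD(2)[OF \<phi> x] norm_mult norm_divide field_simps)
qed

section \<open>Preduals\<close>

context
  fixes A B P
  assumes P: "is_predual C A B P"
begin

lemma predual_blf: "\<phi> \<in> P \<Longrightarrow> blf C A B \<phi>"
  using P by (auto simp: is_predual_def)

lemma predual_add: "\<phi> \<in> P \<Longrightarrow> \<psi> \<in> P \<Longrightarrow> (\<lambda>x. \<phi> x + \<psi> x) \<in> P"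
proof -
  have "\<forall>\<phi>\<in>P. \<forall>\<psi>\<in>P. (\<lambda>x. \<phi> x + \<psi> x) \<in> P"
    using P unfolding is_predual_def by (elim conjE)
  then show "\<phi> \<in> P \<Longrightarrow> \<psi> \<in> P \<Longrightarrow> (\<lambda>x. \<phi> x + \<psi> x) \<in> P" by simp
qed

lemma predual_smul: "\<phi> \<in> P \<Longrightarrow> (\<lambda>x. c * \<phi> x) \<in> P"
proof -
  have "\<forall>c. \<forall>\<phi>\<in>P. (\<lambda>x. c * \<phi> x) \<in> P"
    using P unfolding is_predual_def by (elim conjE)
  then show "\<phi> \<in> P \<Longrightarrow> (\<lambda>x. c * \<phi> x) \<in> P" by simp
qed

lemma predual_represents:
  assumes "\<And>\<phi> \<psi>. \<phi> \<in> P \<Longrightarrow> \<psi> \<in> P \<Longrightarrow> \<Psi> (\<lambda>x. \<phi> x + \<psi> x) = \<Psi> \<phi> + \<Psi> \<psi>"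
    and "\<And>c \<phi>. \<phi> \<in> P \<Longrightarrow> \<Psi> (\<lambda>x. c * \<phi> x) = c * \<Psi> \<phi>"
    and "\<And>\<phi>. \<phi> \<in> P \<Longrightarrow> cmod (\<Psi> \<phi>) \<le> K * fnorm C A B \<phi>"
  obtains x where "x \<in> Hom C A B" "\<And>\<phi>. \<phi> \<in> P \<Longrightarrow> \<Psi> \<phi> = \<phi> x"
proof -
  have "\<forall>\<Psi> :: ('m \<Rightarrow> complex) \<Rightarrow> complex.
         (\<forall>\<phi>\<in>P. \<forall>\<psi>\<in>P. \<Psi> (\<lambda>x. \<phi> x + \<psi> x) = \<Psi> \<phi> + \<Psi> \<psi>) \<longrightarrow>
         (\<forall>c. \<forall>\<phi>\<in>P. \<Psi> (\<lambda>x. c * \<phi> x) = c * \<Psi> \<phi>) \<longrightarrow>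
         (\<exists>K. \<forall>\<phi>\<in>P. cmod (\<Psi> \<phi>) \<le> K * fnorm C A B \<phi>) \<longrightarrow>
         (\<exists>x\<in>Hom C A B. \<forall>\<phi>\<in>P. \<Psi> \<phi> = \<phi> x)"
    using P unfolding is_predual_def by (elim conjE)
  from this[rule_format, of \<Psi>] have "\<exists>x\<in>Hom C A B. \<forall>\<phi>\<in>P. \<Psi> \<phi> = \<phi> x"
    using assms(1-3) by blast
  with that show thesis by blast
qed

lemma nrm_le_predual:
  assumes "x \<in> Hom C A B" "\<And>\<phi>. \<phi> \<in> P \<Longrightarrow> fnorm C A B \<phi> \<le> 1 \<Longrightarrow> cmod (\<phi> x) \<le> r"
  shows "nrm C x \<le> r"
proof -
  \<comment> \<open>The zero functional shows that the supremum defining the norm is taken over a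
    nonempty set.\<close>
  have "fnorm C A B (\<lambda>x. 0) = 0"
    unfolding fnorm_def using nrm_zero[of A B]
    by (subst cSUP_const) (auto intro: exI[of _ "hzero C A B"])
  then have "{\<phi> \<in> P. fnorm C A B \<phi> \<le> 1} \<noteq> {}"
    using P by (auto simp: is_predual_def intro!: exI[of _ "\<lambda>x. 0"])
  then have "(SUP \<phi>\<in>{\<phi>\<in>P. fnorm C A B \<phi> \<le> 1}. cmod (\<phi> x)) \<le> r"
    using assms(2) by (intro cSUP_least) auto
  moreover have "\<forall>x\<in>Hom C A B. nrm C x = (SUP \<phi>\<in>{\<phi>\<in>P. fnorm C A B \<phi> \<le> 1}. cmod (\<phi> x))"
    using P unfolding is_predual_def by (elim conjE)
  ultimately show ?thesis using assms(1) by simp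
qed

lemma predual_separates:
  assumes "x \<in> Hom C A B" "y \<in> Hom C A B" "\<And>\<phi>. \<phi> \<in> P \<Longrightarrow> \<phi> x = \<phi> y"
  shows "x = y"
proof -
  have "nrm C (hsub x y) \<le> 0"
  proof (rule nrm_le_predual[OF sub_hom[OF assms(1,2)]])
    fix \<phi> assume \<phi>: "\<phi> \<in> P"
    note b = blfD[OF predual_blf[OF \<phi>]]
    show "cmod (\<phi> (hsub x y)) \<le> 0"
      using assms(3)[OF \<phi>] by (simp add: b(1)[OF assms(1) smul_hom[OF assms(2)]] b(2)[OF assms(2)])
  qed
  then have "hsub x y = hzero C A B"
    using nrm_nonneg[OF sub_hom[OF assms(1,2)]] nrm_eq_zero[OF sub_hom[OF assms(1,2)]] by simp
  then show ?thesis by (rule sub_eq_zero[OF assms(1,2)])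
qed

end

section \<open>Weak limits along filters and compactness\<close>

text \<open>Convergence for the weak topology that \<open>P\<close> induces. The filter is arbitrary
  because cluster points enter as limits along finer filters.\<close>

definition wlim :: "'o \<Rightarrow> 'o \<Rightarrow> ('m \<Rightarrow> complex) set \<Rightarrow> 'k filter \<Rightarrow> ('k \<Rightarrow> 'm) \<Rightarrow> 'm \<Rightarrow> bool" where
  "wlim A B P G y x \<longleftrightarrow> x \<in> Hom C A B \<and> (\<forall>\<phi>\<in>P. ((\<lambda>k. \<phi> (y k)) \<longlongrightarrow> \<phi> x) G)"

lemma wlim_add:
  assumes "is_predual C A B P" "wlim A B P G y x" "w \<in> Hom C A B" "\<forall>\<^sub>F k in G. y k \<in> Hom C A B"
  shows "wlim A B P G (\<lambda>k. hadd C (y k) w) (hadd C x w)"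
  unfolding wlim_def
proof (intro conjI ballI)
  have x: "x \<in> Hom C A B" using assms(2) by (simp add: wlim_def)
  then show "hadd C x w \<in> Hom C A B" using assms(3) by (rule add_hom)
  fix \<phi> assume \<phi>: "\<phi> \<in> P"
  note b = predual_blf[OF assms(1) \<phi>]
  have "((\<lambda>k. \<phi> (y k) + \<phi> w) \<longlongrightarrow> \<phi> x + \<phi> w) G"
    using assms(2) \<phi> by (intro tendsto_intros) (auto simp: wlim_def)
  moreover have "\<forall>\<^sub>F k in G. \<phi> (y k) + \<phi> w = \<phi> (hadd C (y k) w)"
    using assms(4) by eventually_elim (simp add: blfD(1)[OF b _ assms(3)])
  ultimately show "((\<lambda>k. \<phi> (hadd C (y k) w)) \<longlongrightarrow> \<phi> (hadd C x w)) G"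
    using blfD(1)[OF b x assms(3)] by (simp add: tendsto_cong)
qed

lemma wlim_smul:
  assumes "is_predual C A B P" "wlim A B P G y x" "\<forall>\<^sub>F k in G. y k \<in> Hom C A B"
  shows "wlim A B P G (\<lambda>k. hsmul C c (y k)) (hsmul C c x)"
  unfolding wlim_def
proof (intro conjI ballI)
  have x: "x \<in> Hom C A B" using assms(2) by (simp add: wlim_def)
  then show "hsmul C c x \<in> Hom C A B" by (rule smul_hom)
  fix \<phi> assume \<phi>: "\<phi> \<in> P"
  note b = predual_blf[OF assms(1) \<phi>]
  have "((\<lambda>k. c * \<phi> (y k)) \<longlongrightarrow> c * \<phi> x) G"
    using assms(2) \<phi> by (intro tendsto_intros) (auto simp: wlim_def)
  moreover have "\<forall>\<^sub>F k in G. c * \<phi> (y k) = \<phi> (hsmul C c (y k))"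
    using assms(3) by eventually_elim (simp add: blfD(2)[OF b])
  ultimately show "((\<lambda>k. \<phi> (hsmul C c (y k))) \<longlongrightarrow> \<phi> (hsmul C c x)) G"
    using blfD(2)[OF b x] by (simp add: tendsto_cong)
qed

text \<open>Closed balls are weakly closed, since the norm is a supremum of moduli of functionals in
  \<open>P\<close>.\<close>

lemma wlim_nrm_le:
  assumes P: "is_predual C A B P" and l: "wlim A B P G y x" and G: "G \<noteq> bot"
    and y: "\<forall>\<^sub>F k in G. y k \<in> Hom C A B \<and> nrm C (y k) \<le> r"
  shows "nrm C x \<le> r"
proof (rule nrm_le_predual[OF P])
  show "x \<in> Hom C A B" using l by (simp add: wlim_def)
  fix \<phi> assume \<phi>: "\<phi> \<in> P" "fnorm C A B \<phi> \<le> 1"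
  have "((\<lambda>k. cmod (\<phi> (y k))) \<longlongrightarrow> cmod (\<phi> x)) G"
    using l \<phi> by (intro tendsto_intros) (auto simp: wlim_def)
  moreover have "\<forall>\<^sub>F k in G. cmod (\<phi> (y k)) \<le> r"
    using y
  proof eventually_elim
    case (elim k)
    have "cmod (\<phi> (y k)) \<le> fnorm C A B \<phi> * nrm C (y k)"
      using elim by (intro blf_le_fnorm predual_blf[OF P \<phi>(1)]) auto
    also have "\<dots> \<le> 1 * r" using elim \<phi>(2) nrm_nonneg[of "y k" A B] by (intro mult_mono) auto
    finally show ?case by simp
  qed
  ultimately show "cmod (\<phi> x) \<le> r" using G by (intro tendsto_upperbound) auto
qed

text \<open>Balls with arbitrary centre \<open>- w\<close> are weakly closed. All information about
  products, order and adjoints crosses a weak limit through this lemma.\<close>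

lemma wlim_add_nrm_le:
  assumes "is_predual C A B P" "wlim A B P G y x" "G \<noteq> bot" "w \<in> Hom C A B"
    and "\<forall>\<^sub>F k in G. y k \<in> Hom C A B \<and> nrm C (hadd C (y k) w) \<le> r"
  shows "nrm C (hadd C x w) \<le> r"
proof (rule wlim_nrm_le[OF assms(1) _ assms(3)])
  show "wlim A B P G (\<lambda>k. hadd C (y k) w) (hadd C x w)"
    by (rule wlim_add[OF assms(1,2,4)]) (use assms(5) in \<open>auto elim: eventually_mono\<close>)
  show "\<forall>\<^sub>F k in G. hadd C (y k) w \<in> Hom C A B \<and> nrm C (hadd C (y k) w) \<le> r"
    using assms(5) by eventually_elim (auto intro: add_hom assms(4))
qed

text \<open>The Banach-Alaoglu theorem, by Tychonoff on the space of all functions on \<open>P\<close>.\<close>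

lemma wlim_cluster:
  assumes P: "is_predual C A B P" and G: "G \<noteq> bot"
    and y: "\<forall>\<^sub>F k in G. y k \<in> Hom C A B \<and> nrm C (y k) \<le> K"
  obtains G' x where "G' \<le> G" "G' \<noteq> bot" "wlim A B P G' y x" "nrm C x \<le> K"
proof -
  \<comment> \<open>Coordinates outside \<open>P\<close> are pinned to 0, which makes the product
    over all functions compact.\<close>
  define T where "T \<phi> = (if \<phi> \<in> P then cball 0 (fnorm C A B \<phi> * K) else {0 :: complex})" for \<phi>
  define \<Psi> where "\<Psi> k = (\<lambda>\<phi>. if \<phi> \<in> P then \<phi> (y k) else 0)" for k
  have "compact (T \<phi>)" for \<phi> by (simp add: T_def)
  then have "compactin (product_topology (\<lambda>_. euclidean) UNIV) (PiE UNIV T)"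
    by (subst compactin_PiE) (simp add: compactin_euclidean_iff)
  then have comp: "compact (PiE UNIV T)"
    by (simp add: euclidean_product_topology compactin_euclidean_iff)
  have le: "cmod (\<phi> (y k)) \<le> fnorm C A B \<phi> * K"
    if "\<phi> \<in> P" "y k \<in> Hom C A B" "nrm C (y k) \<le> K" for \<phi> k
  proof -
    note b = predual_blf[OF P that(1)]
    \<comment> \<open>A negative value would force every functional value to be 0 by
      \<open>blf_le_fnorm\<close>, and then the supremum would be 0.\<close>
    have "0 \<le> fnorm C A B \<phi>"
    proof (rule ccontr)
      assume neg: "\<not> 0 \<le> fnorm C A B \<phi>"
      have "hzero C A B \<in> {x \<in> Hom C A B. nrm C x \<le> 1}" by (simp add: nrm_zero)
      moreover have "cmod (\<phi> z) \<le> 0" if "z \<in> Hom C A B" for z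
      proof -
        have "fnorm C A B \<phi> * nrm C z \<le> 0" using neg nrm_nonneg[OF that] by (simp add: mult_nonpos_nonneg)
        then show ?thesis using blf_le_fnorm[OF b that] by linarith
      qed
      then have "fnorm C A B \<phi> = (SUP x\<in>{x \<in> Hom C A B. nrm C x \<le> 1}. 0)"
        unfolding fnorm_def by (intro SUP_cong) auto
      ultimately show False using neg by (metis cSUP_const empty_iff order_refl)
    qed
    then have "fnorm C A B \<phi> * nrm C (y k) \<le> fnorm C A B \<phi> * K"
      using that(3) by (rule mult_left_mono[rotated])
    then show ?thesis using blf_le_fnorm[OF b that(2)] by linarith
  qed
  have ev: "\<forall>\<^sub>F k in G. \<Psi> k \<in> PiE UNIV T"
    using y by eventually_elim (auto simp: \<Psi>_def T_def le)
  have "filtermap \<Psi> G \<noteq> bot" using G by (simp add: filtermap_bot_iff)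
  moreover have "eventually (\<lambda>\<psi>. \<psi> \<in> PiE UNIV T) (filtermap \<Psi> G)"
    using ev by (simp add: eventually_filtermap)
  ultimately obtain \<psi> where \<psi>: "\<psi> \<in> PiE UNIV T" "inf (nhds \<psi>) (filtermap \<Psi> G) \<noteq> bot"
    using comp unfolding compact_filter by blast
  \<comment> \<open>Refining \<open>G\<close> by the preimages of the neighbourhoods of the cluster
    point turns clustering into convergence.\<close>
  define G' where "G' = inf G (filtercomap \<Psi> (nhds \<psi>))"
  have le_G: "G' \<le> G" by (simp add: G'_def)
  have nb: "G' \<noteq> bot"
  proof
    assume "G' = bot"
    then have "eventually (\<lambda>k. False) G'" by simp
    then obtain Q R where QR: "eventually Q G" "eventually R (filtercomap \<Psi> (nhds \<psi>))"
      "\<And>k. Q k \<Longrightarrow> R k \<Longrightarrow> False"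
      unfolding G'_def eventually_inf by blast
    then obtain S where S: "eventually S (nhds \<psi>)" "\<And>k. S (\<Psi> k) \<Longrightarrow> R k"
      by (auto simp: eventually_filtercomap)
    have "eventually (\<lambda>f. \<not> S f) (filtermap \<Psi> G)"
      unfolding eventually_filtermap using QR(1) by eventually_elim (use QR(3) S(2) in blast)
    then have "eventually (\<lambda>f. False) (inf (nhds \<psi>) (filtermap \<Psi> G))"
      unfolding eventually_inf using S(1) by blast
    then show False using \<psi>(2) by (simp add: trivial_limit_def)
  qed
  have "filterlim \<Psi> (nhds \<psi>) G'"
    unfolding G'_def by (rule filterlim_mono[OF filterlim_filtercomap]) auto
  then have lim: "((\<lambda>k. \<Psi> k \<phi>) \<longlongrightarrow> \<psi> \<phi>) G'" for \<phi>
    by (rule continuous_on_tendsto_compose[OF continuous_on_product_coordinates]) auto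
  then have limP: "((\<lambda>k. \<phi> (y k)) \<longlongrightarrow> \<psi> \<phi>) G'" if "\<phi> \<in> P" for \<phi>
    using lim[of \<phi>] that by (simp add: \<Psi>_def)
  have add: "\<psi> (\<lambda>x. \<phi> x + \<phi>' x) = \<psi> \<phi> + \<psi> \<phi>'" if "\<phi> \<in> P" "\<phi>' \<in> P" for \<phi> \<phi>'
  proof (rule tendsto_unique[OF nb])
    from limP[OF predual_add[OF P that]] show "((\<lambda>k. \<phi> (y k) + \<phi>' (y k)) \<longlongrightarrow> \<psi> (\<lambda>x. \<phi> x + \<phi>' x)) G'" .
    show "((\<lambda>k. \<phi> (y k) + \<phi>' (y k)) \<longlongrightarrow> \<psi> \<phi> + \<psi> \<phi>') G'"
      by (intro tendsto_intros limP that)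
  qed
  have smul: "\<psi> (\<lambda>x. c * \<phi> x) = c * \<psi> \<phi>" if "\<phi> \<in> P" for \<phi> c
  proof (rule tendsto_unique[OF nb])
    from limP[OF predual_smul[OF P that]] show "((\<lambda>k. c * \<phi> (y k)) \<longlongrightarrow> \<psi> (\<lambda>x. c * \<phi> x)) G'" .
    show "((\<lambda>k. c * \<phi> (y k)) \<longlongrightarrow> c * \<psi> \<phi>) G'"
      by (intro tendsto_intros limP that)
  qed
  have bound: "cmod (\<psi> \<phi>) \<le> K * fnorm C A B \<phi>" if "\<phi> \<in> P" for \<phi>
  proof -
    have "\<psi> \<phi> \<in> T \<phi>" using \<psi>(1) by auto
    then show ?thesis using that by (simp add: T_def mult.commute)
  qed
  obtain x where x: "x \<in> Hom C A B" "\<And>\<phi>. \<phi> \<in> P \<Longrightarrow> \<psi> \<phi> = \<phi> x"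
    using predual_represents[OF P add smul bound] by blast
  have wl: "wlim A B P G' y x" using limP x by (auto simp: wlim_def)
  have "nrm C x \<le> K"
    by (rule wlim_nrm_le[OF P wl nb filter_leD[OF le_G y]])
  with that le_G nb wl show thesis by blast
qed

text \<open>Right multiplication by a projection is weakly closed: if \<open>y\<^sub>k p = 0\<close> and \<open>v = x p\<close> for the
  limit \<open>x\<close>, then \<open>y\<^sub>k + n v\<close> has orthogonal summands, whence
  \<open>(n + 1)\<^sup>2 \<parallel>v\<parallel>\<^sup>2 \<le> \<parallel>x + n v\<parallel>\<^sup>2 \<le> K\<^sup>2 + n\<^sup>2 \<parallel>v\<parallel>\<^sup>2\<close> for all \<open>n\<close>.\<close>

lemma wlim_cmp_projection_zero:
  assumes P: "is_predual C A B P" and l: "wlim A B P G y x" and G: "G \<noteq> bot"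
    and p: "p \<in> Hom C A A" "cmp C p p = p" "adj C p = p"
    and y: "\<forall>\<^sub>F k in G. y k \<in> Hom C A B \<and> nrm C (y k) \<le> K \<and> cmp C (y k) p = hzero C A B"
  shows "cmp C x p = hzero C A B"
proof -
  have x: "x \<in> Hom C A B" using l by (simp add: wlim_def)
  define v where "v = cmp C x p"
  have v: "v \<in> Hom C A B" unfolding v_def using x p(1) by (intro cmp_hom)
  have vp: "cmp C v p = v" unfolding v_def using cmp_assoc[OF p(1) p(1) x] p(2) by simp
  have adjv: "adj C v = cmp C p (adj C x)" unfolding v_def using adj_cmp[OF p(1) x] p(3) by simp
  \<comment> \<open>The factor is \<open>(n + 1)^2 - n^2\<close>, from comparing the lower and the
    upper bound for \<open>x + n v\<close>.\<close>
  have le: "(2 * real n + 1) * (nrm C v)\<^sup>2 \<le> K\<^sup>2" for n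
  proof -
    let ?w = "hsmul C (complex_of_real (real n)) v"
    have w: "?w \<in> Hom C A B" using v by (rule smul_hom)
    have nw: "nrm C ?w = real n * nrm C v" using nrm_smul[OF v, of "complex_of_real (real n)"] by simp
    have "nrm C (hadd C x ?w) \<le> sqrt (K\<^sup>2 + (real n * nrm C v)\<^sup>2)"
    proof (rule wlim_add_nrm_le[OF P l G w])
      show "\<forall>\<^sub>F k in G. y k \<in> Hom C A B \<and> nrm C (hadd C (y k) ?w) \<le> sqrt (K\<^sup>2 + (real n * nrm C v)\<^sup>2)"
        using y
      proof eventually_elim
        case (elim k)
        then have yk: "y k \<in> Hom C A B" and K: "nrm C (y k) \<le> K" and y0: "cmp C (y k) p = hzero C A B" by auto
        have "cmp C (y k) (adj C v) = cmp C (cmp C (y k) p) (adj C x)"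
          unfolding adjv by (rule cmp_assoc[OF adj_hom[OF x] p(1) yk, symmetric])
        also have "\<dots> = hzero C B B" unfolding y0 by (rule cmp_zero_left[OF adj_hom[OF x]])
        finally have "cmp C (y k) (adj C ?w) = hzero C B B"
          using cmp_smul_right[OF adj_hom[OF v] yk] by (simp add: adj_smul[OF v] smul_zero_right)
        then have "(nrm C (hadd C (y k) ?w))\<^sup>2 \<le> (nrm C (y k))\<^sup>2 + (real n * nrm C v)\<^sup>2"
          using pythagoras_le[OF yk w] nw by simp
        also have "\<dots> \<le> K\<^sup>2 + (real n * nrm C v)\<^sup>2"
          using K nrm_nonneg[OF yk] by (simp add: power_mono)
        finally show ?case using yk by (auto intro: real_le_rsqrt)
      qed
    qed
    then have 1: "(nrm C (hadd C x ?w))\<^sup>2 \<le> K\<^sup>2 + (real n * nrm C v)\<^sup>2"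
      using sqrt_ge_absD nrm_nonneg[OF add_hom[OF x w]] by (metis abs_of_nonneg)
    have "cmp C (hadd C x ?w) p = hadd C v ?w"
      using cmp_add_left[OF p(1) x w] cmp_smul_left[OF p(1) v] vp by (simp add: v_def)
    also have "\<dots> = hsmul C (complex_of_real (real n + 1)) v"
      using add_smul[OF v, of 1 "complex_of_real (real n)"] smul_one[OF v] by (simp add: add.commute)
    finally have "(real n + 1) * nrm C v \<le> nrm C (hadd C x ?w) * nrm C p"
      using nrm_cmp[OF p(1) add_hom[OF x w]] nrm_smul[OF v, of "complex_of_real (real n + 1)"]
      by (simp del: of_real_add)
    also have "\<dots> \<le> nrm C (hadd C x ?w)"
      using nrm_projection_le[OF p] nrm_nonneg[OF add_hom[OF x w]] by (simp add: mult_left_le)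
    finally have "((real n + 1) * nrm C v)\<^sup>2 \<le> (nrm C (hadd C x ?w))\<^sup>2"
      using nrm_nonneg[OF v] by (intro power_mono) auto
    with 1 have "((real n + 1) * nrm C v)\<^sup>2 \<le> K\<^sup>2 + (real n * nrm C v)\<^sup>2" by linarith
    then show ?thesis by (simp add: power2_eq_square algebra_simps)
  qed
  have "nrm C v = 0"
  proof (rule ccontr)
    assume "nrm C v \<noteq> 0"
    then have pos: "(nrm C v)\<^sup>2 > 0" by simp
    obtain n where "K\<^sup>2 / (nrm C v)\<^sup>2 < real n" using reals_Archimedean2 by blast
    then have "K\<^sup>2 < real n * (nrm C v)\<^sup>2" using pos by (simp add: divide_less_eq)
    also have "\<dots> \<le> (2 * real n + 1) * (nrm C v)\<^sup>2" using pos by (intro mult_right_mono) auto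
    finally show False using le[of n] by linarith
  qed
  then show ?thesis using nrm_eq_zero[OF v] v_def by simp
qed

text \<open>Both halves of positivity are bounds on translates by scalars, uniform in
  \<open>k\<close>: self-adjointness by \<open>n i\<close> for every real \<open>n\<close>, and the
  order condition by \<open>- K\<close>, a witness common to all \<open>y k\<close>.\<close>

lemma wlim_hpos:
  assumes P: "is_predual C B B P" and l: "wlim B B P G y x" and G: "G \<noteq> bot"
    and y: "\<forall>\<^sub>F k in G. hpos B (y k) \<and> nrm C (y k) \<le> K"
  shows "hpos B x"
proof -
  have x: "x \<in> Hom C B B" using l by (simp add: wlim_def)
  obtain k where "hpos B (y k)" "nrm C (y k) \<le> K"
    using eventually_happens'[OF G y] by blast
  then have K: "K \<ge> 0" using nrm_nonneg[OF hpos_hom] order_trans by blast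
  have "adj C x = x"
  proof (rule selfadjoint_of_nrm_add_imag[OF x, where K=K])
    fix n :: real
    let ?w = "hsmul C (complex_of_real n * \<i>) (idm C B)"
    have w: "?w \<in> Hom C B B" by (intro smul_hom id_hom)
    have "nrm C (hadd C x ?w) \<le> sqrt (K\<^sup>2 + n\<^sup>2)"
    proof (rule wlim_add_nrm_le[OF P l G w])
      show "\<forall>\<^sub>F k in G. y k \<in> Hom C B B \<and> nrm C (hadd C (y k) ?w) \<le> sqrt (K\<^sup>2 + n\<^sup>2)"
        using y
      proof eventually_elim
        case (elim k)
        then have h: "y k \<in> Hom C B B" "adj C (y k) = y k" by (auto intro: hpos_hom hpos_adj)
        have "(nrm C (hadd C (y k) ?w))\<^sup>2 \<le> (nrm C (y k))\<^sup>2 + n\<^sup>2"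
          by (rule nrm_selfadjoint_add_imag_le[OF h])
        also have "\<dots> \<le> K\<^sup>2 + n\<^sup>2" using elim nrm_nonneg[OF h(1)] by (simp add: power_mono)
        finally show ?case using h by (auto intro: real_le_rsqrt)
      qed
    qed
    then show "(nrm C (hadd C x ?w))\<^sup>2 \<le> K\<^sup>2 + n\<^sup>2"
      using sqrt_ge_absD nrm_nonneg[OF add_hom[OF x w]] by (metis abs_of_nonneg)
  qed
  moreover have "nrm C (hadd C x (hsmul C (complex_of_real (- K)) (idm C B))) \<le> K"
  proof (rule wlim_add_nrm_le[OF P l G smul_hom[OF id_hom]])
    show "\<forall>\<^sub>F k in G. y k \<in> Hom C B B \<and>
        nrm C (hadd C (y k) (hsmul C (complex_of_real (- K)) (idm C B))) \<le> K"
      using y by eventually_elim (blast intro: hpos_hom hpos_bound)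
  qed
  ultimately show ?thesis using x K by (intro hposI)
qed

end

section \<open>Ultraweak sums in a W*-category\<close>

locale wstar_category =
  fixes C :: "('o,'m) wcat"
  assumes wstar_cat: "wstar_cat C"

sublocale wstar_category \<subseteq> cstar_category
  using wstar_cat by unfold_locales (simp add: wstar_cat_def)

context wstar_category
begin

lemma predual_exists: "\<exists>P. is_predual C A B P"
  using wstar_cat by (simp add: wstar_cat_def)

lemma uw_has_sum_unique:
  assumes "uw_has_sum C B I g s" "uw_has_sum C B I g s'"
  shows "s = s'"
proof -
  obtain P where P: "is_predual C B B P" using predual_exists by blast
  show ?thesis
  proof (rule predual_separates[OF P])
    show "s \<in> Hom C B B" "s' \<in> Hom C B B" using assms by (simp_all add: uw_has_sum_def)
    fix \<phi> assume "\<phi> \<in> P"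
    then have "((\<lambda>i. \<phi> (g i)) has_sum \<phi> s) I" "((\<lambda>i. \<phi> (g i)) has_sum \<phi> s') I"
      using assms P by (auto simp: uw_has_sum_def)
    then show "\<phi> s = \<phi> s'" by (rule has_sum_unique)
  qed
qed

lemma uw_sum_eq: "uw_has_sum C B I g s \<Longrightarrow> uw_sum C B I g = s"
  unfolding uw_sum_def using uw_has_sum_unique by blast

lemma uw_has_sum_cong:
  assumes "\<And>i. i \<in> I \<Longrightarrow> g i = h i"
  shows "uw_has_sum C B I g s \<longleftrightarrow> uw_has_sum C B I h s"
proof -
  have "((\<lambda>i. \<phi> (g i)) has_sum \<phi> s) I \<longleftrightarrow> ((\<lambda>i. \<phi> (h i)) has_sum \<phi> s) I" for \<phi> :: "'m \<Rightarrow> complex"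
    using assms by (intro has_sum_cong) simp
  then show ?thesis by (simp add: uw_has_sum_def)
qed

lemma uw_sum_cong: "(\<And>i. i \<in> I \<Longrightarrow> g i = h i) \<Longrightarrow> uw_sum C B I g = uw_sum C B I h"
  unfolding uw_sum_def using uw_has_sum_cong[of I g h B] by presburger

lemma eventually_finite_subset: "\<forall>\<^sub>F F in finite_subsets_at_top I. finite F \<and> F \<subseteq> I"
  by (simp add: eventually_finite_subsets_at_top_weakI)

lemma uw_has_sum_iff_wlim:
  assumes g: "\<And>i. i \<in> I \<Longrightarrow> g i \<in> Hom C B B" and s: "s \<in> Hom C B B"
  shows "uw_has_sum C B I g s \<longleftrightarrow>
    (\<forall>P. is_predual C B B P \<longrightarrow> wlim B B P (finite_subsets_at_top I) (\<lambda>F. hsum B B F g) s)"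
proof -
  have "((\<lambda>i. \<phi> (g i)) has_sum \<phi> s) I \<longleftrightarrow> ((\<lambda>F. \<phi> (hsum B B F g)) \<longlongrightarrow> \<phi> s) (finite_subsets_at_top I)"
    if P: "is_predual C B B P" "\<phi> \<in> P" for P \<phi>
    unfolding has_sum_def
  proof (rule tendsto_cong)
    show "\<forall>\<^sub>F F in finite_subsets_at_top I. (\<Sum>i\<in>F. \<phi> (g i)) = \<phi> (hsum B B F g)"
      using eventually_finite_subset
      by eventually_elim (use g in \<open>auto simp: blf_hsum[OF predual_blf[OF P]] subset_iff\<close>)
  qed
  then show ?thesis using s by (auto simp: uw_has_sum_def wlim_def)
qed

lemma wlim_of_uw_has_sum:
  assumes "uw_has_sum C B I g s" "\<And>i. i \<in> I \<Longrightarrow> g i \<in> Hom C B B" "is_predual C B B P"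
  shows "wlim B B P (finite_subsets_at_top I) (\<lambda>F. hsum B B F g) s"
proof -
  have "s \<in> Hom C B B" using assms(1) by (simp add: uw_has_sum_def)
  then show ?thesis using uw_has_sum_iff_wlim[of I g B s] assms by simp
qed

lemma eventually_superset:
  assumes "finite F" "F \<subseteq> I"
  shows "\<forall>\<^sub>F F' in finite_subsets_at_top I. finite F' \<and> F \<subseteq> F' \<and> F' \<subseteq> I"
  unfolding eventually_finite_subsets_at_top using assms by blast

definition sums_sup :: "'o \<Rightarrow> 'i set \<Rightarrow> ('i \<Rightarrow> 'm) \<Rightarrow> 'm \<Rightarrow> bool" where
  "sums_sup B I h x \<longleftrightarrow> x \<in> Hom C B B \<and>
    (\<forall>F. finite F \<longrightarrow> F \<subseteq> I \<longrightarrow> hpos B (hsub x (hsum B B F h))) \<and>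
    (\<forall>u\<in>Hom C B B. (\<forall>F. finite F \<longrightarrow> F \<subseteq> I \<longrightarrow> hpos B (hsub u (hsum B B F h))) \<longrightarrow> hpos B (hsub u x))"

lemma sums_sup_unique:
  assumes "sums_sup B I h x" "sums_sup B I h x'"
  shows "x = x'"
  using assms hpos_antisym[of x B x'] unfolding sums_sup_def by blast

text \<open>Weak cluster points of the partial sums are suprema in the order; this is why they
  coincide, for all preduals at once.\<close>

lemma hpos_partial_sums_cluster:
  assumes P: "is_predual C B B P" and G: "G \<le> finite_subsets_at_top I" "G \<noteq> bot"
    and h: "\<And>i. i \<in> I \<Longrightarrow> hpos B (h i)"
    and K: "\<And>F. finite F \<Longrightarrow> F \<subseteq> I \<Longrightarrow> nrm C (hsum B B F h) \<le> K"
  obtains G' x where "G' \<le> G" "G' \<noteq> bot" "wlim B B P G' (\<lambda>F. hsum B B F h) x" "nrm C x \<le> K"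
    "sums_sup B I h x"
proof -
  let ?s = "\<lambda>F. hsum B B F h"
  have s: "?s F \<in> Hom C B B" if "finite F" "F \<subseteq> I" for F
    using that h by (intro hsum_hom) (auto intro: hpos_hom)
  have ev: "\<forall>\<^sub>F F in G. finite F \<and> F \<subseteq> I" using eventually_finite_subset G(1) by (rule filter_leD[rotated])
  have bd: "\<forall>\<^sub>F F in G. ?s F \<in> Hom C B B \<and> nrm C (?s F) \<le> K"
    using ev by eventually_elim (auto intro: s K)
  obtain G' x where G': "G' \<le> G" "G' \<noteq> bot" and l: "wlim B B P G' ?s x" and xK: "nrm C x \<le> K"
    by (rule wlim_cluster[OF P G(2) bd])
  have x: "x \<in> Hom C B B" using l by (simp add: wlim_def)
  have ev': "\<forall>\<^sub>F F in G'. finite F \<and> F \<subseteq> I" using G'(1) ev by (rule filter_leD)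
  have sev: "\<forall>\<^sub>F F in G'. ?s F \<in> Hom C B B" using ev' by eventually_elim (auto intro: s)
  have "sums_sup B I h x"
    unfolding sums_sup_def
  proof (intro conjI allI impI ballI)
    show "x \<in> Hom C B B" by (rule x)
  next
    \<comment> \<open>Eventually the index set contains \<open>F\<close>, and from there on the
      difference of the partial sums is positive and bounded by \<open>K + K\<close>.\<close>
    fix F assume F: "finite F" "F \<subseteq> I"
    have nF: "hsmul C (- 1) (?s F) \<in> Hom C B B" using s[OF F] by (rule smul_hom)
    show "hpos B (hsub x (?s F))"
    proof (rule wlim_hpos[OF P wlim_add[OF P l nF sev] G'(2)])
      have "\<forall>\<^sub>F F' in G'. finite F' \<and> F \<subseteq> F' \<and> F' \<subseteq> I"
        by (rule filter_leD[OF G'(1) filter_leD[OF G(1) eventually_superset[OF F]]])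
      then show "\<forall>\<^sub>F F' in G'. hpos B (hsub (?s F') (?s F)) \<and> nrm C (hsub (?s F') (?s F)) \<le> K + K"
      proof eventually_elim
        case (elim F')
        have "nrm C (hsub (?s F') (?s F)) \<le> K + K"
          using nrm_sub[OF s s, of F' F] K[of F'] K[of F] elim F by simp
        then show ?case using elim h by (auto intro: hpos_hsum_sub)
      qed
    qed
  next
    fix u assume u: "u \<in> Hom C B B" and "\<forall>F. finite F \<longrightarrow> F \<subseteq> I \<longrightarrow> hpos B (hsub u (?s F))"
    then have up: "\<And>F. finite F \<Longrightarrow> F \<subseteq> I \<Longrightarrow> hpos B (hsub u (?s F))" by blast
    have lm: "wlim B B P G' (\<lambda>F. hsmul C (- 1) (?s F)) (hsmul C (- 1) x)"
      by (rule wlim_smul[OF P l sev])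
    have sm: "\<forall>\<^sub>F F in G'. hsmul C (- 1) (?s F) \<in> Hom C B B"
      using sev by eventually_elim (rule smul_hom)
    have "hpos B (hadd C (hsmul C (- 1) x) u)"
    proof (rule wlim_hpos[OF P wlim_add[OF P lm u sm] G'(2)])
      show "\<forall>\<^sub>F F in G'. hpos B (hadd C (hsmul C (- 1) (?s F)) u) \<and>
          nrm C (hadd C (hsmul C (- 1) (?s F)) u) \<le> nrm C u + K"
        using ev'
      proof eventually_elim
        case (elim F)
        then have F: "finite F" "F \<subseteq> I" by auto
        have "hadd C (hsmul C (- 1) (?s F)) u = hsub u (?s F)"
          by (rule add_commute[OF smul_hom[OF s[OF F]] u])
        then show ?case using up[OF F] nrm_sub[OF u s[OF F]] K[OF F] by simp
      qed
    qed
    then show "hpos B (hsub u x)" using add_commute[OF smul_hom[OF x] u] by simp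
  qed
  with that[OF G' l xK] show thesis by blast
qed

text \<open>Along every nontrivial filter finer than \<open>finite_subsets_at_top I\<close> the
  partial sums have a cluster point, and it is always the same supremum \<open>s\<close>. If
  convergence failed at some functional, restricting to the bad index sets would produce a different
  cluster point. The bound on \<open>nrm C s\<close> serves later to compare norms of sums.\<close>

lemma uw_has_sum_of_bdd:
  assumes h: "\<And>i. i \<in> I \<Longrightarrow> hpos B (h i)"
    and K: "\<And>F. finite F \<Longrightarrow> F \<subseteq> I \<Longrightarrow> nrm C (hsum B B F h) \<le> K"
  shows "\<exists>s. uw_has_sum C B I h s \<and> nrm C s \<le> K \<and>
    (\<forall>F. finite F \<longrightarrow> F \<subseteq> I \<longrightarrow> hpos B (hsub s (hsum B B F h)))"
proof -
  let ?s = "\<lambda>F. hsum B B F h"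
  obtain P where P: "is_predual C B B P" using predual_exists by blast
  obtain G s where "G \<le> finite_subsets_at_top I" "G \<noteq> bot" and l: "wlim B B P G ?s s"
    and sK: "nrm C s \<le> K" and sup: "sums_sup B I h s"
    by (rule hpos_partial_sums_cluster[OF P order_refl finite_subsets_at_top_neq_bot h K])
  have s: "s \<in> Hom C B B" using l by (simp add: wlim_def)
  have "wlim B B P' (finite_subsets_at_top I) ?s s" if P': "is_predual C B B P'" for P'
    unfolding wlim_def
  proof (intro conjI s ballI)
    fix \<phi> assume \<phi>: "\<phi> \<in> P'"
    show "((\<lambda>F. \<phi> (?s F)) \<longlongrightarrow> \<phi> s) (finite_subsets_at_top I)"
    proof (rule tendstoI, rule ccontr)
      fix e :: real assume e: "e > 0"
      assume "\<not> (\<forall>\<^sub>F F in finite_subsets_at_top I. dist (\<phi> (?s F)) (\<phi> s) < e)"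
      then have nb: "inf (finite_subsets_at_top I) (principal {F. \<not> dist (\<phi> (?s F)) (\<phi> s) < e}) \<noteq> bot"
        by (simp add: trivial_limit_def eventually_inf_principal)
      obtain G' x where G': "G' \<le> inf (finite_subsets_at_top I) (principal {F. \<not> dist (\<phi> (?s F)) (\<phi> s) < e})"
        "G' \<noteq> bot" and l': "wlim B B P' G' ?s x" and "nrm C x \<le> K"
        and sup': "sums_sup B I h x"
        by (rule hpos_partial_sums_cluster[OF P' inf_le1 nb h K])
      have "x = s" by (rule sums_sup_unique[OF sup' sup])
      then have "((\<lambda>F. \<phi> (?s F)) \<longlongrightarrow> \<phi> s) G'" using l' \<phi> by (simp add: wlim_def)
      then have "\<forall>\<^sub>F F in G'. dist (\<phi> (?s F)) (\<phi> s) < e" using e by (rule tendstoD)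
      moreover have "\<forall>\<^sub>F F in G'. \<not> dist (\<phi> (?s F)) (\<phi> s) < e"
        using G'(1) by (simp add: le_principal)
      ultimately have "\<forall>\<^sub>F F in G'. False" by eventually_elim simp
      then show False using G'(2) by (simp add: trivial_limit_def)
    qed
  qed
  then have "uw_has_sum C B I h s"
    using uw_has_sum_iff_wlim[of I h B s] h s by (auto intro: hpos_hom)
  moreover have "hpos B (hsub s (?s F))" if "finite F" "F \<subseteq> I" for F
    using sup that by (simp add: sums_sup_def)
  ultimately show ?thesis using sK by blast
qed

lemma bdd_sum_iff:
  "bdd_sum C B I g \<longleftrightarrow> (\<exists>K. \<forall>F. finite F \<longrightarrow> F \<subseteq> I \<longrightarrow> nrm C (hsum B B F g) \<le> K)"
  by (auto simp: bdd_sum_def fsum_eq_hsum)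

section \<open>Direct sums\<close>

definition universal_sum :: "'i set \<Rightarrow> ('i \<Rightarrow> 'o) \<Rightarrow> 'o \<Rightarrow> ('i \<Rightarrow> 'm) \<Rightarrow> bool" where
  "universal_sum I Ai A \<kappa> \<longleftrightarrow> (\<forall>j\<in>I. \<kappa> j \<in> Hom C (Ai j) A) \<and>
    bdd_sum C A I (\<lambda>j. cmp C (\<kappa> j) (adj C (\<kappa> j))) \<and>
    (\<forall>B. \<forall>f\<in>dsum C I Ai B.
       (\<exists>g\<in>Hom C A B. (\<forall>j\<in>I. cmp C g (\<kappa> j) = f j) \<and>
          (nrm C g)\<^sup>2 = nrm C (uw_sum C B I (\<lambda>j. cmp C (f j) (adj C (f j))))) \<and>
       (\<forall>g\<in>Hom C A B. \<forall>g'\<in>Hom C A B.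
          (\<forall>j\<in>I. cmp C g (\<kappa> j) = f j) \<longrightarrow> (\<forall>j\<in>I. cmp C g' (\<kappa> j) = f j) \<longrightarrow> g = g'))"

definition orthonormal_sum :: "'i set \<Rightarrow> ('i \<Rightarrow> 'o) \<Rightarrow> 'o \<Rightarrow> ('i \<Rightarrow> 'm) \<Rightarrow> bool" where
  "orthonormal_sum I Ai A \<kappa> \<longleftrightarrow> (\<forall>j\<in>I. \<kappa> j \<in> Hom C (Ai j) A) \<and>
    (\<forall>i\<in>I. \<forall>j\<in>I. cmp C (adj C (\<kappa> i)) (\<kappa> j) =
      (if i = j then idm C (Ai i) else hzero C (Ai j) (Ai i))) \<and>
    uw_has_sum C A I (\<lambda>j. cmp C (\<kappa> j) (adj C (\<kappa> j))) (idm C A)"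

lemma universal_sumD:
  assumes "universal_sum I Ai A \<kappa>"
  shows "j \<in> I \<Longrightarrow> \<kappa> j \<in> Hom C (Ai j) A"
    and "bdd_sum C A I (\<lambda>j. cmp C (\<kappa> j) (adj C (\<kappa> j)))"
    and "f \<in> dsum C I Ai B \<Longrightarrow> \<exists>g\<in>Hom C A B. (\<forall>j\<in>I. cmp C g (\<kappa> j) = f j) \<and>
          (nrm C g)\<^sup>2 = nrm C (uw_sum C B I (\<lambda>j. cmp C (f j) (adj C (f j))))"
    and "f \<in> dsum C I Ai B \<Longrightarrow> g \<in> Hom C A B \<Longrightarrow> g' \<in> Hom C A B \<Longrightarrow>
      (\<And>j. j \<in> I \<Longrightarrow> cmp C g (\<kappa> j) = f j) \<Longrightarrow> (\<And>j. j \<in> I \<Longrightarrow> cmp C g' (\<kappa> j) = f j) \<Longrightarrow> g = g'"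
  using assms unfolding universal_sum_def by blast+

lemma dsumD:
  assumes "f \<in> dsum C I Ai B"
  shows "i \<in> I \<Longrightarrow> f i \<in> Hom C (Ai i) B" and "i \<notin> I \<Longrightarrow> f i = undefined"
    and "bdd_sum C B I (\<lambda>i. cmp C (f i) (adj C (f i)))"
  using assms by (auto simp: dsum_def PiE_iff extensional_def)

lemma cmp_self_adj_hom: "f \<in> Hom C A B \<Longrightarrow> cmp C f (adj C f) \<in> Hom C B B"
  by (intro cmp_hom[of _ B A] adj_hom)

text \<open>Composing with \<open>x\<close> turns each partial sum \<open>S\<close> for
  \<open>\<kappa>\<close> into \<open>x S\<close> followed by the adjoint of \<open>x\<close> on the
  right, which costs a factor \<open>nrm C x\<close> twice.\<close>

lemma restrict_cmp_in_dsum: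
  assumes \<kappa>: "\<And>j. j \<in> I \<Longrightarrow> \<kappa> j \<in> Hom C (Ai j) A"
    and b: "bdd_sum C A I (\<lambda>j. cmp C (\<kappa> j) (adj C (\<kappa> j)))" and x: "x \<in> Hom C A B"
  shows "(\<lambda>i\<in>I. cmp C x (\<kappa> i)) \<in> dsum C I Ai B"
proof -
  let ?f = "\<lambda>i\<in>I. cmp C x (\<kappa> i)"
  let ?p = "\<lambda>j. cmp C (\<kappa> j) (adj C (\<kappa> j))"
  have p: "?p i \<in> Hom C A A" if "i \<in> I" for i using \<kappa>[OF that] by (rule cmp_self_adj_hom)
  have eq: "cmp C (?f i) (adj C (?f i)) = cmp C (cmp C x (?p i)) (adj C x)" if "i \<in> I" for i
  proof -
    note k = \<kappa>[OF that]
    have "cmp C (?f i) (adj C (?f i)) = cmp C (cmp C x (\<kappa> i)) (cmp C (adj C (\<kappa> i)) (adj C x))"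
      using that by (simp add: adj_cmp[OF k x])
    also have "\<dots> = cmp C (cmp C (cmp C x (\<kappa> i)) (adj C (\<kappa> i))) (adj C x)"
      by (rule cmp_assoc[OF adj_hom[OF x] adj_hom[OF k] cmp_hom[OF k x], symmetric])
    also have "cmp C (cmp C x (\<kappa> i)) (adj C (\<kappa> i)) = cmp C x (?p i)"
      by (rule cmp_assoc[OF adj_hom[OF k] k x])
    finally show ?thesis .
  qed
  obtain K where K: "\<And>F. finite F \<Longrightarrow> F \<subseteq> I \<Longrightarrow> nrm C (hsum A A F ?p) \<le> K"
    using b by (auto simp: bdd_sum_iff)
  have "nrm C (hsum B B F (\<lambda>i. cmp C (?f i) (adj C (?f i)))) \<le> nrm C x * K * nrm C x"
    if F: "finite F" "F \<subseteq> I" for F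
  proof -
    have pF: "?p i \<in> Hom C A A" if "i \<in> F" for i using p F that by auto
    have S: "hsum A A F ?p \<in> Hom C A A" by (rule hsum_hom[OF F(1) pF])
    have "hsum B B F (\<lambda>i. cmp C (?f i) (adj C (?f i))) = hsum B B F (\<lambda>i. cmp C (cmp C x (?p i)) (adj C x))"
    proof (rule hsum_cong[OF F(1)])
      fix j assume j: "j \<in> F"
      then show "cmp C (?f j) (adj C (?f j)) = cmp C (cmp C x (?p j)) (adj C x)" using F by (intro eq) auto
      then show "cmp C (?f j) (adj C (?f j)) \<in> Hom C B B"
        using cmp_hom[OF adj_hom[OF x] cmp_hom[OF pF[OF j] x]] by simp
    qed
    also have "\<dots> = cmp C (hsum A B F (\<lambda>i. cmp C x (?p i))) (adj C x)"
      by (rule cmp_hsum_left[OF F(1) _ adj_hom[OF x], symmetric]) (rule cmp_hom[OF pF x])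
    also have "hsum A B F (\<lambda>i. cmp C x (?p i)) = cmp C x (hsum A A F ?p)"
      by (rule cmp_hsum_right[OF F(1) pF x, symmetric])
    finally have "nrm C (hsum B B F (\<lambda>i. cmp C (?f i) (adj C (?f i)))) \<le>
        nrm C (cmp C x (hsum A A F ?p)) * nrm C x"
      using nrm_cmp[OF adj_hom[OF x] cmp_hom[OF S x]] nrm_adj[OF x] by simp
    also have "\<dots> \<le> (nrm C x * K) * nrm C x"
    proof (rule mult_right_mono[OF _ nrm_nonneg[OF x]])
      have "nrm C (cmp C x (hsum A A F ?p)) \<le> nrm C x * nrm C (hsum A A F ?p)" by (rule nrm_cmp[OF S x])
      also have "\<dots> \<le> nrm C x * K" by (rule mult_left_mono[OF K[OF F] nrm_nonneg[OF x]])
      finally show "nrm C (cmp C x (hsum A A F ?p)) \<le> nrm C x * K" .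
    qed
    finally show ?thesis .
  qed
  then have "bdd_sum C B I (\<lambda>i. cmp C (?f i) (adj C (?f i)))"
    unfolding bdd_sum_iff by blast
  then show ?thesis using \<kappa> x by (auto simp: dsum_def intro: cmp_hom)
qed

section \<open>Natural isomorphisms and universal families\<close>

lemma universal_sum_of_is_direct_sum:
  assumes "is_direct_sum C I Ai A"
  shows "\<exists>\<kappa>. universal_sum I Ai A \<kappa>"
proof -
  obtain \<Phi> where bij: "\<And>B. bij_betw (\<Phi> B) (Hom C A B) (dsum C I Ai B)"
    and isom: "\<And>B x. x \<in> Hom C A B \<Longrightarrow> dsum_norm C I B (\<Phi> B x) = nrm C x"
    and nat: "\<And>B B' g x. g \<in> Hom C B B' \<Longrightarrow> x \<in> Hom C A B \<Longrightarrow>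
      \<Phi> B' (cmp C g x) = (\<lambda>i\<in>I. cmp C g (\<Phi> B x i))"
    using assms unfolding is_direct_sum_def by blast
  define \<kappa> where "\<kappa> = \<Phi> A (idm C A)"
  have \<kappa>d: "\<kappa> \<in> dsum C I Ai A"
    unfolding \<kappa>_def by (rule bij_betwE[OF bij, rule_format]) simp
  \<comment> \<open>Naturality along \<open>x\<close>, applied to the identity, shows that
    composition with \<open>\<kappa>\<close> determines all of \<open>\<Phi>\<close>.\<close>
  have \<Phi>: "\<Phi> B x = (\<lambda>i\<in>I. cmp C x (\<kappa> i))" if "x \<in> Hom C A B" for B x
    using nat[OF that id_hom] cmp_id(1)[OF that] by (simp add: \<kappa>_def)
  have "universal_sum I Ai A \<kappa>"
    unfolding universal_sum_def
  proof (intro conjI allI ballI impI)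
    show "\<kappa> j \<in> Hom C (Ai j) A" if "j \<in> I" for j using dsumD(1)[OF \<kappa>d that] .
    show "bdd_sum C A I (\<lambda>j. cmp C (\<kappa> j) (adj C (\<kappa> j)))" by (rule dsumD(3)[OF \<kappa>d])
    fix B f assume f: "f \<in> dsum C I Ai B"
    have "f \<in> \<Phi> B ` Hom C A B" using f bij_betw_imp_surj_on[OF bij] by simp
    then obtain g where g: "g \<in> Hom C A B" "\<Phi> B g = f" by blast
    have n: "sqrt (nrm C (uw_sum C B I (\<lambda>j. cmp C (f j) (adj C (f j))))) = nrm C g"
      using isom[OF g(1)] by (simp add: g(2) dsum_norm_def)
    \<comment> \<open>\<open>uw_sum\<close> is a definite description, so the sign of its norm is
      not known at this point. It is read off from the square root, and squaring becomes
      legitimate.\<close>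
    then have "0 \<le> nrm C (uw_sum C B I (\<lambda>j. cmp C (f j) (adj C (f j))))"
      using nrm_nonneg[OF g(1)] by (metis real_sqrt_ge_0_iff)
    then have "(nrm C g)\<^sup>2 = nrm C (uw_sum C B I (\<lambda>j. cmp C (f j) (adj C (f j))))"
      by (simp flip: n)
    moreover have "cmp C g (\<kappa> j) = f j" if "j \<in> I" for j
      using \<Phi>[OF g(1)] that by (simp add: g(2))
    ultimately show "\<exists>g\<in>Hom C A B. (\<forall>j\<in>I. cmp C g (\<kappa> j) = f j) \<and>
        (nrm C g)\<^sup>2 = nrm C (uw_sum C B I (\<lambda>j. cmp C (f j) (adj C (f j))))"
      using g(1) by blast
    fix g g' assume g: "g \<in> Hom C A B" "g' \<in> Hom C A B"
      and eq: "\<forall>j\<in>I. cmp C g (\<kappa> j) = f j" "\<forall>j\<in>I. cmp C g' (\<kappa> j) = f j"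
    have "\<Phi> B g = \<Phi> B g'"
      unfolding \<Phi>[OF g(1)] \<Phi>[OF g(2)] using eq by (intro restrict_ext) simp
    then show "g = g'" using bij[of B] g by (auto simp: bij_betw_def inj_on_def)
  qed
  then show ?thesis by blast
qed

lemma is_direct_sum_of_universal_sum:
  assumes "universal_sum I Ai A \<kappa>"
  shows "is_direct_sum C I Ai A"
proof -
  note u = universal_sumD[OF assms]
  define \<Phi> where "\<Phi> B x = (\<lambda>i\<in>I. cmp C x (\<kappa> i))" for B :: 'o and x
  have mem: "\<Phi> B x \<in> dsum C I Ai B" if "x \<in> Hom C A B" for B x
    unfolding \<Phi>_def by (rule restrict_cmp_in_dsum[OF u(1,2) that])
  show ?thesis
    unfolding is_direct_sum_def
  proof (rule exI[of _ \<Phi>], intro conjI allI ballI)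
    fix B
    show "bij_betw (\<Phi> B) (Hom C A B) (dsum C I Ai B)"
    proof (rule bij_betw_imageI)
      show "inj_on (\<Phi> B) (Hom C A B)"
      proof (rule inj_onI)
        fix x x' assume x: "x \<in> Hom C A B" "x' \<in> Hom C A B" and eq: "\<Phi> B x = \<Phi> B x'"
        show "x = x'"
        proof (rule u(4)[OF mem[OF x(1)] x])
          show "cmp C x (\<kappa> j) = \<Phi> B x j" if "j \<in> I" for j using that by (simp add: \<Phi>_def)
          show "cmp C x' (\<kappa> j) = \<Phi> B x j" if "j \<in> I" for j using that by (simp add: eq) (simp add: \<Phi>_def)
        qed
      qed
      have "f \<in> \<Phi> B ` Hom C A B" if f: "f \<in> dsum C I Ai B" for f
      proof -
        obtain g where g: "g \<in> Hom C A B" "\<forall>j\<in>I. cmp C g (\<kappa> j) = f j" using u(3)[OF f] by blast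
        \<comment> \<open>Outside \<open>I\<close> both functions are
          \<open>undefined\<close>.\<close>
        have "\<Phi> B g = f"
          using g(2) dsumD(2)[OF f] by (auto simp: \<Phi>_def restrict_def)
        then show ?thesis using g(1) by blast
      qed
      then show "\<Phi> B ` Hom C A B = dsum C I Ai B" using mem by blast
    qed
  next
    fix B x y assume "x \<in> Hom C A B" "y \<in> Hom C A B"
    then show "\<Phi> B (hadd C x y) = (\<lambda>i\<in>I. hadd C (\<Phi> B x i) (\<Phi> B y i))"
      unfolding \<Phi>_def by (intro restrict_ext) (simp add: cmp_add_left[OF u(1)])
  next
    fix B c x assume "x \<in> Hom C A B"
    then show "\<Phi> B (hsmul C c x) = (\<lambda>i\<in>I. hsmul C c (\<Phi> B x i))"
      unfolding \<Phi>_def by (intro restrict_ext) (simp add: cmp_smul_left[OF u(1)])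
  next
    fix B x assume x: "x \<in> Hom C A B"
    obtain g where g: "g \<in> Hom C A B" "\<forall>j\<in>I. cmp C g (\<kappa> j) = \<Phi> B x j"
      and n: "(nrm C g)\<^sup>2 = nrm C (uw_sum C B I (\<lambda>j. cmp C (\<Phi> B x j) (adj C (\<Phi> B x j))))"
      using u(3)[OF mem[OF x]] by blast
    \<comment> \<open>Uniqueness identifies \<open>x\<close> with the morphism whose norm is
      known.\<close>
    have "g = x"
      by (rule u(4)[OF mem[OF x] g(1) x]) (use g(2) in \<open>simp_all add: \<Phi>_def\<close>)
    then show "dsum_norm C I B (\<Phi> B x) = nrm C x"
      using n nrm_nonneg[OF x] by (simp add: dsum_norm_def flip: n)
  next
    fix B B' g x assume "g \<in> Hom C B B'" "x \<in> Hom C A B"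
    then show "\<Phi> B' (cmp C g x) = (\<lambda>i\<in>I. cmp C g (\<Phi> B x i))"
      unfolding \<Phi>_def by (intro restrict_ext) (simp add: cmp_assoc[OF u(1)])
  qed
qed

lemma uw_has_sum_single:
  assumes "i \<in> I" "g i \<in> Hom C B B" "\<And>j. j \<in> I \<Longrightarrow> j \<noteq> i \<Longrightarrow> g j = hzero C B B"
  shows "uw_has_sum C B I g (g i)"
  unfolding uw_has_sum_def
proof (intro conjI allI impI ballI assms(2))
  fix P \<phi> assume P: "is_predual C B B P" "\<phi> \<in> P"
  have "((\<lambda>j. \<phi> (g j)) has_sum \<phi> (g i)) {i}"
    using has_sum_finite[of "{i}" "\<lambda>j. \<phi> (g j)"] by simp
  then show "((\<lambda>j. \<phi> (g j)) has_sum \<phi> (g i)) I"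
    by (rule has_sum_cong_neutral[THEN iffD1, rotated -1])
      (use assms blf_zero[OF predual_blf[OF P]] in auto)
qed

text \<open>A contractive left inverse of a contraction is its adjoint. The norm formula of the
  universal property provides both contractions.\<close>

lemma universal_sum_adj:
  assumes univ: "universal_sum I Ai A \<kappa>" and i: "i \<in> I"
  shows "j \<in> I \<Longrightarrow> cmp C (adj C (\<kappa> i)) (\<kappa> j) = (if i = j then idm C (Ai i) else hzero C (Ai j) (Ai i))"
proof -
  note u = universal_sumD[OF univ]
  let ?p = "\<lambda>j. cmp C (\<kappa> j) (adj C (\<kappa> j))"
  have p: "hpos A (?p j)" if "j \<in> I" for j using u(1)[OF that] by (rule hpos_mult_star)
  obtain K where K: "\<And>F. finite F \<Longrightarrow> F \<subseteq> I \<Longrightarrow> nrm C (hsum A A F ?p) \<le> K"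
    using u(2) unfolding bdd_sum_iff by blast
  obtain s where s: "uw_has_sum C A I ?p s" and "nrm C s \<le> K"
    and ub: "\<And>F. finite F \<Longrightarrow> F \<subseteq> I \<Longrightarrow> hpos A (hsub s (hsum A A F ?p))"
    using uw_has_sum_of_bdd[OF p K] by blast
  have sh: "s \<in> Hom C A A" using s by (simp add: uw_has_sum_def)
  \<comment> \<open>This is \<open>\<kappa>\<close> made extensional, in the form of
    \<open>restrict_cmp_in_dsum\<close>. Its extension is the identity, so the norm formula gives
    \<open>nrm C s = (nrm C (idm C A))^2\<close>.\<close>
  let ?\<kappa> = "\<lambda>i\<in>I. cmp C (idm C A) (\<kappa> i)"
  have \<kappa>d: "?\<kappa> \<in> dsum C I Ai A" by (rule restrict_cmp_in_dsum[OF u(1,2) id_hom])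
  obtain g where g: "g \<in> Hom C A A" "\<forall>j\<in>I. cmp C g (\<kappa> j) = ?\<kappa> j"
    and n: "(nrm C g)\<^sup>2 = nrm C (uw_sum C A I (\<lambda>j. cmp C (?\<kappa> j) (adj C (?\<kappa> j))))"
    using u(3)[OF \<kappa>d] by blast
  have "g = idm C A"
    by (rule u(4)[OF \<kappa>d g(1) id_hom]) (use g(2) in simp_all)
  moreover have "uw_sum C A I (\<lambda>j. cmp C (?\<kappa> j) (adj C (?\<kappa> j))) = s"
    using uw_sum_cong[of I "\<lambda>j. cmp C (?\<kappa> j) (adj C (?\<kappa> j))" ?p A] uw_sum_eq[OF s]
    by (simp add: cmp_id(2)[OF u(1)])
  ultimately have "nrm C s = (nrm C (idm C A))\<^sup>2" using n by simp
  then have s1: "nrm C s \<le> 1" using nrm_id_le[of A] nrm_nonneg[OF id_hom, of A] by (simp add: power_le_one)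
  have ki: "\<kappa> i \<in> Hom C (Ai i) A" by (rule u(1)[OF i])
  note aki = adj_hom[OF ki]
  have "hsum A A {i} ?p = ?p i"
    using hsum_insert[of "{}" i ?p A A] hpos_hom[OF p[OF i]] by (simp add: add_zero)
  then have "hpos A (hsub s (?p i))" using ub[of "{i}"] i by simp
  then have "nrm C (?p i) \<le> nrm C s" by (rule hpos_norm_mono[OF p[OF i] sh])
  then have "(nrm C (\<kappa> i))\<^sup>2 \<le> 1" using s1 nrm_mult_star[OF ki] by simp
  then have k1: "nrm C (cmp C (adj C (\<kappa> i)) (\<kappa> i)) \<le> 1" using nrm_star_mult[OF ki] by simp
  \<comment> \<open>The \<open>i\<close>-th row of the identity matrix. Its sum of squares is the
    identity of \<open>Ai i\<close>.\<close>
  define f where "f = (\<lambda>j\<in>I. if j = i then idm C (Ai i) else hzero C (Ai j) (Ai i))"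
  let ?q = "\<lambda>j. cmp C (f j) (adj C (f j))"
  have fh: "f j \<in> Hom C (Ai j) (Ai i)" if "j \<in> I" for j using that by (auto simp: f_def)
  have q: "?q j = (if j = i then idm C (Ai i) else hzero C (Ai i) (Ai i))" if "j \<in> I" for j
    using that by (simp add: f_def adj_id adj_zero cmp_id(1)[OF id_hom] cmp_zero_zero)
  have fd: "f \<in> dsum C I Ai (Ai i)"
  proof -
    have "nrm C (hsum (Ai i) (Ai i) F ?q) \<le> 1" if F: "finite F" "F \<subseteq> I" for F
    proof -
      have "hsum (Ai i) (Ai i) F ?q = (if i \<in> F then ?q i else hzero C (Ai i) (Ai i))"
        by (rule hsum_single) (use F q in \<open>auto simp: subset_iff\<close>)
      then show ?thesis using q[OF i] nrm_id_le[of "Ai i"] by (simp add: nrm_zero)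
    qed
    then show ?thesis using fh by (auto simp: dsum_def bdd_sum_iff f_def)
  qed
  have "uw_has_sum C (Ai i) I ?q (?q i)"
    by (rule uw_has_sum_single[OF i]) (use q i in auto)
  then have "uw_sum C (Ai i) I ?q = idm C (Ai i)" using uw_sum_eq q[OF i] by simp
  then obtain g where g: "g \<in> Hom C A (Ai i)" "\<forall>j\<in>I. cmp C g (\<kappa> j) = f j"
    and n: "(nrm C g)\<^sup>2 = nrm C (idm C (Ai i))"
    using u(3)[OF fd] by auto
  note ag = adj_hom[OF g(1)]
  have gk: "cmp C g (\<kappa> i) = idm C (Ai i)" using g(2) i by (simp add: f_def)
  have kg: "cmp C (adj C (\<kappa> i)) (adj C g) = idm C (Ai i)"
    using adj_cmp[OF ki g(1)] by (simp add: gk adj_id)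
  have g1: "nrm C (cmp C g (adj C g)) \<le> 1" using nrm_mult_star[OF g(1)] n nrm_id_le[of "Ai i"] by simp
  let ?d = "hsub g (adj C (\<kappa> i))"
  let ?E = "emb (Ai i)"
  let ?gg = "cmp C g (adj C g)" and ?kk = "cmp C (adj C (\<kappa> i)) (\<kappa> i)"
  have d: "?d \<in> Hom C A (Ai i)" by (rule sub_hom[OF g(1) aki])
  have gg: "?gg \<in> Hom C (Ai i) (Ai i)" and kk: "?kk \<in> Hom C (Ai i) (Ai i)"
    by (rule cmp_hom[OF ag g(1)], rule cmp_hom[OF ki aki])
  \<comment> \<open>Since \<open>g\<close> is a left inverse of \<open>\<kappa> i\<close>, both
    mixed terms are identities. Pairing each with \<open>?gg\<close> or \<open>?kk\<close> leaves a
    negative element minus a positive one.\<close>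
  have "cmp C ?d (adj C ?d) = hsub (hsub ?gg (idm C (Ai i))) (hsub (idm C (Ai i)) ?kk)"
    using gk kg by (simp only: adj_sub[OF g(1) aki] adj_adj[OF ki]
        cmp_sub_right[OF ag ki d] cmp_sub_left[OF ag g(1) aki] cmp_sub_left[OF ki g(1) aki])
  then have dd: "?E (cmp C ?d (adj C ?d)) = (?E ?gg - ?E (idm C (Ai i))) - (?E (idm C (Ai i)) - ?E ?kk)"
    by (simp only: emb_sub[OF gg id_hom] emb_sub[OF id_hom kk] emb_sub[OF sub_hom[OF gg id_hom] sub_hom[OF id_hom kk]])
  have 1: "hpos (Ai i) (hsub (idm C (Ai i)) ?gg)"
    by (rule hpos_id_sub[OF gg _ g1]) (simp add: adj_cmp[OF ag g(1)] adj_adj[OF g(1)])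
  have 2: "hpos (Ai i) (hsub (idm C (Ai i)) ?kk)"
    by (rule hpos_id_sub[OF kk _ k1]) (simp add: adj_cmp[OF ki aki] adj_adj[OF ki])
  have "pos (?E (idm C (Ai i)) - ?E ?gg + (?E (idm C (Ai i)) - ?E ?kk))"
    using 1 2 by (intro pos_add) (simp_all add: hpos_def emb_sub[OF id_hom gg] emb_sub[OF id_hom kk])
  then have "pos (- ?E (cmp C ?d (adj C ?d)))" unfolding dd by (simp add: algebra_simps)
  then have "?E (cmp C ?d (adj C ?d)) = 0"
    using hpos_mult_star[OF d] by (intro pos_antisym) (auto simp: hpos_def)
  then have "nrm C (cmp C ?d (adj C ?d)) = 0"
    using norm_emb[OF cmp_self_adj_hom[OF d]] by simp
  then have "?d = hzero C A (Ai i)" using nrm_mult_star[OF d] nrm_eq_zero[OF d] by simp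
  then have "g = adj C (\<kappa> i)" by (rule sub_eq_zero[OF g(1) aki])
  then show "j \<in> I \<Longrightarrow> cmp C (adj C (\<kappa> i)) (\<kappa> j) = (if i = j then idm C (Ai i) else hzero C (Ai j) (Ai i))"
    using g(2) by (simp add: f_def)
qed

end

section \<open>Orthonormal families and their partial sums\<close>

locale orthonormal_family = wstar_category C
  for C :: "('o,'m) wcat" +
  fixes I :: "'i set" and Ai :: "'i \<Rightarrow> 'o" and A :: 'o and \<kappa> :: "'i \<Rightarrow> 'm"
  assumes \<kappa>: "\<And>j. j \<in> I \<Longrightarrow> \<kappa> j \<in> Hom C (Ai j) A"
    and orth: "\<And>i j. i \<in> I \<Longrightarrow> j \<in> I \<Longrightarrow>
      cmp C (adj C (\<kappa> i)) (\<kappa> j) = (if i = j then idm C (Ai i) else hzero C (Ai j) (Ai i))"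
begin

abbreviation range_proj :: "'i \<Rightarrow> 'm" where "range_proj j \<equiv> cmp C (\<kappa> j) (adj C (\<kappa> j))"

lemma range_proj_hom: "j \<in> I \<Longrightarrow> range_proj j \<in> Hom C A A"
  using \<kappa> by (rule cmp_self_adj_hom)

lemma adj_range_proj: "j \<in> I \<Longrightarrow> adj C (range_proj j) = range_proj j"
  by (simp add: adj_cmp[OF adj_hom[OF \<kappa>] \<kappa>] adj_adj[OF \<kappa>])

lemma range_proj_cmp:
  assumes "i \<in> I" "j \<in> I"
  shows "cmp C (range_proj i) (\<kappa> j) = (if i = j then \<kappa> j else hzero C (Ai j) A)"
  using assms cmp_assoc[OF \<kappa>[OF assms(2)] adj_hom[OF \<kappa>[OF assms(1)]] \<kappa>[OF assms(1)]]
  by (simp add: orth cmp_id(1)[OF \<kappa>] cmp_zero_right[OF \<kappa>])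

lemma range_proj_idem:
  assumes "j \<in> I"
  shows "cmp C (range_proj j) (range_proj j) = range_proj j"
  using cmp_assoc[OF adj_hom[OF \<kappa>[OF assms]] \<kappa>[OF assms] range_proj_hom[OF assms]]
  by (simp add: range_proj_cmp assms)

text \<open>By orthonormality the finite sum extends the part of \<open>f\<close> over
  \<open>F\<close>, and its squared norm is the norm of the partial sum of \<open>f\<close>. This is
  how norms of sums become norms of morphisms.\<close>

lemma hsum_cmp_adj:
  assumes f: "\<And>i. i \<in> I \<Longrightarrow> f i \<in> Hom C (Ai i) B" and F: "finite F" "F \<subseteq> I"
  shows "hsum A B F (\<lambda>i. cmp C (f i) (adj C (\<kappa> i))) \<in> Hom C A B" (is "?g \<in> _")
    and "j \<in> I \<Longrightarrow> cmp C (hsum A B F (\<lambda>i. cmp C (f i) (adj C (\<kappa> i)))) (\<kappa> j) =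
      (if j \<in> F then f j else hzero C (Ai j) B)"
    and "cmp C (hsum A B F (\<lambda>i. cmp C (f i) (adj C (\<kappa> i)))) (adj C (hsum A B F (\<lambda>i. cmp C (f i) (adj C (\<kappa> i))))) =
      hsum B B F (\<lambda>i. cmp C (f i) (adj C (f i)))"
proof -
  have h: "cmp C (f i) (adj C (\<kappa> i)) \<in> Hom C A B" if "i \<in> F" for i
    using that F f[of i] \<kappa>[of i] by (auto intro: cmp_hom adj_hom)
  show g: "?g \<in> Hom C A B" by (rule hsum_hom[OF F(1) h])
  show gk: "cmp C ?g (\<kappa> j) = (if j \<in> F then f j else hzero C (Ai j) B)" if j: "j \<in> I" for j
  proof -
    have eq: "cmp C (cmp C (f i) (adj C (\<kappa> i))) (\<kappa> j) = (if i = j then f j else hzero C (Ai j) B)"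
      if "i \<in> F" for i
    proof -
      have i: "i \<in> I" using that F by auto
      show ?thesis
        using cmp_assoc[OF \<kappa>[OF j] adj_hom[OF \<kappa>[OF i]] f[OF i]] i j
        by (simp add: orth cmp_id(1)[OF f] cmp_zero_right[OF f])
    qed
    have "cmp C ?g (\<kappa> j) = hsum (Ai j) B F (\<lambda>i. cmp C (cmp C (f i) (adj C (\<kappa> i))) (\<kappa> j))"
      by (rule cmp_hsum_left[OF F(1) h \<kappa>[OF j]])
    also have "\<dots> = (if j \<in> F then cmp C (cmp C (f j) (adj C (\<kappa> j))) (\<kappa> j) else hzero C (Ai j) B)"
      by (rule hsum_single[OF F(1)]) (use eq f[OF j] in auto)
    finally show ?thesis using eq by simp
  qed
  have "adj C ?g = hsum B A F (\<lambda>i. adj C (cmp C (f i) (adj C (\<kappa> i))))"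
    by (rule adj_hsum[OF F(1) h])
  also have "\<dots> = hsum B A F (\<lambda>i. cmp C (\<kappa> i) (adj C (f i)))"
  proof (rule hsum_cong[OF F(1) adj_hom[OF h]])
    fix i assume "i \<in> F"
    then have i: "i \<in> I" using F by auto
    show "adj C (cmp C (f i) (adj C (\<kappa> i))) = cmp C (\<kappa> i) (adj C (f i))"
      by (simp add: adj_cmp[OF adj_hom[OF \<kappa>[OF i]] f[OF i]] adj_adj[OF \<kappa>[OF i]])
  qed
  finally have "cmp C ?g (adj C ?g) = cmp C ?g (hsum B A F (\<lambda>i. cmp C (\<kappa> i) (adj C (f i))))" by simp
  also have "\<dots> = hsum B B F (\<lambda>i. cmp C ?g (cmp C (\<kappa> i) (adj C (f i))))"
    by (rule cmp_hsum_right[OF F(1) _ g]) (use F f \<kappa> in \<open>auto intro!: cmp_hom adj_hom\<close>)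
  also have "\<dots> = hsum B B F (\<lambda>i. cmp C (f i) (adj C (f i)))"
  proof (rule hsum_cong[OF F(1)])
    fix i assume iF: "i \<in> F"
    then have i: "i \<in> I" using F by auto
    show "cmp C ?g (cmp C (\<kappa> i) (adj C (f i))) = cmp C (f i) (adj C (f i))"
      using cmp_assoc[OF adj_hom[OF f[OF i]] \<kappa>[OF i] g] gk[OF i] iF by simp
    then show "cmp C ?g (cmp C (\<kappa> i) (adj C (f i))) \<in> Hom C B B"
      using cmp_self_adj_hom[OF f[OF i]] by simp
  qed
  finally show "cmp C ?g (adj C ?g) = hsum B B F (\<lambda>i. cmp C (f i) (adj C (f i)))" .
qed

text \<open>The case \<open>f = \<kappa>\<close> of \<open>hsum_cmp_adj\<close>: each partial sum
  equals its product with its own adjoint, so it is a projection.\<close>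

lemma sum_range_proj:
  assumes F: "finite F" "F \<subseteq> I"
  shows "hsum A A F range_proj \<in> Hom C A A"
    and "j \<in> I \<Longrightarrow> cmp C (hsum A A F range_proj) (\<kappa> j) = (if j \<in> F then \<kappa> j else hzero C (Ai j) A)"
    and "nrm C (hsum A A F range_proj) \<le> 1"
    and "cmp C (hsum A A F range_proj) (adj C (hsum A A F range_proj)) = hsum A A F range_proj"
proof -
  show h: "hsum A A F range_proj \<in> Hom C A A"
    and "j \<in> I \<Longrightarrow> cmp C (hsum A A F range_proj) (\<kappa> j) = (if j \<in> F then \<kappa> j else hzero C (Ai j) A)"
    and pp: "cmp C (hsum A A F range_proj) (adj C (hsum A A F range_proj)) = hsum A A F range_proj"
    using hsum_cmp_adj[OF \<kappa> F] by auto
  have "nrm C (hsum A A F range_proj) * nrm C (hsum A A F range_proj) = nrm C (hsum A A F range_proj)"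
    using nrm_mult_star[OF h] pp by (simp add: power2_eq_square)
  then have "nrm C (hsum A A F range_proj) = 0 \<or> nrm C (hsum A A F range_proj) = 1"
    by (simp only: mult_cancel_right2)
  then show "nrm C (hsum A A F range_proj) \<le> 1" by linarith
qed

text \<open>Composition with \<open>\<kappa> j\<close> is reduced to composition with its range
  projection: subtracting \<open>c\<close> composed with the adjoint of \<open>\<kappa> j\<close>
  makes \<open>y k\<close> annihilate that projection, and \<open>wlim_cmp_projection_zero\<close>
  carries this to the limit.\<close>

lemma wlim_cmp_eventually_eq:
  assumes P: "is_predual C A B P" and l: "wlim A B P G y x" and G: "G \<noteq> bot" and j: "j \<in> I"
    and c: "c \<in> Hom C (Ai j) B"
    and y: "\<forall>\<^sub>F k in G. y k \<in> Hom C A B \<and> nrm C (y k) \<le> K \<and> cmp C (y k) (\<kappa> j) = c"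
  shows "cmp C x (\<kappa> j) = c"
proof -
  note k = \<kappa>[OF j] note ak = adj_hom[OF k]
  let ?w = "hsmul C (- 1) (cmp C c (adj C (\<kappa> j)))"
  have cw: "cmp C c (adj C (\<kappa> j)) \<in> Hom C A B" by (rule cmp_hom[OF ak c])
  have w: "?w \<in> Hom C A B" by (rule smul_hom[OF cw])
  have x: "x \<in> Hom C A B" using l by (simp add: wlim_def)
  have yh: "\<forall>\<^sub>F k in G. y k \<in> Hom C A B" using y by eventually_elim simp
  have cp: "cmp C (cmp C c (adj C (\<kappa> j))) (\<kappa> j) = c"
    using cmp_assoc[OF k ak c] orth[OF j j] by (simp add: cmp_id(1)[OF c])
  have sub: "cmp C (hadd C z ?w) (\<kappa> j) = hsub (cmp C z (\<kappa> j)) c" if "z \<in> Hom C A B" for z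
    using cmp_sub_left[OF k that cw] cp by simp
  have "cmp C (hadd C x ?w) (range_proj j) = hzero C A B"
  proof (rule wlim_cmp_projection_zero[OF P wlim_add[OF P l w yh] G
        range_proj_hom[OF j] range_proj_idem[OF j] adj_range_proj[OF j]])
    show "\<forall>\<^sub>F k in G. hadd C (y k) ?w \<in> Hom C A B \<and> nrm C (hadd C (y k) ?w) \<le> K + nrm C ?w \<and>
        cmp C (hadd C (y k) ?w) (range_proj j) = hzero C A B"
      using y
    proof eventually_elim
      case (elim k')
      then have yk: "y k' \<in> Hom C A B" by simp
      have "cmp C (hadd C (y k') ?w) (range_proj j) = cmp C (hsub (cmp C (y k') (\<kappa> j)) c) (adj C (\<kappa> j))"
        using cmp_assoc[OF ak k add_hom[OF yk w]] sub[OF yk] by simp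
      also have "\<dots> = hzero C A B"
        using elim sub_self[OF c] cmp_zero_left[OF ak] by simp
      finally show ?case using elim nrm_add[OF yk w] add_hom[OF yk w] by auto
    qed
  qed
  then have "cmp C (cmp C (hadd C x ?w) (range_proj j)) (\<kappa> j) = hzero C (Ai j) B"
    by (simp add: cmp_zero_left[OF k])
  then have "cmp C (hadd C x ?w) (\<kappa> j) = hzero C (Ai j) B"
    using cmp_assoc[OF k range_proj_hom[OF j] add_hom[OF x w]] range_proj_cmp[OF j j] by simp
  then show ?thesis using sub[OF x] sub_eq_zero[OF cmp_hom[OF k x] c] by simp
qed

end

context wstar_category
begin

section \<open>Universal families are the complete orthonormal ones\<close>

lemma orthonormal_sum_of_universal_sum:
  assumes univ: "universal_sum I Ai A \<kappa>"
  shows "orthonormal_sum I Ai A \<kappa>"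
proof -
  note u = universal_sumD[OF univ]
  interpret orthonormal_family C I Ai A \<kappa>
    using u(1) universal_sum_adj[OF univ] by unfold_locales
  let ?p = "\<lambda>j. cmp C (\<kappa> j) (adj C (\<kappa> j))"
  note ph = range_proj_hom and sp = sum_range_proj
  have p: "hpos A (?p j)" if "j \<in> I" for j using u(1)[OF that] by (rule hpos_mult_star)
  obtain s where s: "uw_has_sum C A I ?p s"
    using uw_has_sum_of_bdd[OF p sp(3)] by blast
  have sh: "s \<in> Hom C A A" using s by (simp add: uw_has_sum_def)
  obtain P where P: "is_predual C A A P" using predual_exists by blast
  have l: "wlim A A P (finite_subsets_at_top I) (\<lambda>F. hsum A A F ?p) s"
    by (rule wlim_of_uw_has_sum[OF s ph P])
  have sk: "cmp C s (\<kappa> j) = \<kappa> j" if j: "j \<in> I" for j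
  proof (rule wlim_cmp_eventually_eq[OF P l finite_subsets_at_top_neq_bot j u(1)[OF j]])
    show "\<forall>\<^sub>F F in finite_subsets_at_top I. hsum A A F ?p \<in> Hom C A A \<and>
        nrm C (hsum A A F ?p) \<le> 1 \<and> cmp C (hsum A A F ?p) (\<kappa> j) = \<kappa> j"
    proof (rule eventually_mono[OF eventually_superset[of "{j}" I]])
      fix F assume "finite F \<and> {j} \<subseteq> F \<and> F \<subseteq> I"
      then have F: "finite F" "F \<subseteq> I" "j \<in> F" by auto
      show "hsum A A F ?p \<in> Hom C A A \<and>
        nrm C (hsum A A F ?p) \<le> 1 \<and> cmp C (hsum A A F ?p) (\<kappa> j) = \<kappa> j"
        using sp(1,3)[OF F(1,2)] sp(2)[OF F(1,2) j] F(3) by simp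
    qed (use j in auto)
  qed
  let ?\<kappa> = "\<lambda>i\<in>I. cmp C (idm C A) (\<kappa> i)"
  have \<kappa>d: "?\<kappa> \<in> dsum C I Ai A" by (rule restrict_cmp_in_dsum[OF u(1,2) id_hom])
  have "s = idm C A"
    by (rule u(4)[OF \<kappa>d sh id_hom]) (simp_all add: sk cmp_id(2)[OF u(1)])
  then show ?thesis unfolding orthonormal_sum_def using u(1) orth s by blast
qed

lemma universal_sum_of_orthonormal_sum:
  assumes os: "orthonormal_sum I Ai A \<kappa>"
  shows "universal_sum I Ai A \<kappa>"
proof -
  interpret orthonormal_family C I Ai A \<kappa>
    using os by unfold_locales (auto simp: orthonormal_sum_def)
  have one: "uw_has_sum C A I (\<lambda>j. cmp C (\<kappa> j) (adj C (\<kappa> j))) (idm C A)"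
    using os unfolding orthonormal_sum_def by blast
  let ?p = "\<lambda>j. cmp C (\<kappa> j) (adj C (\<kappa> j))"
  note ph = range_proj_hom and sp = sum_range_proj
  have inj: "d = hzero C A B" if d: "d \<in> Hom C A B" and dk: "\<And>j. j \<in> I \<Longrightarrow> cmp C d (\<kappa> j) = hzero C (Ai j) B"
    for B d
  proof -
    \<comment> \<open>An endomorphism of \<open>A\<close> can be compared with
      \<open>idm C A\<close>, which is the known weak limit of the partial sums.\<close>
    define h where "h = cmp C (adj C d) d"
    have h: "h \<in> Hom C A A" unfolding h_def by (rule cmp_hom[OF d adj_hom[OF d]])
    have ah: "adj C h = h" by (simp add: h_def adj_cmp[OF d adj_hom[OF d]] adj_adj[OF d])
    have hk: "cmp C h (\<kappa> j) = hzero C (Ai j) A" if "j \<in> I" for j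
      using cmp_assoc[OF \<kappa>[OF that] d adj_hom[OF d]] dk[OF that] cmp_zero_right[OF adj_hom[OF d]]
      by (simp add: h_def)
    have hp: "cmp C h (hsum A A F ?p) = hzero C A A" if F: "finite F" "F \<subseteq> I" for F
    proof -
      have z: "cmp C h (?p j) = hzero C A A" if "j \<in> F" for j
      proof -
        have j: "j \<in> I" using that F by auto
        show ?thesis
          using cmp_assoc[OF adj_hom[OF \<kappa>[OF j]] \<kappa>[OF j] h] hk[OF j] cmp_zero_left[OF adj_hom[OF \<kappa>[OF j]]]
          by simp
      qed
      have "cmp C h (hsum A A F ?p) = hsum A A F (\<lambda>j. cmp C h (?p j))"
        by (rule cmp_hsum_right[OF F(1) _ h]) (use F ph in auto)
      \<comment> \<open>All summands vanish, so any index can play the exceptional one;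
        \<open>undefined\<close> is an arbitrary choice.\<close>
      also have "\<dots> = hzero C A A"
        using hsum_single[OF F(1), of undefined "\<lambda>j. cmp C h (?p j)" A A] z by auto
      finally show ?thesis .
    qed
    obtain P where P: "is_predual C A A P" using predual_exists by blast
    have l: "wlim A A P (finite_subsets_at_top I) (\<lambda>F. hsum A A F ?p) (idm C A)"
      by (rule wlim_of_uw_has_sum[OF one ph P])
    have "h = hzero C A A"
    proof (rule eq_zero_of_nrm_add_smul_id[OF h ah, where K="nrm C h"])
      fix n :: real
      let ?c = "complex_of_real n"
      have ev: "\<forall>\<^sub>F F in finite_subsets_at_top I. hsum A A F ?p \<in> Hom C A A"
        using eventually_finite_subset by eventually_elim (use sp(1) in blast)
      have l': "wlim A A P (finite_subsets_at_top I) (\<lambda>F. hsmul C ?c (hsum A A F ?p)) (hsmul C ?c (idm C A))"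
        by (rule wlim_smul[OF P l ev])
      have "nrm C (hadd C (hsmul C ?c (idm C A)) h) \<le> sqrt ((nrm C h)\<^sup>2 + n\<^sup>2)"
      proof (rule wlim_add_nrm_le[OF P l' finite_subsets_at_top_neq_bot h])
        show "\<forall>\<^sub>F F in finite_subsets_at_top I. hsmul C ?c (hsum A A F ?p) \<in> Hom C A A \<and>
            nrm C (hadd C (hsmul C ?c (hsum A A F ?p)) h) \<le> sqrt ((nrm C h)\<^sup>2 + n\<^sup>2)"
          using eventually_finite_subset
        proof eventually_elim
          case (elim F)
          then have F: "finite F" "F \<subseteq> I" by auto
          let ?S = "hsum A A F ?p"
          have S: "?S \<in> Hom C A A" by (rule sp(1)[OF F])
          \<comment> \<open>The partial sum equals its product with its adjoint, and that product is
            self-adjoint.\<close>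
          have aS: "adj C ?S = ?S"
            using adj_cmp[OF adj_hom[OF S] S] sp(4)[OF F] by (simp add: adj_adj[OF S])
          have "cmp C h (adj C (hsmul C ?c ?S)) = hzero C A A"
            using cmp_smul_right[OF S h] hp[OF F] by (simp add: adj_smul[OF S] aS smul_zero_right)
          then have "(nrm C (hadd C h (hsmul C ?c ?S)))\<^sup>2 \<le> (nrm C h)\<^sup>2 + (nrm C (hsmul C ?c ?S))\<^sup>2"
            by (rule pythagoras_le[OF h smul_hom[OF S]])
          also have "(nrm C (hsmul C ?c ?S))\<^sup>2 \<le> n\<^sup>2"
            using nrm_smul[OF S, of ?c] sp(3)[OF F] nrm_nonneg[OF S]
            by (simp add: power_mult_distrib mult_left_le power_le_one)
          finally have "(nrm C (hadd C (hsmul C ?c ?S) h))\<^sup>2 \<le> (nrm C h)\<^sup>2 + n\<^sup>2"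
            using add_commute[OF h smul_hom[OF S]] by simp
          then show ?case using S by (auto intro: real_le_rsqrt smul_hom)
        qed
      qed
      then have "nrm C (hadd C h (hsmul C ?c (idm C A))) \<le> sqrt ((nrm C h)\<^sup>2 + n\<^sup>2)"
        using add_commute[OF h smul_hom[OF id_hom]] by simp
      then show "(nrm C (hadd C h (hsmul C ?c (idm C A))))\<^sup>2 \<le> (nrm C h)\<^sup>2 + n\<^sup>2"
        using sqrt_ge_absD nrm_nonneg[OF add_hom[OF h smul_hom[OF id_hom]]] by (metis abs_of_nonneg)
    qed
    then show ?thesis using eq_zero_of_star_mult[OF d] by (simp add: h_def)
  qed
  show ?thesis
    unfolding universal_sum_def
  proof (intro conjI allI ballI impI)
    show "\<kappa> j \<in> Hom C (Ai j) A" if "j \<in> I" for j by (rule \<kappa>[OF that])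
    show "bdd_sum C A I ?p" unfolding bdd_sum_iff using sp(3) by blast
  next
    fix B f g g'
    assume g: "g \<in> Hom C A B" "g' \<in> Hom C A B"
      and eq: "\<forall>j\<in>I. cmp C g (\<kappa> j) = f j" "\<forall>j\<in>I. cmp C g' (\<kappa> j) = f j"
    have "hsub g g' = hzero C A B"
    proof (rule inj[OF sub_hom[OF g]])
      fix j assume j: "j \<in> I"
      have "cmp C (hsub g g') (\<kappa> j) = hsub (cmp C g (\<kappa> j)) (cmp C g' (\<kappa> j))"
        by (rule cmp_sub_left[OF \<kappa>[OF j] g])
      also have "\<dots> = hzero C (Ai j) B"
        using eq j sub_self[OF cmp_hom[OF \<kappa>[OF j] g(1)]] by simp
      finally show "cmp C (hsub g g') (\<kappa> j) = hzero C (Ai j) B" .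
    qed
    then show "g = g'" by (rule sub_eq_zero[OF g])
  next
    fix B f assume f: "f \<in> dsum C I Ai B"
    note fh = dsumD(1)[OF f]
    let ?q = "\<lambda>i. cmp C (f i) (adj C (f i))"
    let ?g = "\<lambda>F. hsum A B F (\<lambda>i. cmp C (f i) (adj C (\<kappa> i)))"
    have gF: "?g F \<in> Hom C A B" "j \<in> I \<Longrightarrow> cmp C (?g F) (\<kappa> j) = (if j \<in> F then f j else hzero C (Ai j) B)"
      "cmp C (?g F) (adj C (?g F)) = hsum B B F ?q" if "finite F" "F \<subseteq> I" for F j
      using hsum_cmp_adj[of f B F] fh that by blast+
    have q: "hpos B (?q i)" if "i \<in> I" for i using fh[OF that] by (rule hpos_mult_star)
    have nsq: "nrm C (hsum B B F ?q) = (nrm C (?g F))\<^sup>2" if "finite F" "F \<subseteq> I" for F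
      using nrm_mult_star[OF gF(1)[OF that]] gF(3)[OF that] by simp
    obtain K where K: "\<And>F. finite F \<Longrightarrow> F \<subseteq> I \<Longrightarrow> nrm C (hsum B B F ?q) \<le> K"
      using dsumD(3)[OF f] unfolding bdd_sum_iff by blast
    obtain s where s: "uw_has_sum C B I ?q s" and "nrm C s \<le> K"
      and ub: "\<And>F. finite F \<Longrightarrow> F \<subseteq> I \<Longrightarrow> hpos B (hsub s (hsum B B F ?q))"
      using uw_has_sum_of_bdd[OF q K] by blast
    have sh: "s \<in> Hom C B B" using s by (simp add: uw_has_sum_def)
    have g_le: "nrm C (?g F) \<le> sqrt (nrm C s)" if F: "finite F" "F \<subseteq> I" for F
    proof (rule real_le_rsqrt)
      have "hpos B (hsum B B F ?q)"
        using hpos_mult_star[OF gF(1)[OF F]] gF(3)[OF F] by simp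
      then have "nrm C (hsum B B F ?q) \<le> nrm C s" by (rule hpos_norm_mono[OF _ sh ub[OF F]])
      then show "(nrm C (?g F))\<^sup>2 \<le> nrm C s" using nsq[OF F] by simp
    qed
    obtain P where P: "is_predual C A B P" using predual_exists by blast
    have ev: "\<forall>\<^sub>F F in finite_subsets_at_top I. ?g F \<in> Hom C A B \<and> nrm C (?g F) \<le> sqrt (nrm C s)"
      using eventually_finite_subset by eventually_elim (use gF(1) g_le in blast)
    obtain G g where G: "G \<le> finite_subsets_at_top I" "G \<noteq> bot" and l: "wlim A B P G ?g g"
      and gs: "nrm C g \<le> sqrt (nrm C s)"
      by (rule wlim_cluster[OF P finite_subsets_at_top_neq_bot ev])
    have g: "g \<in> Hom C A B" using l by (simp add: wlim_def)
    have gk: "cmp C g (\<kappa> j) = f j" if j: "j \<in> I" for j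
    proof (rule wlim_cmp_eventually_eq[OF P l G(2) j fh[OF j]])
      have "\<forall>\<^sub>F F in G. finite F \<and> {j} \<subseteq> F \<and> F \<subseteq> I"
        by (rule filter_leD[OF G(1) eventually_superset]) (use j in auto)
      then show "\<forall>\<^sub>F F in G. ?g F \<in> Hom C A B \<and> nrm C (?g F) \<le> sqrt (nrm C s) \<and> cmp C (?g F) (\<kappa> j) = f j"
      proof eventually_elim
        case (elim F)
        then have F: "finite F" "F \<subseteq> I" "j \<in> F" by auto
        show ?case using gF(1)[OF F(1,2)] g_le[OF F(1,2)] gF(2)[OF F(1,2) j] F(3) by simp
      qed
    qed
    \<comment> \<open>The cluster point gave only an upper bound for the norm of \<open>g\<close>.
      Conversely \<open>?g F\<close> is \<open>g\<close> composed with a projection, so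
      \<open>g\<close> bounds all partial sums.\<close>
    have q_le: "nrm C (hsum B B F ?q) \<le> (nrm C g)\<^sup>2" if F: "finite F" "F \<subseteq> I" for F
    proof -
      let ?S = "hsum A A F ?p"
      have "?g F = cmp C g ?S"
      proof -
        have "cmp C g ?S = hsum A B F (\<lambda>i. cmp C g (?p i))"
          by (rule cmp_hsum_right[OF F(1) _ g]) (use F ph in auto)
        also have "\<dots> = ?g F"
        proof (rule hsum_cong[OF F(1)])
          fix i assume "i \<in> F"
          then have i: "i \<in> I" using F by auto
          show "cmp C g (?p i) \<in> Hom C A B" by (rule cmp_hom[OF ph[OF i] g])
          show "cmp C g (?p i) = cmp C (f i) (adj C (\<kappa> i))"
            using cmp_assoc[OF adj_hom[OF \<kappa>[OF i]] \<kappa>[OF i] g] gk[OF i] by simp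
        qed
        finally show ?thesis by simp
      qed
      then have "nrm C (?g F) \<le> nrm C g * nrm C ?S" using nrm_cmp[OF sp(1)[OF F] g] by simp
      also have "\<dots> \<le> nrm C g" using sp(3)[OF F] nrm_nonneg[OF g] by (simp add: mult_left_le)
      finally show ?thesis using nsq[OF F] nrm_nonneg[OF gF(1)[OF F]] by (simp add: power_mono)
    qed
    \<comment> \<open>Convergence is applied again with the bound \<open>(nrm C g)^2\<close>. The
      sum is unique, so \<open>s\<close> inherits this bound.\<close>
    obtain s' where s': "uw_has_sum C B I ?q s'" "nrm C s' \<le> (nrm C g)\<^sup>2"
      using uw_has_sum_of_bdd[OF q q_le] by blast
    have "nrm C s \<le> (nrm C g)\<^sup>2" using s'(2) uw_has_sum_unique[OF s s'(1)] by simp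
    moreover have "(nrm C g)\<^sup>2 \<le> nrm C s"
      using power_mono[OF gs nrm_nonneg[OF g], of 2] nrm_nonneg[OF sh] by simp
    ultimately have "(nrm C g)\<^sup>2 = nrm C (uw_sum C B I ?q)" using uw_sum_eq[OF s] by simp
    with g gk show "\<exists>g\<in>Hom C A B. (\<forall>j\<in>I. cmp C g (\<kappa> j) = f j) \<and>
        (nrm C g)\<^sup>2 = nrm C (uw_sum C B I ?q)"
      by blast
  qed
qed

end

theorem theorem5p1:
  fixes C :: "('o,'m) wcat" and I :: "'i set" and Ai :: "'i \<Rightarrow> 'o" and A :: 'o
  assumes "wstar_cat C"
  shows "(is_direct_sum C I Ai A \<longleftrightarrow>
           (\<exists>\<kappa>. (\<forall>j\<in>I. \<kappa> j \<in> Hom C (Ai j) A) \<and>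
              bdd_sum C A I (\<lambda>j. cmp C (\<kappa> j) (adj C (\<kappa> j))) \<and>
              (\<forall>B. \<forall>f\<in>dsum C I Ai B.
                 (\<exists>g\<in>Hom C A B. (\<forall>j\<in>I. cmp C g (\<kappa> j) = f j) \<and>
                    (nrm C g)\<^sup>2 = nrm C (uw_sum C B I (\<lambda>j. cmp C (f j) (adj C (f j))))) \<and>
                 (\<forall>g\<in>Hom C A B. \<forall>g'\<in>Hom C A B.
                    (\<forall>j\<in>I. cmp C g (\<kappa> j) = f j) \<longrightarrow> (\<forall>j\<in>I. cmp C g' (\<kappa> j) = f j) \<longrightarrow> g = g'))))
       \<and>
       (is_direct_sum C I Ai A \<longleftrightarrow>
           (\<exists>\<kappa>. (\<forall>j\<in>I. \<kappa> j \<in> Hom C (Ai j) A) \<and>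
              (\<forall>i\<in>I. \<forall>j\<in>I. cmp C (adj C (\<kappa> i)) (\<kappa> j) =
                  (if i = j then idm C (Ai i) else hzero C (Ai j) (Ai i))) \<and>
              uw_has_sum C A I (\<lambda>j. cmp C (\<kappa> j) (adj C (\<kappa> j))) (idm C A)))"
proof -
  interpret wstar_category C using assms by (rule wstar_category.intro)
  have 2: "is_direct_sum C I Ai A \<longleftrightarrow> (\<exists>\<kappa>. universal_sum I Ai A \<kappa>)"
    using universal_sum_of_is_direct_sum is_direct_sum_of_universal_sum by blast
  have 3: "(\<exists>\<kappa>. universal_sum I Ai A \<kappa>) \<longleftrightarrow> (\<exists>\<kappa>. orthonormal_sum I Ai A \<kappa>)"
    using orthonormal_sum_of_universal_sum universal_sum_of_orthonormal_sum by blast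
  show ?thesis
    by (rule conjI, rule 2[unfolded universal_sum_def],
        rule trans[OF 2 3, unfolded orthonormal_sum_def])
qed

end
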